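(* Let $n,k\ge 1$ and let $R$ be any ring with parameters as in the definition of the cyclotomic BMW algebra $\mathscr B_n^k=\mathscr B_n^k(R)$. For each $0\le l\le n$ let $\mathfrak W_{l,k}$ be an arbitrary $R$-basis of the Ariki-Koike algebra $\mathfrak h_{l,k}(R)$, let $\overline{\mathfrak W}_{l,k}\subseteq\mathscr B_l^k$ be any subset of the same cardinality mapped by $\pi_l$ onto $\mathfrak W_{l,k}$, and let $\widetilde{\mathfrak W}_{l,k}$ be the image of $\overline{\mathfrak W}_{l,k}$ in $\mathscr B_n^k$. Then $\mathscr B_n^k$ is spanned over $R$ by the set of elements of the form $$Y_{i_1}'^{\,s_1}Y_{i_2}'^{\,s_2}\cdots Y_{i_f}'^{\,s_f}\,(X_{i_1}\cdots X_{j_1-1}e_{j_1}\cdots e_{n-2}e_{n-1})\cdots(X_{i_f}\cdots X_{j_f-1}e_{j_f}\cdots e_{n-2f}e_{n-2f+1})\,\chi^{(n-2f)}$$ $$\cdot\,(e_{n-2f+1}e_{n-2f}\cdots e_{h_f}X_{h_f-1}\cdots X_{g_f})\cdots(e_{n-1}e_{n-2}\cdots e_{h_1}X_{h_1-1}\cdots X_{g_1})\,Y_{g_f}'^{\,t_f}\cdots Y_{g_2}'^{\,t_2}Y_{g_1}'^{\,t_1},$$ where $f=0,1,\dots,\lfloor n/2\rfloor$, $i_1>i_2>\dots>i_f$, $g_1>g_2>\dots>g_f$, and for each $m=1,\dots,f$ we have $1\le i_m\le j_m\le n-2m+1$ and $1\le g_m\le h_m\le n-2m+1$, $s_1,\dots,s_f,t_1,\dots,t_f\in\{\lfloor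 k/2\rfloor-(k-1),\dots,\lfloor k/2\rfloor\}$, and $\chi^{(n-2f)}\in\widetilde{\mathfrak W}_{n-2f,k}$.
   Context: Fix natural numbers $n,k\ge 1$. Let $R$ be a unital commutative ring containing units $A_0,q_0,q,\lambda$ and elements $q_1,\dots,q_{k-1},A_1,\dots,A_{k-1}$ such that $\lambda-\lambda^{-1}=\delta(1-A_0)$, where $\delta:=q-q^{-1}$. The cyclotomic BMW algebra $\mathscr B_n^k=\mathscr B_n^k(R)$ is the unital associative $R$-algebra generated by $Y^{\pm1},X_1^{\pm1},\dots,X_{n-1}^{\pm1},e_1,\dots,e_{n-1}$ subject to the following relations (for all indices for which they make sense): $X_i-X_i^{-1}=\delta(1-e_i)$; $X_iX_j=X_jX_i$, $X_ie_j=e_jX_i$, $e_ie_j=e_je_i$ for $|i-j|\ge2$; $X_iX_{i+1}X_i=X_{i+1}X_iX_{i+1}$; $X_ie_i=e_iX_i=\lambda e_i$; $X_iX_je_i=e_je_i=e_jX_iX_j$ for $|i-j|=1$; $e_ie_{i\pm1}e_i=e_i$; $e_i^2=A_0e_i$; $Y^k=\sum_{i=0}^{k-1}q_iY^i$; $X_1YX_1Y=YX_1YX_1$; $YX_i=X_iY$ and $Ye_i=e_iY$ for $i>1$; $YX_1Ye_1=\lambda^{-1}e_1=e_1YX_1Y$; $e_1Y^me_1=A_me_1$ for $0\le m\le k-1$. By convention $\mathscr B_0^k=R$. For $1\le i\le n$ put $Y_i':=X_{i-1}\cdots X_2X_1YX_1X_2\cdots X_{i-1}$ (so $Y_1'=Y$).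 For $l\ge1$, the Ariki-Koike algebra $\mathfrak h_{l,k}(R)$ is the unital associative $R$-algebra with generators $T_0^{\pm1},T_1^{\pm1},\dots,T_{l-1}^{\pm1}$ and relations $T_0T_1T_0T_1=T_1T_0T_1T_0$; $T_iT_{i+1}T_i=T_{i+1}T_iT_{i+1}$ for $1\le i\le l-2$; $T_iT_j=T_jT_i$ for $|i-j|\ge2$; $T_0^k=\sum_{i=0}^{k-1}q_iT_0^i$; $T_i^2=(q^2-1)T_i+q^2$ for $1\le i\le l-1$. By convention $\mathfrak h_{0,k}=R$. It is $R$-free of rank $k^l\,l!$. There is a surjective $R$-algebra map $\pi_l:\mathscr B_l^k\to\mathfrak h_{l,k}$ with $Y\mapsto T_0$, $X_i\mapsto q^{-1}T_i$, $e_i\mapsto0$. For $l\le n$ there is a natural $R$-algebra map $\mathscr B_l^k\to\mathscr B_n^k$ sending each generator to the generator of the same name; "image in $\mathscr B_n^k$" refers to this map. Empty products are $1$ (in particular, in $X_i\cdots X_{j-1}$ with $j=i$ there are no factors). *)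

theory Defs
  imports "HOL-Algebra.QuotRing" "HOL-Algebra.Module" "HOL-Library.Poly_Mapping" "HOL-Library.Equipollence"
begin

section \<open>Associative algebras given by generators and relations\<close>

text \<open>
  The free monoid, written additively (concatenation is \<open>+\<close>, although it is not commutative):
  with a \<^class>\<open>monoid_add\<close> index type, the multiplication that the library puts on
  finitely supported functions is the one of the monoid algebra, so that
  \<open>('g, 'r) free_alg\<close> is the free associative unital algebra over \<open>'r\<close> on
  all elements of \<open>'g\<close>.
\<close>

datatype 'g free_word = Word (letters: "'g list")

instantiation free_word :: (type) monoid_add
begin

definition zero_free_word :: "'a free_word" where
  "0 = Word []"

definition plus_free_word :: "'a free_word \<Rightarrow> 'a free_word \<Rightarrow> 'a free_word" where
  "u + v = Word (letters u @ letters v)"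

instance
  by standard (simp_all add: zero_free_word_def plus_free_word_def)

end

type_synonym ('g, 'r) free_alg = "'g free_word \<Rightarrow>\<^sub>0 'r"

definition fgen :: "'g \<Rightarrow> ('g, 'r::comm_ring_1) free_alg" where
  "fgen g = Poly_Mapping.single (Word [g]) 1"

definition fconst :: "'r \<Rightarrow> ('g, 'r::comm_ring_1) free_alg" where
  "fconst c = Poly_Mapping.single 0 c"

definition free_alg_on :: "'g set \<Rightarrow> ('g, 'r::comm_ring_1) free_alg ring" where
  "free_alg_on G =
     \<lparr>carrier = {p. \<forall>w \<in> Poly_Mapping.keys p. set (letters w) \<subseteq> G},
      monoid.mult = (*), one = 1, ring.zero = 0, ring.add = (+)\<rparr>"

text \<open>A pair \<open>(a, b)\<close> in \<open>rels\<close> stands for the relation \<open>a = b\<close>.\<close>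

definition rel_ideal ::
  "'g set \<Rightarrow> (('g, 'r::comm_ring_1) free_alg \<times> ('g, 'r) free_alg) set \<Rightarrow> ('g, 'r) free_alg set" where
  "rel_ideal G rels = Idl\<^bsub>free_alg_on G\<^esub> {a - b | a b. (a, b) \<in> rels}"

definition rel_class ::
  "'g set \<Rightarrow> (('g, 'r::comm_ring_1) free_alg \<times> ('g, 'r) free_alg) set \<Rightarrow>
     ('g, 'r) free_alg \<Rightarrow> ('g, 'r) free_alg set" where
  "rel_class G rels p = rel_ideal G rels +>\<^bsub>free_alg_on G\<^esub> p"

definition presented_alg ::
  "'g set \<Rightarrow> (('g, 'r::comm_ring_1) free_alg \<times> ('g, 'r) free_alg) set \<Rightarrow>
     ('r, ('g, 'r) free_alg set) module" where
  "presented_alg G rels =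
     (let Q = free_alg_on G Quot rel_ideal G rels
      in \<lparr>carrier = carrier Q, monoid.mult = monoid.mult Q, one = \<one>\<^bsub>Q\<^esub>,
          ring.zero = \<zero>\<^bsub>Q\<^esub>, ring.add = ring.add Q,
          smult = (\<lambda>c x. rel_class G rels (fconst c) \<otimes>\<^bsub>Q\<^esub> x)\<rparr>)"

definition subst_gens ::
  "('g \<Rightarrow> ('h, 'r) free_alg) \<Rightarrow> ('g, 'r::comm_ring_1) free_alg \<Rightarrow> ('h, 'r) free_alg" where
  "subst_gens \<sigma> p =
     (\<Sum>w \<in> Poly_Mapping.keys p.
        fconst (Poly_Mapping.lookup p w) * prod_list (map \<sigma> (letters w)))"

text \<open>
  The map into the algebra presented by \<open>G'\<close> and \<open>rels'\<close> that sends the class of each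
  generator \<open>g\<close> to the class of \<open>\<sigma> g\<close>. It is meaningful if \<open>\<sigma>\<close> respects
  the relations of the source: then the image of a coset is a singleton.
\<close>

definition induced_map ::
  "'h set \<Rightarrow> (('h, 'r::comm_ring_1) free_alg \<times> ('h, 'r) free_alg) set \<Rightarrow>
     ('g \<Rightarrow> ('h, 'r) free_alg) \<Rightarrow> ('g, 'r) free_alg set \<Rightarrow> ('h, 'r) free_alg set" where
  "induced_map G' rels' \<sigma> x = the_elem ((\<lambda>p. rel_class G' rels' (subst_gens \<sigma> p)) ` x)"


section \<open>Spans, bases, ordered products\<close>

text \<open>Only meaningful for \<open>S \<subseteq> carrier M\<close>.\<close>

definition lin_span :: "('r::comm_ring_1, 'a, 'm) module_scheme \<Rightarrow> 'a set \<Rightarrow> 'a set" where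
  "lin_span M S = {\<Oplus>\<^bsub>M\<^esub>x\<in>F. c x \<odot>\<^bsub>M\<^esub> x | F c. finite F \<and> F \<subseteq> S}"

definition lin_indep :: "('r::comm_ring_1, 'a, 'm) module_scheme \<Rightarrow> 'a set \<Rightarrow> bool" where
  "lin_indep M S \<longleftrightarrow>
     (\<forall>F c. finite F \<longrightarrow> F \<subseteq> S \<longrightarrow> (\<Oplus>\<^bsub>M\<^esub>x\<in>F. c x \<odot>\<^bsub>M\<^esub> x) = \<zero>\<^bsub>M\<^esub> \<longrightarrow> (\<forall>x\<in>F. c x = 0))"

definition is_basis :: "('r::comm_ring_1, 'a, 'm) module_scheme \<Rightarrow> 'a set \<Rightarrow> bool" where
  "is_basis M S \<longleftrightarrow> S \<subseteq> carrier M \<and> lin_indep M S \<and> lin_span M S = carrier M"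

definition mprod :: "('a, 'm) monoid_scheme \<Rightarrow> 'a list \<Rightarrow> 'a" where
  "mprod M xs = foldr (\<lambda>x y. x \<otimes>\<^bsub>M\<^esub> y) xs \<one>\<^bsub>M\<^esub>"


section \<open>Parameters\<close>

text \<open>The inverse of a unit, unspecified on non-units.\<close>

definition unit_inv :: "'r::comm_ring_1 \<Rightarrow> 'r" where
  "unit_inv x = (THE y. x * y = 1)"

text \<open>
  \<open>par_qs i\<close> is $q_i$, the coefficient of $Y^i$ in the order relation for $Y$; \<open>par_q\<close> is $q$.
  Only the values of \<open>par_qs\<close> and \<open>par_A\<close> below \<open>par_k\<close> matter.
\<close>

record 'r cyc_params =
  par_k :: nat
  par_q :: 'r
  par_lam :: 'r
  par_qs :: "nat \<Rightarrow> 'r"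
  par_A :: "nat \<Rightarrow> 'r"

definition par_delta :: "'r::comm_ring_1 cyc_params \<Rightarrow> 'r" where
  "par_delta P = par_q P - unit_inv (par_q P)"

definition valid_params :: "'r::comm_ring_1 cyc_params \<Rightarrow> bool" where
  "valid_params P \<longleftrightarrow>
     par_A P 0 dvd 1 \<and> par_qs P 0 dvd 1 \<and> par_q P dvd 1 \<and> par_lam P dvd 1 \<and>
     par_lam P - unit_inv (par_lam P) = par_delta P * (1 - par_A P 0)"


section \<open>The cyclotomic BMW algebra\<close>

datatype bmw_gen = GY | GYinv | GX nat | GXinv nat | GE nat

text \<open>No generators for \<open>n = 0\<close>, hence no relations: the algebra is then the ground ring.\<close>

definition bmw_gens :: "nat \<Rightarrow> bmw_gen set" where
  "bmw_gens n =
     (if n = 0 then {} else {GY, GYinv}) \<union> GX ` {1..<n} \<union> GXinv ` {1..<n} \<union> GE ` {1..<n}"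

definition bmw_rels ::
  "nat \<Rightarrow> 'r::comm_ring_1 cyc_params \<Rightarrow> ((bmw_gen, 'r) free_alg \<times> (bmw_gen, 'r) free_alg) set" where
  "bmw_rels n P =
     (let Y = fgen GY; Y' = fgen GYinv; X = (\<lambda>i. fgen (GX i)); X' = (\<lambda>i. fgen (GXinv i));
          e = (\<lambda>i. fgen (GE i)); I = {1..<n};
          lam = fconst (par_lam P); laminv = fconst (unit_inv (par_lam P));
          delta = fconst (par_delta P); A = (\<lambda>m. fconst (par_A P m));
          far = {(i, j). i \<in> I \<and> j \<in> I \<and> (i + 2 \<le> j \<or> j + 2 \<le> i)};
          adj = {(i, j). i \<in> I \<and> j \<in> I \<and> (j = i + 1 \<or> i = j + 1)}
      in (if n \<ge> 1 then {(Y * Y', 1), (Y' * Y, 1)} else {})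
       \<union> {(X i * X' i, 1) | i. i \<in> I}
       \<union> {(X' i * X i, 1) | i. i \<in> I}
       \<union> {(X i - X' i, delta * (1 - e i)) | i. i \<in> I}
       \<union> {(X i * X j, X j * X i) | i j. (i, j) \<in> far}
       \<union> {(X i * e j, e j * X i) | i j. (i, j) \<in> far}
       \<union> {(e i * e j, e j * e i) | i j. (i, j) \<in> far}
       \<union> {(X i * X (i + 1) * X i, X (i + 1) * X i * X (i + 1)) | i. i \<in> I \<and> i + 1 \<in> I}
       \<union> {(X i * e i, lam * e i) | i. i \<in> I}
       \<union> {(e i * X i, lam * e i) | i. i \<in> I}
       \<union> {(X i * X j * e i, e j * e i) | i j. (i, j) \<in> adj}
       \<union> {(e j * e i, e j * X i * X j) | i j. (i, j) \<in> adj}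
       \<union> {(e i * e j * e i, e i) | i j. (i, j) \<in> adj}
       \<union> {(e i * e i, A 0 * e i) | i. i \<in> I}
       \<union> (if n \<ge> 1 then {(Y ^ par_k P, \<Sum>i<par_k P. fconst (par_qs P i) * Y ^ i)} else {})
       \<union> (if n \<ge> 2 then {(X 1 * Y * X 1 * Y, Y * X 1 * Y * X 1)} else {})
       \<union> {(Y * X i, X i * Y) | i. i \<in> I \<and> i > 1}
       \<union> {(Y * e i, e i * Y) | i. i \<in> I \<and> i > 1}
       \<union> (if n \<ge> 2 then {(Y * X 1 * Y * e 1, laminv * e 1), (laminv * e 1, e 1 * Y * X 1 * Y)} else {})
       \<union> {(e 1 * Y ^ m * e 1, A m * e 1) | m. n \<ge> 2 \<and> m < par_k P})"

definition bmw :: "nat \<Rightarrow> 'r::comm_ring_1 cyc_params \<Rightarrow> ('r, (bmw_gen, 'r) free_alg set) module" where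
  "bmw n P = presented_alg (bmw_gens n) (bmw_rels n P)"

definition bmw_elt :: "nat \<Rightarrow> 'r::comm_ring_1 cyc_params \<Rightarrow> bmw_gen \<Rightarrow> (bmw_gen, 'r) free_alg set" where
  "bmw_elt n P g = rel_class (bmw_gens n) (bmw_rels n P) (fgen g)"

definition bmw_incl ::
  "nat \<Rightarrow> 'r::comm_ring_1 cyc_params \<Rightarrow> (bmw_gen, 'r) free_alg set \<Rightarrow> (bmw_gen, 'r) free_alg set" where
  "bmw_incl n P = induced_map (bmw_gens n) (bmw_rels n P) fgen"

text \<open>$Y'_i = X_{i-1} \cdots X_2 X_1 Y X_1 X_2 \cdots X_{i-1}$ in the algebra on \<open>n\<close> strands.\<close>

definition bmw_Yp :: "nat \<Rightarrow> 'r::comm_ring_1 cyc_params \<Rightarrow> nat \<Rightarrow> (bmw_gen, 'r) free_alg set" where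
  "bmw_Yp n P i =
     mprod (bmw n P)
       (map (\<lambda>a. bmw_elt n P (GX a)) (rev [1..<i]) @ [bmw_elt n P GY] @
        map (\<lambda>a. bmw_elt n P (GX a)) [1..<i])"


section \<open>The Ariki-Koike algebra\<close>

datatype ak_gen = GT nat | GTinv nat

definition ak_gens :: "nat \<Rightarrow> ak_gen set" where
  "ak_gens l = GT ` {..<l} \<union> GTinv ` {..<l}"

definition ak_rels ::
  "nat \<Rightarrow> 'r::comm_ring_1 cyc_params \<Rightarrow> ((ak_gen, 'r) free_alg \<times> (ak_gen, 'r) free_alg) set" where
  "ak_rels l P =
     (let T = (\<lambda>i. fgen (GT i)); T' = (\<lambda>i. fgen (GTinv i)); q = par_q P
      in {(T i * T' i, 1) | i. i < l}
       \<union> {(T' i * T i, 1) | i. i < l}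
       \<union> (if l \<ge> 2 then {(T 0 * T 1 * T 0 * T 1, T 1 * T 0 * T 1 * T 0)} else {})
       \<union> {(T i * T (i + 1) * T i, T (i + 1) * T i * T (i + 1)) | i. 1 \<le> i \<and> i + 2 \<le> l}
       \<union> {(T i * T j, T j * T i) | i j. i < l \<and> j < l \<and> (i + 2 \<le> j \<or> j + 2 \<le> i)}
       \<union> (if l \<ge> 1 then {(T 0 ^ par_k P, \<Sum>i<par_k P. fconst (par_qs P i) * T 0 ^ i)} else {})
       \<union> {(T i ^ 2, fconst (q ^ 2 - 1) * T i + fconst (q ^ 2)) | i. 1 \<le> i \<and> i < l})"

definition ak :: "nat \<Rightarrow> 'r::comm_ring_1 cyc_params \<Rightarrow> ('r, (ak_gen, 'r) free_alg set) module" where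
  "ak l P = presented_alg (ak_gens l) (ak_rels l P)"

primrec ak_image :: "'r::comm_ring_1 cyc_params \<Rightarrow> bmw_gen \<Rightarrow> (ak_gen, 'r) free_alg" where
  "ak_image P GY = fgen (GT 0)"
| "ak_image P GYinv = fgen (GTinv 0)"
| "ak_image P (GX i) = fconst (unit_inv (par_q P)) * fgen (GT i)"
| "ak_image P (GXinv i) = fconst (par_q P) * fgen (GTinv i)"
| "ak_image P (GE i) = 0"

definition ak_proj ::
  "nat \<Rightarrow> 'r::comm_ring_1 cyc_params \<Rightarrow> (bmw_gen, 'r) free_alg set \<Rightarrow> (ak_gen, 'r) free_alg set" where
  "ak_proj l P = induced_map (ak_gens l) (ak_rels l P) (ak_image P)"

end

theory Submission
  imports Defs
begin

text \<open>
  A word with one arc is $Y_i'^s X_i \cdots X_{j-1} e_j \cdots e_{n-1}$. Multiplying it by a generator from the left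
  gives a combination of such words, each followed by an element of the algebra on two strands fewer: powers of
  $Y'$ pass a braid generator up to lower terms by the skein relation, and exponents outside the
  prescribed window are brought back by the order relation of $Y$. Hence the left ideal generated
  by $e_{n-1} e_{n-3} \cdots$ is spanned by products of arcs followed by the algebra on the remaining strands. If
  the second arc does not start to the left of the first one, the product can be rewritten with a first arc that
  starts further to the right, so that arcs with decreasing starting points suffice. The relations are symmetric under
  reversal of products, which gives the same for right ideals.

  Therefore the ideal of diagrams with $f$ arcs is spanned by a left half diagram, an element of the algebra on
  $n - 2f$ strands, and a right half diagram. Modulo diagrams with $f + 1$ arcs the middle element only matters
  modulo the ideal generated by the $e_i$, and the quotient by that ideal is the Ariki-Koike algebra.
\<close>

section \<open>Powers, spans and central scalars\<close>

text \<open>Moving a power of some \<open>Y'\<close> past a braid generator is never clean: every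
  skein correction also creates a cap, and a cap turns an exponent on one strand into its negative
  on the neighbouring strand. The inductions still terminate because, for each sign of the exponent,
  one of \<open>X i\<close> and \<open>Xi i\<close> leaves strictly smaller absolute values on the
  strand of larger index.

  The window of exponents consists of k consecutive integers around 0, as symmetric as k allows,
  with the longer half on the positive side. As an interval containing 0 it absorbs every exponent
  between 0 and a permitted one. Exchanging two arcs controls one exponent only up to sign; the
  window absorbs this too, because the absolute value is then at most s - 1 if the original exponent
  s is positive and at most - s otherwise.

  The unit A_0 enters through the product E of f disjoint caps: E E is A_0^f E, so a E b is a scalar
  multiple of (a E)(E b), and the results on left and right ideals can be combined. The unit q_0
  makes negative powers of Y expressible by nonnegative ones.\<close>

definition zpw :: "'b::monoid_mult \<Rightarrow> 'b \<Rightarrow> int \<Rightarrow> 'b" where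
  "zpw x xi c = (if 0 \<le> c then x ^ nat c else xi ^ nat (- c))"

lemma zpw_0 [simp]: "zpw x xi 0 = 1"
  by (simp add: zpw_def)

lemma zpw_1 [simp]: "zpw x xi 1 = x"
  by (simp add: zpw_def)

lemma zpw_of_nat: "zpw x xi (int m) = x ^ m"
  by (simp add: zpw_def)

lemma zpw_minus_of_nat: "zpw x xi (- int m) = xi ^ m"
  by (simp add: zpw_def)

lemma zpw_uminus: "zpw x xi (- c) = zpw xi x c"
  by (auto simp: zpw_def)

lemma zpw_Suc:
  assumes "x * xi = 1" "xi * x = (1::'b::monoid_mult)"
  shows "zpw x xi (c + 1) = x * zpw x xi c"
proof (cases "0 \<le> c")
  case True
  then show ?thesis by (simp add: zpw_def nat_add_distrib)
next
  case False
  then obtain m where m: "c = - int (Suc m)"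
    by (metis int_cases not_le of_nat_0_le_iff negD)
  have "c + 1 = - int m" using m by simp
  then have "zpw x xi (c + 1) = xi ^ m" using zpw_minus_of_nat by metis
  moreover have "zpw x xi c = xi * xi ^ m" using m zpw_minus_of_nat[of x xi "Suc m"] by simp
  ultimately show ?thesis by (simp add: mult.assoc[symmetric] assms)
qed

lemma zpw_pred:
  assumes "x * xi = 1" "xi * x = (1::'b::monoid_mult)"
  shows "zpw x xi (c - 1) = xi * zpw x xi c"
  using zpw_Suc[OF assms, of "c - 1"] assms by (simp add: mult.assoc[symmetric])

lemma zpw_add:
  assumes "x * xi = 1" "xi * x = (1::'b::monoid_mult)"
  shows "zpw x xi (a + b) = zpw x xi a * zpw x xi b"
proof (induction a rule: int_induct[where k = 0])
  case base then show ?case by simp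
next
  case (step1 i)
  then show ?case using zpw_Suc[OF assms, of i] zpw_Suc[OF assms, of "i + b"]
    by (simp add: mult.assoc algebra_simps)
next
  case (step2 i)
  have "i - 1 + b = (i + b) - 1" by simp
  then have "zpw x xi (i - 1 + b) = xi * zpw x xi (i + b)"
    by (simp only: zpw_pred[OF assms])
  then show ?case using step2 zpw_pred[OF assms, of i] by (simp add: mult.assoc)
qed

lemma commute_inverse:
  assumes "x * xi = 1" "xi * x = (1::'b::monoid_mult)" "u * x = x * u"
  shows "u * xi = xi * u"
proof -
  have "u * xi = xi * (x * u) * xi" using assms(2) by (simp add: mult.assoc[symmetric])
  also have "\<dots> = xi * u" using assms(1,3) by (metis mult.assoc mult.right_neutral)
  finally show ?thesis .
qed

lemma commute_power:
  assumes "u * x = x * (u::'b::monoid_mult)"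
  shows "u * x ^ m = x ^ m * u"
  by (induction m) (use assms in \<open>simp_all add: mult.assoc[symmetric], simp add: mult.assoc\<close>)

lemma commute_zpw:
  assumes "x * xi = 1" "xi * x = (1::'b::monoid_mult)" "u * x = x * u"
  shows "u * zpw x xi c = zpw x xi c * u"
  using commute_power[OF assms(3)] commute_power[OF commute_inverse[OF assms]]
  by (simp add: zpw_def)

text \<open>An inductive span instead of finite sums: membership of a product is checked on the
  spanning elements by rule induction, and no coefficient functions have to be carried
  along.\<close>

inductive_set zspan :: "'b::{ring,monoid_mult} set \<Rightarrow> 'b set \<Rightarrow> 'b set" for Z A where
  zspan_zero: "0 \<in> zspan Z A"
| zspan_base: "x \<in> A \<Longrightarrow> x \<in> zspan Z A"
| zspan_add: "x \<in> zspan Z A \<Longrightarrow> y \<in> zspan Z A \<Longrightarrow> x + y \<in> zspan Z A"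
| zspan_scale: "z \<in> Z \<Longrightarrow> x \<in> zspan Z A \<Longrightarrow> z * x \<in> zspan Z A"

inductive_set algen :: "'b::{ring,monoid_mult} set \<Rightarrow> 'b set \<Rightarrow> 'b set" for Z G where
  algen_scalar: "z \<in> Z \<Longrightarrow> z \<in> algen Z G"
| algen_gen: "g \<in> G \<Longrightarrow> g \<in> algen Z G"
| algen_add: "x \<in> algen Z G \<Longrightarrow> y \<in> algen Z G \<Longrightarrow> x + y \<in> algen Z G"
| algen_mult: "x \<in> algen Z G \<Longrightarrow> y \<in> algen Z G \<Longrightarrow> x * y \<in> algen Z G"

lemma algen_mono: "x \<in> algen Z G \<Longrightarrow> G \<subseteq> G' \<Longrightarrow> x \<in> algen Z G'"
  by (induction rule: algen.induct) (auto intro: algen.intros)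

lemma zspan_mono: "x \<in> zspan Z A \<Longrightarrow> A \<subseteq> zspan Z B \<Longrightarrow> x \<in> zspan Z B"
  by (induction rule: zspan.induct) (auto intro: zspan.intros)

locale scalars =
  fixes Z :: "'b::{ring,monoid_mult} set"
  assumes central: "z \<in> Z \<Longrightarrow> z * x = x * z"
    and one_Z: "1 \<in> Z" and minus_one_Z: "- 1 \<in> Z" and zero_Z: "0 \<in> Z"
begin

abbreviation zs where "zs \<equiv> zspan Z"
abbreviation ag where "ag \<equiv> algen Z"

lemma zs_uminus: "x \<in> zs A \<Longrightarrow> - x \<in> zs A"
  using zspan_scale[OF minus_one_Z] by fastforce

lemma zs_diff: "x \<in> zs A \<Longrightarrow> y \<in> zs A \<Longrightarrow> x - y \<in> zs A"
  using zspan_add[of x Z A "- y"] zs_uminus by fastforce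

lemma zs_sum: "(\<And>i. i \<in> I \<Longrightarrow> f i \<in> zs A) \<Longrightarrow> sum f I \<in> zs A"
  by (induction I rule: infinite_finite_induct) (auto intro: zspan.intros)

lemma zs_lmult:
  assumes "x \<in> zs A" "\<And>a. a \<in> A \<Longrightarrow> g * a \<in> zs B"
  shows "g * x \<in> zs B"
  using assms(1)
proof (induction rule: zspan.induct)
  case (zspan_scale z x)
  have "g * (z * x) = z * (g * x)" using central[OF zspan_scale(1), of g]
    by (metis mult.assoc)
  then show ?case using zspan_scale zspan.zspan_scale by metis
qed (auto simp: distrib_left intro: zspan.intros assms(2))

lemma zs_rmult:
  assumes "x \<in> zs A" "\<And>a. a \<in> A \<Longrightarrow> a * g \<in> zs B"
  shows "x * g \<in> zs B"
  using assms(1)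
  by (induction rule: zspan.induct) (auto simp: distrib_right mult.assoc intro: zspan.intros assms(2))

lemma zs_mult:
  assumes "x \<in> zs A" "y \<in> zs B" "\<And>a b. a \<in> A \<Longrightarrow> b \<in> B \<Longrightarrow> a * b \<in> zs C"
  shows "x * y \<in> zs C"
  by (rule zs_rmult[OF assms(1)], rule zs_lmult[OF assms(2)], rule assms(3))

lemma ag_one: "1 \<in> ag G" using one_Z by (rule algen_scalar)
lemma ag_zero: "0 \<in> ag G" using zero_Z by (rule algen_scalar)

lemma ag_uminus: "x \<in> ag G \<Longrightarrow> - x \<in> ag G"
  using algen_mult[OF algen_scalar[OF minus_one_Z]] by fastforce

lemma ag_diff: "x \<in> ag G \<Longrightarrow> y \<in> ag G \<Longrightarrow> x - y \<in> ag G"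
  using algen_add[of x Z G "- y"] ag_uminus by fastforce

lemma ag_power: "x \<in> ag G \<Longrightarrow> x ^ m \<in> ag G"
  by (induction m) (auto intro: ag_one algen_mult)

lemma ag_zpw: "x \<in> ag G \<Longrightarrow> xi \<in> ag G \<Longrightarrow> zpw x xi c \<in> ag G"
  by (simp add: zpw_def ag_power)

lemma ag_prod_list: "(\<And>x. x \<in> set xs \<Longrightarrow> x \<in> ag G) \<Longrightarrow> prod_list xs \<in> ag G"
  by (induction xs) (auto intro: ag_one algen_mult)

lemma ag_commute:
  assumes "h \<in> ag G" "\<And>g. g \<in> G \<Longrightarrow> g * x = x * g"
  shows "h * x = x * h"
  using assms(1)
proof (induction rule: algen.induct)
  case (algen_mult a b) then show ?case by (metis mult.assoc)
next
  case (algen_scalar z) then show ?case by (rule central)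
qed (auto simp: distrib_left distrib_right assms(2))

text \<open>One of the two intervals is empty; \<open>rng c\<close> indexes the error terms of moving a \<open>c\<close>-th power
  past a braid generator \<open>x\<close> with inverse \<open>x'\<close>.\<close>

definition rng :: "int \<Rightarrow> int set" where
  "rng c = {1..c} \<union> {c + 1..0}"

text \<open>The model is \<open>x = X i\<close>, \<open>x' = Xi i\<close>, where a power changes
  strand and the crossing changes sign. Since \<open>x' = x - u\<close>, one step reads
  \<open>x a = b x - b u\<close>, and with inverses \<open>x ai = bi x + u ai\<close>. Iterating
  leaves one error per step; the extra \<open>b\<close> in the first formula is why the errors run
  from \<open>d = 1\<close> for positive \<open>c\<close> but end at \<open>d = 0\<close> for
  negative \<open>c\<close>.\<close>

lemma intertwine:
  assumes a: "a * ai = 1" "ai * a = 1" and b: "b * bi = 1" "bi * b = 1"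
    and xa: "x * a = b * x'" and xai: "x' * ai = bi * x" and u: "x - x' = u"
  shows "x * zpw a ai c - zpw b bi c * x \<in> zs {zpw b bi d * u * zpw a ai (c - d) | d. d \<in> rng c}"
proof -
  have pos: "x * zpw a ai (int m) - zpw b bi (int m) * x
      \<in> zs {zpw b bi d * u * zpw a ai (int m - d) | d. d \<in> rng (int m)}" for m
  proof (induction m)
    case 0 then show ?case by (simp add: zspan_zero)
  next
    case (Suc m)
    let ?A = "zpw a ai (int m)" and ?B = "zpw b bi (int m)"
    have sa: "zpw a ai (int (Suc m)) = a * ?A" using zpw_Suc[OF a, of "int m"] by (simp add: add.commute)
    have sb: "zpw b bi (int (Suc m)) = b * ?B" using zpw_Suc[OF b, of "int m"] by (simp add: add.commute)
    have "x * (a * ?A) = b * ((x - u) * ?A)"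
      using xa u by (metis diff_diff_eq2 add_diff_cancel_left' mult.assoc)
    then have eq: "x * (a * ?A) - b * ?B * x = b * (x * ?A - ?B * x) - b * u * ?A"
      by (simp add: algebra_simps mult.assoc)
    show ?case unfolding sa sb eq
    proof (rule zs_diff)
      show "b * (x * ?A - ?B * x) \<in> zs {zpw b bi d * u * zpw a ai (int (Suc m) - d) | d. d \<in> rng (int (Suc m))}"
      proof (rule zs_lmult[OF Suc], rule zspan_base, clarify)
        fix d assume d: "d \<in> rng (int m)"
        have "b * (zpw b bi d * u * zpw a ai (int m - d)) = zpw b bi (d + 1) * u * zpw a ai (int (Suc m) - (d + 1))"
          by (simp add: zpw_Suc[OF b] mult.assoc)
        moreover have "d + 1 \<in> rng (int (Suc m))" using d by (auto simp: rng_def)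
        ultimately show "\<exists>d'. b * (zpw b bi d * u * zpw a ai (int m - d)) = zpw b bi d' * u * zpw a ai (int (Suc m) - d') \<and> d' \<in> rng (int (Suc m))"
          by blast
      qed
      show "b * u * ?A \<in> zs {zpw b bi d * u * zpw a ai (int (Suc m) - d) | d. d \<in> rng (int (Suc m))}"
        by (rule zspan_base) (rule CollectI, rule exI[of _ 1], simp add: rng_def)
    qed
  qed
  have neg: "x * zpw a ai (- int m) - zpw b bi (- int m) * x
      \<in> zs {zpw b bi d * u * zpw a ai (- int m - d) | d. d \<in> rng (- int m)}" for m
  proof (induction m)
    case 0 then show ?case by (simp add: zspan_zero)
  next
    case (Suc m)
    let ?A = "zpw a ai (- int m)" and ?B = "zpw b bi (- int m)"
    have sa: "zpw a ai (- int (Suc m)) = ai * ?A" using zpw_pred[OF a, of "- int m"]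
      by (metis minus_diff_eq minus_add_distrib of_nat_Suc add.commute uminus_add_conv_diff)
    have sb: "zpw b bi (- int (Suc m)) = bi * ?B" using zpw_pred[OF b, of "- int m"]
      by (metis minus_diff_eq minus_add_distrib of_nat_Suc add.commute uminus_add_conv_diff)
    have "x * ai = bi * x + u * ai"
      using xai u by (metis diff_add_cancel add.commute distrib_right)
    then have "x * (ai * ?A) = bi * (x * ?A) + u * (ai * ?A)"
      by (simp add: mult.assoc[symmetric] distrib_right)
    then have eq: "x * (ai * ?A) - bi * ?B * x = bi * (x * ?A - ?B * x) + u * (ai * ?A)"
      by (simp add: algebra_simps mult.assoc)
    show ?case unfolding sa sb eq
    proof (rule zspan_add)
      show "bi * (x * ?A - ?B * x) \<in> zs {zpw b bi d * u * zpw a ai (- int (Suc m) - d) | d. d \<in> rng (- int (Suc m))}"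
      proof (rule zs_lmult[OF Suc], rule zspan_base, clarify)
        fix d assume d: "d \<in> rng (- int m)"
        have "bi * (zpw b bi d * u * zpw a ai (- int m - d)) = zpw b bi (d - 1) * u * zpw a ai (- int (Suc m) - (d - 1))"
          by (simp add: zpw_pred[OF b] mult.assoc)
        moreover have "d - 1 \<in> rng (- int (Suc m))" using d by (auto simp: rng_def)
        ultimately show "\<exists>d'. bi * (zpw b bi d * u * zpw a ai (- int m - d)) = zpw b bi d' * u * zpw a ai (- int (Suc m) - d') \<and> d' \<in> rng (- int (Suc m))"
          by blast
      qed
      show "u * (ai * ?A) \<in> zs {zpw b bi d * u * zpw a ai (- int (Suc m) - d) | d. d \<in> rng (- int (Suc m))}"
        by (rule zspan_base) (rule CollectI, rule exI[of _ 0], use sa in \<open>simp add: rng_def\<close>)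
    qed
  qed
  show ?thesis
  proof (cases "0 \<le> c")
    case True then show ?thesis using pos[of "nat c"] by simp
  next
    case False then show ?thesis using neg[of "nat (- c)"] by simp
  qed
qed

end

section \<open>The relations of the cyclotomic BMW algebra\<close>

text \<open>Scalars are modelled by a set \<open>Z\<close> of central elements; \<open>dl, la, qs i, Am i\<close> stand for
  $\delta, \lambda, q_i, A_i$, and a further \<open>i\<close> at the end of a name marks an inverse.\<close>

locale bmw_ring = scalars Z for Z :: "'b::{ring,monoid_mult} set" +
  fixes n k :: nat and Y Yi :: 'b and X Xi e :: "nat \<Rightarrow> 'b"
    and dl la lai A0 A0i q0i :: 'b and qs Am :: "nat \<Rightarrow> 'b"
  assumes params: "dl \<in> Z" "la \<in> Z" "lai \<in> Z" "A0 \<in> Z" "A0i \<in> Z" "q0i \<in> Z"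
      "\<And>i. i < k \<Longrightarrow> qs i \<in> Z" "\<And>i. i < k \<Longrightarrow> Am i \<in> Z"
    and k_pos: "1 \<le> k"
    and units: "la * lai = 1" "A0 * A0i = 1" "qs 0 * q0i = 1"
    and Y_inv: "1 \<le> n \<Longrightarrow> Y * Yi = 1" "1 \<le> n \<Longrightarrow> Yi * Y = 1"
    and X_inv: "\<And>i. 1 \<le> i \<Longrightarrow> i < n \<Longrightarrow> X i * Xi i = 1" "\<And>i. 1 \<le> i \<Longrightarrow> i < n \<Longrightarrow> Xi i * X i = 1"
    and skein: "\<And>i. 1 \<le> i \<Longrightarrow> i < n \<Longrightarrow> X i - Xi i = dl * (1 - e i)"
    and far: "\<And>i j. 1 \<le> i \<Longrightarrow> i < n \<Longrightarrow> 1 \<le> j \<Longrightarrow> j < n \<Longrightarrow> i + 2 \<le> j \<or> j + 2 \<le> i \<Longrightarrow>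
        X i * X j = X j * X i \<and> X i * e j = e j * X i \<and> e i * e j = e j * e i"
    and braid: "\<And>i. 1 \<le> i \<Longrightarrow> i + 1 < n \<Longrightarrow> X i * X (i + 1) * X i = X (i + 1) * X i * X (i + 1)"
    and Xe: "\<And>i. 1 \<le> i \<Longrightarrow> i < n \<Longrightarrow> X i * e i = la * e i" "\<And>i. 1 \<le> i \<Longrightarrow> i < n \<Longrightarrow> e i * X i = la * e i"
    and XXe: "\<And>i j. 1 \<le> i \<Longrightarrow> i < n \<Longrightarrow> 1 \<le> j \<Longrightarrow> j < n \<Longrightarrow> j = i + 1 \<or> i = j + 1 \<Longrightarrow>
        X i * X j * e i = e j * e i \<and> e j * X i * X j = e j * e i \<and> e i * e j * e i = e i"
    and ee: "\<And>i. 1 \<le> i \<Longrightarrow> i < n \<Longrightarrow> e i * e i = A0 * e i"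
    and Y_order: "1 \<le> n \<Longrightarrow> Y ^ k = (\<Sum>i<k. qs i * Y ^ i)"
    and YX1: "2 \<le> n \<Longrightarrow> X 1 * Y * X 1 * Y = Y * X 1 * Y * X 1"
    and YX: "\<And>i. 1 < i \<Longrightarrow> i < n \<Longrightarrow> Y * X i = X i * Y" "\<And>i. 1 < i \<Longrightarrow> i < n \<Longrightarrow> Y * e i = e i * Y"
    and YXYe: "2 \<le> n \<Longrightarrow> Y * X 1 * Y * e 1 = lai * e 1" "2 \<le> n \<Longrightarrow> e 1 * Y * X 1 * Y = lai * e 1"
    and eYe: "\<And>m. 2 \<le> n \<Longrightarrow> m < k \<Longrightarrow> e 1 * Y ^ m * e 1 = Am m * e 1"
begin

definition adj :: "nat \<Rightarrow> nat \<Rightarrow> bool" where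
  "adj i j \<longleftrightarrow> 1 \<le> i \<and> i < n \<and> 1 \<le> j \<and> j < n \<and> (j = i + 1 \<or> i = j + 1)"

lemma mult_assoc_eq: "a * b = (c::'b) \<Longrightarrow> a * (b * x) = c * x"
  by (simp add: mult.assoc[symmetric])

lemma comm_mult: "u * a = a * u \<Longrightarrow> u * b = b * u \<Longrightarrow> u * (a * b) = a * b * (u::'b)"
  by (metis mult.assoc)

lemma central_left: "z \<in> Z \<Longrightarrow> x * (z * y) = z * (x * (y::'b))"
  using central[of z x] by (metis mult.assoc)

lemma la': "lai * la = 1" and A0': "A0i * A0 = 1" and q0': "q0i * qs 0 = 1"
  using units central params k_pos by (metis)+

text \<open>Duplicates a cap at the price of a scalar, for places where one copy is used up and
  another is still required.\<close>

lemma A0_e: "1 \<le> i \<Longrightarrow> i < n \<Longrightarrow> A0i * (e i * e i) = e i"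
  using ee A0' by (metis mult.assoc mult.left_neutral)

lemma X_Xi: "1 \<le> i \<Longrightarrow> i < n \<Longrightarrow> X i = Xi i + dl * (1 - e i)"
  using skein[of i] by (metis diff_add_cancel add.commute)

lemma Xi_X: "1 \<le> i \<Longrightarrow> i < n \<Longrightarrow> Xi i = X i - dl + dl * e i"
  using skein[of i] by (simp add: algebra_simps)

lemma Xie: assumes "1 \<le> i" "i < n" shows "Xi i * e i = lai * e i" "e i * Xi i = lai * e i"
proof -
  have "e i = la * (Xi i * e i)"
    using Xe(1)[OF assms] X_inv(2)[OF assms] central_left[OF params(2), of "Xi i" "e i"] by (metis mult_assoc_eq mult.left_neutral)
  then have "lai * e i = Xi i * e i" using la' by (metis mult.assoc mult.left_neutral)
  then show "Xi i * e i = lai * e i" by simp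
  have "e i = la * (e i * Xi i)"
    using Xe(2)[OF assms] X_inv(1)[OF assms] by (metis mult.assoc mult.right_neutral)
  then have "lai * e i = e i * Xi i" using la' by (metis mult.assoc mult.left_neutral)
  then show "e i * Xi i = lai * e i" by simp
qed

lemma XX: assumes "1 \<le> i" "i < n" shows "X i * X i = 1 + dl * X i - dl * la * e i"
proof -
  have "X i * X i = X i * Xi i + X i * (dl * (1 - e i))"
    by (metis X_Xi[OF assms] distrib_left)
  also have "\<dots> = 1 + dl * (X i - X i * e i)"
    using central[OF params(1), of "X i"] X_inv[OF assms]
    by (simp add: right_diff_distrib central_left[OF params(1)])
  finally show ?thesis by (simp add: Xe[OF assms] algebra_simps mult.assoc)
qed

lemma adj_sym: "adj i j \<Longrightarrow> adj j i" by (auto simp: adj_def)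

lemma adj_b: assumes "adj i j" shows "1 \<le> i" "i < n" "1 \<le> j" "j < n"
  using assms by (auto simp: adj_def)

context
  fixes i j assumes adj: "adj i j"
begin

lemma adj_rels: "X i * (X j * e i) = e j * e i" "e j * (X i * X j) = e j * e i" "e i * (e j * e i) = e i"
    "X j * (X i * e j) = e i * e j" "e i * (X j * X i) = e i * e j" "e j * (e i * e j) = e j"
  using XXe[of i j] XXe[of j i] adj by (auto simp: adj_def mult.assoc)

lemma adj_inv: "Xi i * X i = 1" "X i * Xi i = 1" "Xi j * X j = 1" "X j * Xi j = 1"
  using X_inv adj by (auto simp: adj_def)

lemma adj_cancel: "Xi i * (X i * x) = x" "X i * (Xi i * x) = x" "Xi j * (X j * x) = x" "X j * (Xi j * x) = x"
  using adj_inv by (metis mult_assoc_eq mult.left_neutral)+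

text \<open>Here and in the next lemmas a crossing next to an adjacent cap is traded for a second
  cap and the opposite crossing at the other index, by cancelling one crossing in the relation for
  \<open>X i * X j * e i\<close> or its mirror images.\<close>

lemma Xj_ei: "X j * e i = Xi i * (e j * e i)" using adj_rels adj_cancel by metis
lemma Xij_ei: "Xi j * e i = X i * (e j * e i)"
  using adj_rels(3,4) adj_cancel(3) by (metis mult.assoc)
lemma ej_Xi: "e j * X i = e j * (e i * Xi j)"
  using adj_rels(2) adj_inv(4) by (metis mult.assoc mult.right_neutral)
lemma ej_Xii: "e j * Xi i = e j * (e i * X j)"
proof -
  have "e j * (e i * (X j * X i)) = e j" using adj_rels(5) adj_rels(6) by simp
  then show ?thesis using adj_inv(2) by (metis mult.assoc mult.right_neutral)
qed
lemma ej_Xii': "e i * Xi j = e i * (e j * X i)"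
proof -
  have "e i * (e j * (X i * X j)) = e i" using adj_rels(2,3) by simp
  then show ?thesis using adj_inv(4) by (metis mult.assoc mult.right_neutral)
qed
lemma eXe: "e j * (X i * e j) = lai * e j"
proof -
  have "e j * (X i * e j) = e j * (e i * (Xi j * e j))" using arg_cong[OF ej_Xi, of "\<lambda>t. t * e j"] by (simp only: mult.assoc)
  then show ?thesis using Xie(1)[OF adj_b(3,4)[OF adj]] adj_rels(6) by (simp add: central_left[OF params(3)])
qed
lemma eXie: "e j * (Xi i * e j) = la * e j"
proof -
  have "e j * (Xi i * e j) = e j * (e i * (X j * e j))" using arg_cong[OF ej_Xii, of "\<lambda>t. t * e j"] by (simp only: mult.assoc)
  then show ?thesis using Xe(1)[OF adj_b(3,4)[OF adj]] adj_rels(6) by (simp add: central_left[OF params(2)])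
qed
lemma XXe_conj: "X i * (X j * e i) = e j * (X i * X j)" using adj_rels by simp
lemma Xi_ej_ei: "X i * (e j * e i) = Xi j * e i" using Xij_ei by simp
lemma ei_ej_Xi: "e i * (e j * X i) = e i * Xi j" by (rule ej_Xii'[symmetric])
lemma braid': "X i * (X j * X i) = X j * (X i * X j)"
  using braid[of i] braid[of j] adj by (auto simp: adj_def mult.assoc)

end

section \<open>The elements Y', their inverses, and generators commuting with them\<close>

fun y :: "nat \<Rightarrow> 'b" where
  "y 0 = 1" | "y (Suc 0) = Y" | "y (Suc (Suc i)) = X (Suc i) * y (Suc i) * X (Suc i)"

fun yi :: "nat \<Rightarrow> 'b" where
  "yi 0 = 1" | "yi (Suc 0) = Yi" | "yi (Suc (Suc i)) = Xi (Suc i) * yi (Suc i) * Xi (Suc i)"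

lemma y_Suc: "1 \<le> i \<Longrightarrow> y (Suc i) = X i * y i * X i" "1 \<le> i \<Longrightarrow> yi (Suc i) = Xi i * yi i * Xi i"
  by (cases i; simp)+

lemma y_inv: "i \<le> n \<Longrightarrow> y i * yi i = 1 \<and> yi i * y i = 1"
proof (induction i)
  case 0 then show ?case by simp
next
  case (Suc i)
  show ?case
  proof (cases "i = 0")
    case True then show ?thesis using Y_inv Suc by simp
  next
    case False
    then have i: "1 \<le> i" "i < n" using Suc by auto
    have a: "y i * (yi i * x) = x" "yi i * (y i * x) = x" for x
      using Suc mult_assoc_eq by (metis Suc_leD mult.left_neutral)+
    have b: "X i * (Xi i * x) = x" "Xi i * (X i * x) = x" for x
      using X_inv[OF i] mult_assoc_eq by (metis mult.left_neutral)+
    show ?thesis using i by (simp add: y_Suc mult.assoc a b X_inv)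
  qed
qed

lemma far_comm:
  assumes "1 \<le> i" "i < n" "1 \<le> j" "j < n" "i + 2 \<le> j \<or> j + 2 \<le> i"
  shows "X i * X j = X j * X i" "X i * e j = e j * X i" "e i * X j = X j * e i" "e i * e j = e j * e i"
    "X i * Xi j = Xi j * X i" "e i * Xi j = Xi j * e i" "Xi i * X j = X j * Xi i" "Xi i * e j = e j * Xi i" "Xi i * Xi j = Xi j * Xi i"
proof -
  have 1: "X i * X j = X j * X i" "X i * e j = e j * X i" "e i * X j = X j * e i" "e i * e j = e j * e i"
    using far[OF assms] far[OF assms(3,4,1,2)] assms(5) by metis+
  have c: "a * Xi j = Xi j * a" if "a * X j = X j * a" for a
    using commute_inverse[OF X_inv[OF assms(3,4)] that] .
  have d: "a * Xi i = Xi i * a" if "a * X i = X i * a" for a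
    using commute_inverse[OF X_inv[OF assms(1,2)] that] .
  show "X i * X j = X j * X i" "X i * e j = e j * X i" "e i * X j = X j * e i" "e i * e j = e j * e i"
    "X i * Xi j = Xi j * X i" "e i * Xi j = Xi j * e i" "Xi i * X j = X j * Xi i" "Xi i * e j = e j * Xi i" "Xi i * Xi j = Xi j * Xi i"
    using 1 c d by metis+
qed

lemma Xie_comm:
  assumes "1 \<le> i" "i < n" "x * X i = X i * x" shows "x * Xi i = Xi i * x"
  using commute_inverse[OF X_inv[OF assms(1,2)] assms(3)] .

lemma y_comm_XE:
  assumes "1 \<le> a" "a < n" "1 \<le> b" "b \<le> n" "a \<noteq> b" "a + 1 \<noteq> b"
  shows "X a * y b = y b * X a \<and> e a * y b = y b * e a"
  using assms
proof (induction b arbitrary: a rule: less_induct)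
  case (less b)
  note assms = less.prems
  show ?case
  proof (cases "b = 1")
    case True then show ?thesis using YX[of a] assms less by auto
  next
    case False
    define c where "c = b - 1"
    have c: "b = Suc c" "1 \<le> c" "c < n" using False less by (auto simp: c_def)
    show ?thesis
    proof (cases "a + 1 = c")
      case False
      have ac: "a + 2 \<le> c \<or> c + 2 \<le> a" using less c False by linarith
      have IH: "X a * y c = y c * X a" "e a * y c = y c * e a"
      proof -
        have "c < b" "c \<le> n" "a \<noteq> c" "a + 1 \<noteq> c" using c ac False by linarith+
        from less.IH[OF this(1) assms(1,2) c(2) this(2-4)] show "X a * y c = y c * X a" "e a * y c = y c * e a" by blast+
      qed
      note f = far_comm[OF assms(1,2) c(2,3) ac]
      have 1: "X a * (X c * z) = X c * (X a * z)" "e a * (X c * z) = X c * (e a * z)"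
        "X a * (y c * z) = y c * (X a * z)" "e a * (y c * z) = y c * (e a * z)" for z
        using f IH by (metis mult.assoc)+
      show ?thesis using c by (simp add: y_Suc mult.assoc 1 f IH)
    next
      case True
      \<comment> \<open>The critical case \<open>b = a + 2\<close>, where \<open>y b\<close> is
        \<open>y a\<close> conjugated by \<open>X c\<close> and \<open>X a\<close> in the sense of
        \<open>yb\<close>. The braid relation turns \<open>X a\<close> into \<open>X c\<close> on
        the left pair of crossings, \<open>X c\<close> passes \<open>y a\<close>, and the right pair
        turns it back into \<open>X a\<close>. For \<open>e a\<close> the relation
        \<open>XXe_conj\<close> does the same.\<close>
      have adj: "adj a c" using True c assms by (auto simp: adj_def)
      have far': "X c * y a = y a * X c" "e c * y a = y a * e c" using less.IH[of a c] True c assms by auto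
      have yb: "y b = X c * (X a * (y a * (X a * X c)))" using c True assms
        by (simp add: y_Suc mult.assoc flip: True)
      have "X a * y b = (X a * (X c * X a)) * (y a * (X a * X c))" by (simp add: yb mult.assoc)
      also have "\<dots> = X c * (X a * (X c * y a * (X a * X c)))" by (simp add: braid'[OF adj] mult.assoc)
      also have "\<dots> = X c * (X a * (y a * (X a * (X c * X a))))" by (simp add: far' braid'[OF adj] mult.assoc)
      finally have 1: "X a * y b = y b * X a" by (simp add: yb mult.assoc)
      have "e a * y b = (e a * (X c * X a)) * (y a * (X a * X c))" by (simp add: yb mult.assoc)
      also have "\<dots> = X c * (X a * (e c * y a * (X a * X c)))"
        by (simp only: XXe_conj[OF adj_sym[OF adj], symmetric] mult.assoc)
      also have "\<dots> = X c * (X a * (y a * (e c * (X a * X c))))" by (simp add: far' mult.assoc)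
      also have "\<dots> = X c * (X a * (y a * (X a * (X c * e a))))" by (simp add: XXe_conj[OF adj])
      finally have "e a * y b = y b * e a" by (simp add: yb mult.assoc)
      then show ?thesis using 1 by simp
    qed
  qed
qed

section \<open>Subalgebras on the first strands and on intervals of strands\<close>

definition gens :: "nat \<Rightarrow> 'b set" where
  "gens l = (if l = 0 then {} else {Y, Yi}) \<union> {g. \<exists>b. 1 \<le> b \<and> b < l \<and> g \<in> {X b, Xi b, e b}}"

text \<open>\<open>H l\<close> is the image of the algebra on \<open>l\<close> strands, \<open>K m l\<close> the part supported on the strands from \<open>m\<close> to \<open>l\<close>.\<close>

definition H :: "nat \<Rightarrow> 'b set" where "H l = ag (gens l)"

definition K :: "nat \<Rightarrow> nat \<Rightarrow> 'b set" where
  "K m l = ag {g. \<exists>b. m \<le> b \<and> b < l \<and> g \<in> {X b, Xi b, e b}}"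

lemma H_mono: "x \<in> H l \<Longrightarrow> l \<le> l' \<Longrightarrow> x \<in> H l'"
  unfolding H_def by (erule algen_mono) (auto simp: gens_def split: if_splits)

lemma K_mono: "x \<in> K m l \<Longrightarrow> m' \<le> m \<Longrightarrow> l \<le> l' \<Longrightarrow> x \<in> K m' l'"
  unfolding K_def by (erule algen_mono) (blast intro: order_trans less_le_trans)

lemma K_H: "x \<in> K m l \<Longrightarrow> 1 \<le> m \<Longrightarrow> x \<in> H l"
  unfolding H_def K_def by (erule algen_mono) (fastforce simp: gens_def)

lemma H_gen: "1 \<le> b \<Longrightarrow> b < l \<Longrightarrow> X b \<in> H l" "1 \<le> b \<Longrightarrow> b < l \<Longrightarrow> Xi b \<in> H l" "1 \<le> b \<Longrightarrow> b < l \<Longrightarrow> e b \<in> H l"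
   "1 \<le> l \<Longrightarrow> Y \<in> H l" "1 \<le> l \<Longrightarrow> Yi \<in> H l"
  by (auto simp: H_def gens_def intro: algen_gen)

lemma K_gen: "m \<le> b \<Longrightarrow> b < l \<Longrightarrow> X b \<in> K m l" "m \<le> b \<Longrightarrow> b < l \<Longrightarrow> Xi b \<in> K m l" "m \<le> b \<Longrightarrow> b < l \<Longrightarrow> e b \<in> K m l"
  by (auto simp: K_def intro: algen_gen)

lemma H_ring: "1 \<in> H l" "0 \<in> H l" "a \<in> H l \<Longrightarrow> b \<in> H l \<Longrightarrow> a * b \<in> H l" "a \<in> H l \<Longrightarrow> b \<in> H l \<Longrightarrow> a + b \<in> H l"
   "z \<in> Z \<Longrightarrow> z \<in> H l" "z \<in> Z \<Longrightarrow> a \<in> H l \<Longrightarrow> z * a \<in> H l" "a \<in> H l \<Longrightarrow> b \<in> H l \<Longrightarrow> a - b \<in> H l"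
  unfolding H_def by (auto intro: ag_one ag_zero algen.intros ag_diff)

lemma K_ring: "1 \<in> K m l" "0 \<in> K m l" "a \<in> K m l \<Longrightarrow> b \<in> K m l \<Longrightarrow> a * b \<in> K m l" "a \<in> K m l \<Longrightarrow> b \<in> K m l \<Longrightarrow> a + b \<in> K m l"
   "z \<in> Z \<Longrightarrow> z \<in> K m l" "z \<in> Z \<Longrightarrow> a \<in> K m l \<Longrightarrow> z * a \<in> K m l" "a \<in> K m l \<Longrightarrow> b \<in> K m l \<Longrightarrow> a - b \<in> K m l"
  unfolding K_def by (auto intro: ag_one ag_zero algen.intros ag_diff)

lemma y_H: "i \<le> l \<Longrightarrow> y i \<in> H l \<and> yi i \<in> H l"
proof (induction i)
  case 0 then show ?case by (simp add: H_ring)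
next
  case (Suc i)
  then show ?case by (cases "i = 0") (auto simp: y_Suc intro!: H_ring(1,3) H_gen)
qed

definition yp :: "nat \<Rightarrow> int \<Rightarrow> 'b" where "yp i c = zpw (y i) (yi i) c"

lemma yp_H: "i \<le> l \<Longrightarrow> yp i c \<in> H l"
  unfolding yp_def using y_H[of i l] by (auto simp: H_def intro: ag_zpw)

lemma yp_0 [simp]: "yp i 0 = 1" and yp_1 [simp]: "yp i 1 = y i" by (simp_all add: yp_def)

lemma yp_add: "i \<le> n \<Longrightarrow> yp i (c + d) = yp i c * yp i d"
  unfolding yp_def using y_inv[of i] by (intro zpw_add) auto

lemma comm_yp: "i \<le> n \<Longrightarrow> x * y i = y i * x \<Longrightarrow> x * yp i c = yp i c * x"
  unfolding yp_def using y_inv[of i] by (intro commute_zpw) auto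

lemma yp_comm_XE:
  assumes "1 \<le> a" "a < n" "b \<le> n" "a \<noteq> b" "a + 1 \<noteq> b"
  shows "X a * yp b c = yp b c * X a" "e a * yp b c = yp b c * e a" "Xi a * yp b c = yp b c * Xi a"
proof -
  have *: "X a * y b = y b * X a \<and> e a * y b = y b * e a"
    using y_comm_XE[of a b] assms by (cases "b = 0") auto
  then show 1: "X a * yp b c = yp b c * X a" "e a * yp b c = yp b c * e a"
    using comm_yp assms by auto
  show "Xi a * yp b c = yp b c * Xi a" using Xie_comm[OF assms(1,2), of "yp b c"] 1 by simp
qed

lemma y_comm_Y: "1 \<le> b \<Longrightarrow> b \<le> n \<Longrightarrow> Y * y b = y b * Y"
proof (induction b)
  case 0 then show ?case by simp
next
  case (Suc b)
  consider "b = 0" | "b = 1" | "b \<ge> 2" by linarith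
  then show ?case
  proof cases
    case 1 then show ?thesis by simp
  next
    case 2 then show ?thesis using YX1 Suc by (simp add: mult.assoc numeral_2_eq_2)
  next
    case 3
    then have "Y * y b = y b * Y" "Y * X b = X b * Y" using Suc YX by auto
    then have "Y * (X b * y b * X b) = X b * y b * X b * Y" by (intro comm_mult)
    then show ?thesis using 3 by (simp add: y_Suc)
  qed
qed

lemma H_comm_y:
  assumes "h \<in> H l" "l < b" "b \<le> n" shows "h * y b = y b * h"
  using assms(1) unfolding H_def
proof (rule ag_commute)
  fix g assume "g \<in> gens l"
  then consider "1 \<le> l" "g = Y \<or> g = Yi" | a where "1 \<le> a" "a < l" "g \<in> {X a, Xi a, e a}"
    by (auto simp: gens_def split: if_splits)
  then show "g * y b = y b * g"
  proof cases
    case 1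
    then have "Y * y b = y b * Y" using y_comm_Y assms by auto
    moreover have "Yi * y b = y b * Yi" using commute_inverse[OF Y_inv, of "y b"] assms 1 calculation by auto
    ultimately show ?thesis using 1 by auto
  next
    case 2
    then have "X a * y b = y b * X a" "e a * y b = y b * e a" using y_comm_XE[of a b] assms by auto
    moreover have "y b * Xi a = Xi a * y b" using Xie_comm[of a "y b"] calculation 2 assms by auto
    ultimately show ?thesis using 2 by auto
  qed
qed

lemma H_comm_yp: "h \<in> H l \<Longrightarrow> l < b \<Longrightarrow> b \<le> n \<Longrightarrow> h * yp b c = yp b c * h"
  using comm_yp H_comm_y by simp

lemma yp_comm: "a \<le> n \<Longrightarrow> b \<le> n \<Longrightarrow> yp a c * yp b d = yp b d * yp a c"
  using H_comm_yp[OF yp_H, of a a b c d] H_comm_yp[OF yp_H, of b b a d c] yp_add[of a c d] yp_add[of a d c]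
  by (cases a b rule: linorder_cases) (auto simp: add.commute)

lemma H_comm_XE:
  assumes "h \<in> H l" "l < b" "b < n" shows "h * X b = X b * h" "h * e b = e b * h" "h * Xi b = Xi b * h"
proof -
  have 1: "g * X b = X b * g \<and> g * e b = e b * g" if "g \<in> gens l" for g
  proof -
    from that consider "1 \<le> l" "g = Y \<or> g = Yi" | a where "1 \<le> a" "a < l" "g \<in> {X a, Xi a, e a}"
      by (auto simp: gens_def split: if_splits)
    then show ?thesis
    proof cases
      case 1
      then have *: "Y * X b = X b * Y" "Y * e b = e b * Y" using YX assms by auto
      moreover have "Yi * X b = X b * Yi" "Yi * e b = e b * Yi"
        using commute_inverse[OF Y_inv, of "X b"] commute_inverse[OF Y_inv, of "e b"] assms 1 * by auto
      ultimately show ?thesis using 1 by auto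
    next
      case 2
      then show ?thesis using far_comm[of a b] assms by auto
    qed
  qed
  show 2: "h * X b = X b * h" "h * e b = e b * h"
    using assms(1) 1 unfolding H_def by (blast intro: ag_commute)+
  show "h * Xi b = Xi b * h" using Xie_comm[of b h] 2 assms by auto
qed

lemma H_comm_K:
  assumes "h \<in> H l" "x \<in> K m l'" "l < m" "l' \<le> n" shows "h * x = x * h"
  using ag_commute[OF assms(2)[unfolded K_def], of h] H_comm_XE[OF assms(1)] assms by force

lemma yp_comm_K:
  assumes "x \<in> K m l" "b < m" "l \<le> n" shows "x * yp b c = yp b c * x"
  using assms(1) unfolding K_def
  by (rule ag_commute) (use assms yp_comm_XE[of _ b c] in force)

text \<open>For \<open>i = 1\<close> the relation for Y X_1 Y e_1 gives \<open>lai\<close>, and the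
  further factor \<open>X 1\<close> on the cap gives \<open>la\<close>. The step carries the cap at
  \<open>j\<close> to the cap at \<open>i\<close> with
  \<open>X j * X i * e j = e i * e j\<close>.\<close>

lemma y_y_e: "1 \<le> i \<Longrightarrow> i < n \<Longrightarrow> y i * (y (Suc i) * e i) = e i \<and> e i * (y i * y (Suc i)) = e i"
proof (induction i)
  case 0 then show ?case by simp
next
  case (Suc i)
  show ?case
  proof (cases "i = 0")
    case True
    have n: "2 \<le> n" using Suc True by simp
    have 1: "1 < n" using n by simp
    have "Y * (X 1 * (Y * (X 1 * e 1))) = la * (Y * X 1 * Y * e 1)"
      using Xe(1)[of 1] n central_left[OF params(2)] by (simp add: mult.assoc)
    also have "\<dots> = e 1" using YXYe(1)[OF n] units by (simp add: mult.assoc[symmetric])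
    finally have a: "Y * (X 1 * (Y * (X 1 * e 1))) = e 1" .
    have "e 1 * (Y * (X 1 * (Y * X 1))) = e 1 * (X 1 * (Y * (X 1 * Y)))"
      using YX1[OF n] by (simp add: mult.assoc)
    also have "\<dots> = la * (e 1 * Y * X 1 * Y)" using Xe(2)[of 1] n by (simp add: mult.assoc[symmetric])
    also have "\<dots> = e 1" using YXYe(2)[OF n] units by (simp add: mult.assoc[symmetric])
    finally show ?thesis using a True by (simp add: mult.assoc)
  next
    case False
    define j where "j = Suc i"
    have adj: "adj i j" using Suc False by (auto simp: adj_def j_def)
    have IH: "y i * (y j * e i) = e i" "e i * (y i * y j) = e i" using Suc False by (auto simp: j_def)
    have yj: "y j = X i * (y i * X i)" using False by (simp add: j_def y_Suc mult.assoc)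
    have yj1: "y (Suc j) = X j * (y j * X j)" using False by (simp add: j_def y_Suc mult.assoc)
    have c: "X j * y i = y i * X j" using y_comm_XE[of j i] adj by (auto simp: adj_def j_def)
    \<comment> \<open>Isolates \<open>y i * y j\<close> in the middle, so that the outer crossings
      move \<open>e j\<close> to \<open>e i\<close> and the hypothesis for \<open>i\<close>
      applies.\<close>
    have e: "y j * y (Suc j) = X i * (X j * (y i * (y j * (X j * X i))))"
    proof -
      have "y j * y (Suc j) = X i * (y i * (X i * (X j * X i) * (y i * (X i * X j))))"
        by (simp add: yj yj1 mult.assoc)
      also have "\<dots> = X i * ((y i * X j) * (X i * ((X j * y i) * (X i * X j))))"
        by (simp add: braid'[OF adj] mult.assoc)
      also have "\<dots> = X i * (X j * (y i * (X i * (y i * (X j * (X i * X j))))))"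
        by (simp add: c mult.assoc flip: c) (simp add: c mult.assoc[symmetric])
      finally show ?thesis by (simp add: yj mult.assoc flip: braid'[OF adj])
    qed
    have "y j * (y (Suc j) * e j) = X i * (X j * (y i * (y j * (X j * (X i * e j)))))"
      using arg_cong[OF e, of "\<lambda>t. t * e j"] by (simp only: mult.assoc)
    also have "\<dots> = X i * (X j * (y i * (y j * e i) * e j))" using adj_rels(4)[OF adj] by (simp add: mult.assoc)
    also have "\<dots> = e j" using IH adj_rels(1,6)[OF adj] by (metis mult.assoc)
    finally have 1: "y j * (y (Suc j) * e j) = e j" .
    have "e j * (y j * y (Suc j)) = e j * (X i * X j) * (y i * (y j * (X j * X i)))" by (simp only: e mult.assoc)
    also have "\<dots> = e j * (e i * (y i * y j) * (X j * X i))" using adj_rels(2)[OF adj] by (simp add: mult.assoc)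
    also have "\<dots> = e j" using IH adj_rels(5,6)[OF adj] by (metis mult.assoc)
    finally show ?thesis using 1 by (simp add: j_def)
  qed
qed

text \<open>By \<open>y_y_e\<close>, \<open>y i * y (Suc i)\<close> acts as 1 on the cap, so a power
  can slide to the other end of the arc with the opposite exponent. All four sign patterns are
  proved at once in \<open>p\<close>, since \<open>yp\<close> chooses between an element and its
  inverse.\<close>

lemma yp_Suc_e:
  assumes "1 \<le> i" "i < n"
  shows "yp (Suc i) c * e i = yp i (- c) * e i" "e i * yp (Suc i) c = e i * yp i (- c)"
proof -
  have XY_inv: "y i * yi i = 1" "yi i * y i = 1" "y (Suc i) * yi (Suc i) = 1" "yi (Suc i) * y (Suc i) = 1"
    using y_inv assms by auto
  have cm: "y i * y (Suc i) = y (Suc i) * y i" using H_comm_y[of "y i" i "Suc i"] y_H[of i i] assms by auto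
  have a: "y (Suc i) * e i = yi i * e i"
    using y_y_e[OF assms] XY_inv by (metis mult_assoc_eq mult.left_neutral)
  have a': "yi (Suc i) * e i = y i * e i"
    using y_y_e[OF assms] XY_inv cm by (metis mult_assoc_eq mult.left_neutral mult.assoc)
  have b: "e i * y (Suc i) = e i * yi i"
    using y_y_e[OF assms] XY_inv cm by (metis mult.assoc mult.right_neutral)
  have b': "e i * yi (Suc i) = e i * y i"
    using y_y_e[OF assms] XY_inv by (metis mult.assoc mult.right_neutral)
  have c1: "y (Suc i) * yi i = yi i * y (Suc i)" using commute_inverse[of "y i" "yi i" "y (Suc i)"] XY_inv cm by simp
  have c2: "yi (Suc i) * y i = y i * yi (Suc i)" using commute_inverse[of "y (Suc i)" "yi (Suc i)" "y i"] XY_inv cm by simp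
  have p: "y (Suc i) ^ m * e i = yi i ^ m * e i \<and> yi (Suc i) ^ m * e i = y i ^ m * e i \<and>
      e i * y (Suc i) ^ m = e i * yi i ^ m \<and> e i * yi (Suc i) ^ m = e i * y i ^ m" for m
  proof (induction m)
    case 0 then show ?case by simp
  next
    case (Suc m)
    have "y (Suc i) ^ Suc m * e i = y (Suc i) * (yi i ^ m * e i)" using Suc by (simp add: mult.assoc)
    also have "\<dots> = yi i ^ m * (y (Suc i) * e i)" using commute_power[OF c1, of m] by (metis mult.assoc)
    finally have 1: "y (Suc i) ^ Suc m * e i = yi i ^ Suc m * e i" using a by (simp add: mult.assoc power_Suc2 del: power_Suc)
    have "yi (Suc i) ^ Suc m * e i = yi (Suc i) * (y i ^ m * e i)" using Suc by (simp add: mult.assoc)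
    also have "\<dots> = y i ^ m * (yi (Suc i) * e i)" using commute_power[OF c2, of m] by (metis mult.assoc)
    finally have 2: "yi (Suc i) ^ Suc m * e i = y i ^ Suc m * e i" using a' by (simp add: mult.assoc power_Suc2 del: power_Suc)
    have "e i * y (Suc i) ^ Suc m = e i * yi i ^ m * y (Suc i)" using Suc by (simp add: mult.assoc[symmetric] power_Suc2 del: power_Suc)
    also have "\<dots> = e i * y (Suc i) * yi i ^ m" using commute_power[OF c1, of m] by (metis mult.assoc)
    finally have 3: "e i * y (Suc i) ^ Suc m = e i * yi i ^ Suc m" using b by (simp add: mult.assoc)
    have "e i * yi (Suc i) ^ Suc m = e i * y i ^ m * yi (Suc i)" using Suc by (simp add: mult.assoc[symmetric] power_Suc2 del: power_Suc)
    also have "\<dots> = e i * yi (Suc i) * y i ^ m" using commute_power[OF c2, of m] by (metis mult.assoc)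
    finally have 4: "e i * yi (Suc i) ^ Suc m = e i * y i ^ Suc m" using b' by (simp add: mult.assoc)
    show ?case using 1 2 3 4 by simp
  qed
  show "yp (Suc i) c * e i = yp i (- c) * e i" "e i * yp (Suc i) c = e i * yp i (- c)"
    using p[of "nat c"] p[of "nat (- c)"] by (auto simp: yp_def zpw_def)
qed

lemma yp_flip: "zpw (yi a) (y a) d = yp a (- d)"
  by (simp add: yp_def zpw_uminus)

section \<open>Powers of the elements Y'\<close>

definition S :: "int set" where "S = {int (k div 2) - (int k - 1)..int (k div 2)}"

lemma S_0: "0 \<in> S" using k_pos by (auto simp: S_def)

text \<open>The exponents that arise when a power is split up lie between 0 and the original one. As
  \<open>S\<close> is an interval containing 0, they stay permitted (\<open>btw_S\<close>).\<close>

definition btw :: "int \<Rightarrow> int \<Rightarrow> bool" where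
  "btw d c \<longleftrightarrow> (0 \<le> d \<and> d \<le> c) \<or> (c \<le> d \<and> d \<le> 0)"

lemma btw_S: "btw d c \<Longrightarrow> c \<in> S \<Longrightarrow> d \<in> S"
  using S_0 by (auto simp: btw_def S_def)

lemma rng_btw: "d \<in> rng c \<Longrightarrow> btw d c \<and> btw (c - d) c"
  by (auto simp: rng_def btw_def)

lemma skein_split: "z \<in> Z \<Longrightarrow> p * (z * (1 - e i)) * q = z * (p * 1 * q) - z * (p * e i * q)"
  by (simp add: right_diff_distrib left_diff_distrib mult.assoc central_left[of z])

text \<open>With the skein relation as \<open>u\<close> in \<open>intertwine\<close>, each error
  splits into one with nothing in the middle and one with a cap. From here on errors are always
  treated by the two cases \<open>v = 1\<close> and \<open>v = e i\<close>.\<close>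

lemma zs_skein:
  assumes "x \<in> zs {f d * (z * (1 - e i)) * g d | d. d \<in> D}" "z \<in> Z"
  shows "x \<in> zs {f d * v * g d | d v. d \<in> D \<and> v \<in> {1, e i}}"
  using assms(1)
proof (rule zspan_mono, safe)
  fix d assume "d \<in> D"
  then have "f d * v * g d \<in> zs {f d * v * g d | d v. d \<in> D \<and> v \<in> {1, e i}}" if "v \<in> {1, e i}" for v
    using that by (intro zspan_base) blast
  from this[of 1] this[of "e i"]
  have "f d * 1 * g d \<in> zs {f d * v * g d | d v. d \<in> D \<and> v \<in> {1, e i}}"
    "f d * e i * g d \<in> zs {f d * v * g d | d v. d \<in> D \<and> v \<in> {1, e i}}" by blast+
  then show "f d * (z * (1 - e i)) * g d \<in> zs {f d * v * g d | d v. d \<in> D \<and> v \<in> {1, e i}}"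
    unfolding skein_split[OF assms(2)] by (intro zs_diff zspan_scale[OF assms(2)])
qed

context
  fixes i assumes i: "1 \<le> i" "i < n"
begin

lemma XY_inv: "y i * yi i = 1" "yi i * y i = 1" "y (Suc i) * yi (Suc i) = 1" "yi (Suc i) * y (Suc i) = 1"
    "X i * Xi i = 1" "Xi i * X i = 1"
  using y_inv[of i] y_inv[of "Suc i"] X_inv i by auto

lemma X_cancel: "X i * (Xi i * z) = z" "Xi i * (X i * z) = z"
  using XY_inv(5,6) by (metis mult_assoc_eq mult.left_neutral)+

lemma X_y_shift: "X i * y i = y (Suc i) * Xi i" "Xi i * yi i = yi (Suc i) * X i"
    "Xi i * y (Suc i) = y i * X i" "X i * yi (Suc i) = yi i * Xi i"
  using i by (simp_all add: y_Suc mult.assoc XY_inv X_cancel)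

lemma X_yp: "X i * yp i c - yp (Suc i) c * X i \<in> zs {yp (Suc i) d * v * yp i (c - d) | d v. d \<in> rng c \<and> v \<in> {1, e i}}"
  unfolding yp_def
  by (rule zs_skein[OF intertwine[OF XY_inv(1-4) X_y_shift(1,2) skein[OF i]] params(1)])

lemma skein': "Xi i - X i = - dl * (1 - e i)"
  using skein[OF i] by (metis minus_diff_eq minus_mult_left)

lemma zs_skein':
  assumes "x \<in> zs {f d * (- dl * (1 - e i)) * g d | d. d \<in> D}"
  shows "x \<in> zs {f d * v * g d | d v. d \<in> D \<and> v \<in> {1, e i}}"
proof -
  have "x \<in> zs {f d * (dl * (1 - e i)) * g d | d. d \<in> D}"
    using assms
  proof (rule zspan_mono, safe)
    fix d assume "d \<in> D"
    then have "- (f d * (dl * (1 - e i)) * g d) \<in> zs {f d * (dl * (1 - e i)) * g d | d. d \<in> D}"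
      by (intro zs_uminus zspan_base) blast
    then show "f d * (- dl * (1 - e i)) * g d \<in> zs {f d * (dl * (1 - e i)) * g d | d. d \<in> D}"
      by simp
  qed
  then show ?thesis by (rule zs_skein) (rule params)
qed

lemma Xi_yp: "Xi i * yp (Suc i) c - yp i c * Xi i \<in> zs {yp i d * v * yp (Suc i) (c - d) | d v. d \<in> rng c \<and> v \<in> {1, e i}}"
  unfolding yp_def
  by (rule zs_skein'[OF intertwine[OF XY_inv(3,4,1,2) X_y_shift(3,4) skein']])

text \<open>For \<open>c > 0\<close> the errors of \<open>Xi i\<close> have \<open>d\<close> from 1
  to \<open>c\<close>, so \<open>c - d\<close> drops strictly. For \<open>c < 0\<close> they would
  include \<open>d = 0\<close>, which leaves \<open>c\<close> unchanged; therefore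
  \<open>X i\<close> is moved past the positive power \<open>- c\<close> of the inverses
  instead.\<close>

lemma yp_lower:
  assumes "c \<noteq> 0"
  obtains V V' where "(V = X i \<and> V' = Xi i) \<or> (V = Xi i \<and> V' = X i)"
    "V * yp (Suc i) c - yp i c * V \<in> zs {yp i d * v * yp (Suc i) (c - d) | d v. \<bar>c - d\<bar> < \<bar>c\<bar> \<and> v \<in> {1, e i}}"
proof (cases "0 < c")
  case True
  have "Xi i * yp (Suc i) c - yp i c * Xi i \<in> zs {yp i d * v * yp (Suc i) (c - d) | d v. \<bar>c - d\<bar> < \<bar>c\<bar> \<and> v \<in> {1, e i}}"
    by (rule zspan_mono[OF Xi_yp]) (use True in \<open>fastforce simp: rng_def intro: zspan_base\<close>)
  then show ?thesis using that by blast
next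
  case False
  let ?c = "- c"
  have "X i * zpw (yi (Suc i)) (y (Suc i)) ?c - zpw (yi i) (y i) ?c * X i \<in>
     zs {zpw (yi i) (y i) d * v * zpw (yi (Suc i)) (y (Suc i)) (?c - d) | d v. d \<in> rng ?c \<and> v \<in> {1, e i}}"
    by (rule zs_skein[OF intertwine[OF XY_inv(4,3,2,1) X_y_shift(4,3) skein[OF i]] params(1)])
  then have "X i * zpw (yi (Suc i)) (y (Suc i)) ?c - zpw (yi i) (y i) ?c * X i
     \<in> zs {yp i d * v * yp (Suc i) (c - d) | d v. \<bar>c - d\<bar> < \<bar>c\<bar> \<and> v \<in> {1, e i}}" (is "_ \<in> zs ?B")
  proof (rule zspan_mono, clarify)
    fix d v assume dv: "d \<in> rng ?c" "v \<in> {1, e i}"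
    have d: "\<bar>c - (- d)\<bar> < \<bar>c\<bar>" using dv(1) False assms by (auto simp: rng_def)
    have "zpw (yi i) (y i) d * v * zpw (yi (Suc i)) (y (Suc i)) (?c - d) = yp i (- d) * v * yp (Suc i) (c - (- d))"
      by (simp add: yp_flip add.commute)
    then have "zpw (yi i) (y i) d * v * zpw (yi (Suc i)) (y (Suc i)) (?c - d) \<in> ?B"
      using dv(2) d by blast
    then show "zpw (yi i) (y i) d * v * zpw (yi (Suc i)) (y (Suc i)) (?c - d) \<in> zs ?B"
      by (rule zspan_base)
  qed
  then have "X i * yp (Suc i) c - yp i c * X i \<in> zs ?B" by (simp only: yp_flip minus_minus)
  then show ?thesis using that by blast
qed

end

lemma zs_Hr: "x \<in> zs {h * t | h. h \<in> H l} \<Longrightarrow> \<exists>h\<in>H l. x = h * t"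
proof (induction rule: zspan.induct)
  case zspan_zero then show ?case using H_ring(2) by (metis mult_zero_left)
next
  case (zspan_add x y)
  then obtain h h' where "h \<in> H l" "x = h * t" "h' \<in> H l" "y = h' * t" by blast
  then show ?case by (intro bexI[of _ "h + h'"]) (auto simp: distrib_right intro: H_ring)
next
  case (zspan_scale z x)
  then obtain h where "h \<in> H l" "x = h * t" by blast
  then show ?case using zspan_scale(1) by (intro bexI[of _ "z * h"]) (auto simp: mult.assoc intro: H_ring)
qed auto

text \<open>Multiplying by Y, the order relation brings Y^k down. Multiplying by the inverse, the
  same relation divided by Y is solved for the inverse, which is possible because
  \<open>qs 0\<close> is a unit.\<close>

lemma Y_span: assumes "1 \<le> n" shows "yp 1 c \<in> zs {Y ^ m | m. m < k}"
proof -
  let ?A = "{Y ^ m | m. m < k}"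
  have b: "Y ^ m \<in> zs ?A" if "m < k" for m using that by (intro zspan_base) blast
  have 1: "Y * x \<in> zs ?A" if "x \<in> zs ?A" for x
    using that
  proof (rule zs_lmult, safe)
    fix m assume m: "m < k"
    show "Y * Y ^ m \<in> zs ?A"
    proof (cases "Suc m < k")
      case True then show ?thesis using b[of "Suc m"] by simp
    next
      case False
      then have "Y * Y ^ m = (\<Sum>i<k. qs i * Y ^ i)" using m Y_order[OF assms]
        by (metis Suc_lessI power_Suc)
      moreover have "\<dots> \<in> zs ?A" by (intro zs_sum zspan_scale params b) simp_all
      ultimately show ?thesis by simp
    qed
  qed
  have Yi_Suc: "Yi * Y ^ Suc m = Y ^ m" for m using Y_inv(2)[OF assms] by (simp add: mult_assoc_eq)
  have 2: "Yi * x \<in> zs ?A" if "x \<in> zs ?A" for x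
    using that
  proof (rule zs_lmult, safe)
    fix m assume m: "m < k"
    show "Yi * Y ^ m \<in> zs ?A"
    proof (cases m)
      case (Suc m')
      then have "Yi * Y ^ m = Y ^ m'" using Yi_Suc by metis
      then show ?thesis using b[of m'] m Suc by simp
    next
      case 0
      obtain k' where k': "k = Suc k'" using k_pos by (cases k) auto
      have "Y ^ k' = Yi * (\<Sum>i<k. qs i * Y ^ i)" using Yi_Suc[of k'] Y_order[OF assms] k' by metis
      also have "\<dots> = Yi * (qs 0 + (\<Sum>i<k'. qs (Suc i) * Y ^ Suc i))"
        by (simp add: k' sum.lessThan_Suc_shift del: sum.lessThan_Suc power_Suc)
      also have "\<dots> = qs 0 * Yi + (\<Sum>i<k'. qs (Suc i) * Y ^ i)"
      proof -
        have "Yi * (qs (Suc i) * Y ^ Suc i) = qs (Suc i) * Y ^ i" if "i < k'" for i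
          using central_left[OF params(7)[of "Suc i"], of Yi] that k' Yi_Suc by simp
        then have "(\<Sum>i<k'. Yi * (qs (Suc i) * Y ^ Suc i)) = (\<Sum>i<k'. qs (Suc i) * Y ^ i)"
          by (intro sum.cong) auto
        moreover have "Yi * qs 0 = qs 0 * Yi" using central[OF params(7), of 0 Yi] k_pos by simp
        ultimately show ?thesis by (simp only: distrib_left sum_distrib_left)
      qed
      finally have "qs 0 * Yi = Y ^ k' - (\<Sum>i<k'. qs (Suc i) * Y ^ i)" by simp
      then have "Yi = q0i * (Y ^ k' - (\<Sum>i<k'. qs (Suc i) * Y ^ i))"
        using q0' by (metis mult.assoc mult.left_neutral)
      moreover have "\<dots> \<in> zs ?A"
        by (intro zspan_scale zs_diff zs_sum b params) (auto simp: k')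
      ultimately show ?thesis using 0 by simp
    qed
  qed
  have "1 \<in> zs ?A" using b[of 0] k_pos by simp
  then have "Y ^ m \<in> zs ?A" "Yi ^ m \<in> zs ?A" for m using 1 2 by (induction m) auto
  then show ?thesis by (simp add: yp_def zpw_def)
qed

text \<open>Any k consecutive exponents serve as well as 0, ..., k - 1: the lowest power of the
  window is split off and \<open>Y_span\<close> is applied to the remaining factor.\<close>

lemma Y_span_S: assumes "1 \<le> n" shows "yp 1 c \<in> zs {yp 1 s | s. s \<in> S}"
proof -
  let ?l = "int (k div 2) - (int k - 1)"
  have "yp 1 c = yp 1 ?l * yp 1 (c - ?l)" using yp_add[of 1 ?l "c - ?l"] assms by simp
  moreover have "yp 1 ?l * yp 1 (c - ?l) \<in> zs {yp 1 s | s. s \<in> S}"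
  proof (rule zs_lmult[OF Y_span[OF assms]], safe)
    fix m assume m: "m < k"
    have "yp 1 (int m) = Y ^ m" by (simp add: yp_def zpw_of_nat)
    then have "yp 1 ?l * Y ^ m = yp 1 (?l + int m)" using yp_add[OF assms] by metis
    moreover have "?l + int m \<in> S" using m by (auto simp: S_def)
    ultimately show "yp 1 ?l * Y ^ m \<in> zs {yp 1 s | s. s \<in> S}" by (intro zspan_base) blast
  qed
  ultimately show ?thesis by simp
qed

text \<open>The induction on \<open>i\<close> lowers \<open>\<bar>c\<bar>\<close> by conjugating with \<open>X i\<close> or \<open>Xi i\<close>, whichever leaves only
  error terms with a smaller exponent (\<open>yp_lower\<close>).\<close>

definition sandwich :: "nat \<Rightarrow> bool" where
  "sandwich i \<longleftrightarrow> (\<forall>c. \<exists>h\<in>H (i - 1). e i * (yp i c * e i) = h * e i)"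

lemma sandwich_1: assumes "2 \<le> n" shows "sandwich 1"
  unfolding sandwich_def
proof
  fix c
  have "e 1 * (yp 1 c * e 1) \<in> zs {h * e 1 | h. h \<in> H 0}"
  proof (rule zs_lmult)
    show "yp 1 c * e 1 \<in> zs {Y ^ m * e 1 | m. m < k}"
      using Y_span[of c] assms by (intro zs_rmult[of "yp 1 c"]) (auto intro: zspan_base)
    fix a assume "a \<in> {Y ^ m * e 1 | m. m < k}"
    then obtain m where m: "a = Y ^ m * e 1" "m < k" by blast
    then have "e 1 * a = Am m * e 1" using eYe[OF assms m(2)] by (simp add: mult.assoc)
    then show "e 1 * a \<in> zs {h * e 1 | h. h \<in> H 0}" using H_ring(5)[OF params(8)[OF m(2)]]
      by (auto intro: zspan_base)
  qed
  then show "\<exists>h\<in>H (1 - 1). e 1 * (yp 1 c * e 1) = h * e 1" using zs_Hr by simp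
qed

text \<open>After \<open>X i\<close> has passed the power it meets the cap and becomes
  \<open>la\<close>; the power, now on strand \<open>Suc i\<close>, slides back through the cap. In
  the errors with \<open>v = e i\<close> a power lies between two caps, which is the hypothesis
  \<open>sandwich i\<close>.\<close>

lemma X_yp_e:
  assumes i: "1 \<le> i" "i < n" and F: "sandwich i"
  shows "X i * (yp i c * e i) \<in> zs {h * e i | h. h \<in> H i}"
proof -
  let ?T = "zs {h * e i | h. h \<in> H i}"
  have T: "h * e i \<in> ?T" if "h \<in> H i" for h using that by (intro zspan_base) blast
  have "(X i * yp i c - yp (Suc i) c * X i) * e i \<in> ?T"
  proof (rule zs_rmult[OF X_yp[OF i]], safe)
    fix d
    have "yp (Suc i) d * 1 * yp i (c - d) * e i = yp i (c - d) * (yp (Suc i) d * e i)"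
      using yp_comm[of "Suc i" i d "c - d"] i by (simp add: mult.assoc[symmetric])
    also have "\<dots> = (yp i (c - d) * yp i (- d)) * e i" by (simp add: yp_Suc_e[OF i] mult.assoc)
    finally show "yp (Suc i) d * 1 * yp i (c - d) * e i \<in> ?T"
      using T[OF H_ring(3)[OF yp_H yp_H]] by simp
    obtain h where h: "h \<in> H (i - 1)" "e i * (yp i (c - d) * e i) = h * e i" using F unfolding sandwich_def by blast
    have h': "h \<in> H i" using H_mono[OF h(1)] by simp
    have "yp (Suc i) d * e i * yp i (c - d) * e i = (yp (Suc i) d * h) * e i"
      by (simp add: mult.assoc h)
    also have "\<dots> = h * (yp (Suc i) d * e i)" using H_comm_yp[OF h', of "Suc i" d] i by (metis Suc_leI lessI mult.assoc)
    also have "\<dots> = (h * yp i (- d)) * e i" by (simp add: yp_Suc_e[OF i] mult.assoc)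
    finally show "yp (Suc i) d * e i * yp i (c - d) * e i \<in> ?T" using T[OF H_ring(3)[OF h' yp_H]] by simp
  qed
  moreover have "yp (Suc i) c * X i * e i = la * yp i (- c) * e i"
    using Xe(1)[OF i] yp_Suc_e(1)[OF i, of c] by (simp add: mult.assoc central_left params)
  moreover have "la * yp i (- c) * e i \<in> ?T" by (rule T) (intro H_ring(6) params yp_H order_refl)
  moreover have "X i * (yp i c * e i) = (X i * yp i c - yp (Suc i) c * X i) * e i + yp (Suc i) c * X i * e i"
    by (simp add: left_diff_distrib mult.assoc)
  ultimately show ?thesis using zspan_add[of "(X i * yp i c - yp (Suc i) c * X i) * e i" Z _ "yp (Suc i) c * X i * e i"]
    by presburger
qed

lemma sandwich_Suc:
  assumes i: "1 \<le> i" "Suc i < n" and F: "sandwich i"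
  shows "sandwich (Suc i)"
proof -
  let ?E = "e (Suc i)" and ?T = "zs {h * e (Suc i) | h. h \<in> H i}"
  have i': "i < n" using i by simp
  have adj: "adj i (Suc i)" using i by (auto simp: adj_def)
  have T: "h * ?E \<in> ?T" if "h \<in> H i" for h using that by (intro zspan_base) blast
  have Tl: "h * x \<in> ?T" if "h \<in> H i" "x \<in> ?T" for h x
    using that(2) by (rule zs_lmult) (auto simp: mult.assoc[symmetric] intro!: T H_ring(3) that)
  have Hc: "?E * (h * z) = h * (?E * z)" if "h \<in> H i" for h z
    using H_comm_XE(2)[OF that, of "Suc i"] i by (metis lessI mult.assoc)
  have eEe: "?E * (e i * (?E * z)) = ?E * z" for z using adj_rels(6)[OF adj] by (metis mult.assoc)
  have eh: "?E * (x * ?E) \<in> ?T" if x: "x \<in> zs {h * e i | h. h \<in> H i}" for x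
  proof -
    obtain h where h: "h \<in> H i" "x = h * e i" using zs_Hr[OF x] by blast
    then show ?thesis using T[OF h(1)] by (simp add: mult.assoc Hc adj_rels(6)[OF adj])
  qed
  have main: "?E * (yp (Suc i) c * ?E) \<in> ?T" for c
  proof (induction "nat \<bar>c\<bar>" arbitrary: c rule: less_induct)
    case less
    have IH: "?E * (yp (Suc i) m * ?E) \<in> ?T" if "\<bar>m\<bar> < \<bar>c\<bar>" for m using less that by auto
    have ew: "e i * (yp (Suc i) m * ?E) = e i * (?E * yp i (- m))" for m
    proof -
      have "e i * (yp (Suc i) m * ?E) = e i * (yp i (- m) * ?E)" using yp_Suc_e(2)[OF i(1) i'] by (metis mult.assoc)
      then show ?thesis using H_comm_XE(2)[OF yp_H[of i i "- m"], of "Suc i"] i by simp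
    qed
    have Ehr: "x * h \<in> ?T" if "x \<in> ?T" "h \<in> H i" for x h
      using that(1)
    proof (rule zs_rmult, safe)
      fix h' assume "h' \<in> H i"
      then show "h' * ?E * h \<in> ?T" using T[OF H_ring(3)[OF _ that(2)], of h'] H_comm_XE(2)[OF that(2), of "Suc i"] i
        by (simp add: mult.assoc)
    qed
    show ?case
    proof (cases "c = 0")
      case True
      then have "?E * (yp (Suc i) c * ?E) = A0 * ?E" using ee[of "Suc i"] i by simp
      then show ?thesis using T[OF H_ring(5)[OF params(4)]] by simp
    next
      case False
      obtain V V' where VV: "(V = X i \<and> V' = Xi i) \<or> (V = Xi i \<and> V' = X i)"
        and V: "V * yp (Suc i) c - yp i c * V \<in> zs {yp i d * v * yp (Suc i) (c - d) | d v. \<bar>c - d\<bar> < \<bar>c\<bar> \<and> v \<in> {1, e i}}"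
        using yp_lower[OF i(1) i' False] by blast
      have V'V: "V' * (V * x) = x" for x using VV X_cancel[OF i(1) i'] by auto
      \<comment> \<open>By the skein relation it is enough to treat \<open>Xi i\<close> in front of
        a power: the two other terms of \<open>V'\<close> contribute nothing, or the element itself
        and its product with \<open>e i\<close>.\<close>
      have V'cases: "V' = Xi i + z * (1 - e i) \<and> z \<in> Z" if "z = (if V' = Xi i then 0 else dl)" for z
        using VV X_Xi[OF i(1) i'] params zero_Z that by auto
      \<comment> \<open>Replaces the power on strand \<open>Suc i\<close> by the conjugate
        \<open>V' * yp i c * V\<close>, treated in 1, at the cost of errors with smaller exponent on
        strand \<open>Suc i\<close>, treated in 2.\<close>
      have eq: "yp (Suc i) c * ?E = V' * (yp i c * (V * ?E)) + V' * ((V * yp (Suc i) c - yp i c * V) * ?E)"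
        using V'V by (simp add: left_diff_distrib right_diff_distrib mult.assoc)
      have 1: "?E * (V' * (yp i c * (V * ?E))) \<in> ?T"
      proof -
        \<comment> \<open>\<open>U\<close> and \<open>U'\<close> are \<open>X (Suc i)\<close> and
          its inverse in some order. They commute with \<open>y i\<close> and cancel, leaving the
          power of \<open>y i\<close> between two copies of \<open>e i\<close>; the hypothesis for
          \<open>i\<close> removes it, and \<open>e (Suc i) * e i * e (Suc i)\<close>
          collapses.\<close>
        obtain U U' where U: "?E * V' = ?E * (e i * U)" "V * ?E = U' * (e i * ?E)" "U * U' = 1"
            "U * yp i c = yp i c * U"
        proof (cases "V = X i")
          case True
          then have "V' = Xi i" using VV V'V[of 1] XY_inv[OF i(1) i'] by (metis mult.assoc mult.left_neutral mult.right_neutral)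
          then show ?thesis using that[of "X (Suc i)" "Xi (Suc i)"] True ej_Xii[OF adj] Xj_ei[OF adj_sym[OF adj]]
             X_inv[of "Suc i"] yp_comm_XE[of "Suc i" i c] i by auto
        next
          case False
          then show ?thesis using VV that[of "Xi (Suc i)" "X (Suc i)"] ej_Xi[OF adj] Xij_ei[OF adj_sym[OF adj]]
             X_inv[of "Suc i"] yp_comm_XE[of "Suc i" i c] i by auto
        qed
        obtain h where h: "h \<in> H (i - 1)" "e i * (yp i c * e i) = h * e i" using F unfolding sandwich_def by blast
        have h': "h \<in> H i" using H_mono[OF h(1)] by simp
        have "?E * (V' * (yp i c * (V * ?E))) = ?E * (e i * U) * (yp i c * (U' * (e i * ?E)))"
          using U by (metis mult.assoc)
        also have "\<dots> = ?E * (e i * (yp i c * (e i * ?E)))"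
          using U(3,4) by (metis mult.assoc mult.left_neutral)
        also have "\<dots> = ?E * (h * (e i * ?E))" using h(2) by (metis mult.assoc)
        also have "\<dots> = h * ?E" by (simp add: Hc[OF h'] adj_rels(6)[OF adj])
        finally show ?thesis using T[OF h'] by simp
      qed
      have 2: "?E * (V' * (yp i d * v * yp (Suc i) m * ?E)) \<in> ?T" if m: "\<bar>m\<bar> < \<bar>c\<bar>" and v: "v \<in> {1, e i}" for d v m
      proof -
        have a: "?E * (V' * (yp (Suc i) m * ?E)) \<in> ?T"
        proof -
          have a1: "?E * ((Xi i * yp (Suc i) m - yp i m * Xi i) * ?E) \<in> ?T"
          proof (rule zs_lmult[OF zs_rmult[OF Xi_yp[OF i(1) i']]])
            show "a * ?E \<in> zs {yp i d * v * yp (Suc i) (m - d) * ?E | d v. d \<in> rng m \<and> v \<in> {1, e i}}"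
              if "a \<in> {yp i d * v * yp (Suc i) (m - d) | d v. d \<in> rng m \<and> v \<in> {1, e i}}" for a
              using that by (intro zspan_base) blast
          next
            fix a assume "a \<in> {yp i d * v * yp (Suc i) (m - d) * ?E | d v. d \<in> rng m \<and> v \<in> {1, e i}}"
            then obtain d v where a: "a = yp i d * v * yp (Suc i) (m - d) * ?E" "d \<in> rng m" "v \<in> {1, e i}" by blast
            have "\<bar>m - d\<bar> \<le> \<bar>m\<bar>" using rng_btw[OF a(2)] by (auto simp: btw_def)
            \<comment> \<open>Moving \<open>Xi i\<close> does not lower the exponent strictly when
              \<open>m\<close> is negative, but \<open>m\<close> itself is already strictly smaller
              than \<open>c\<close> in absolute value.\<close>
            then have md: "\<bar>m - d\<bar> < \<bar>c\<bar>" using m by simp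
            have "?E * (v * (yp (Suc i) (m - d) * ?E)) \<in> ?T"
            proof (cases "v = 1")
              case True then show ?thesis using IH[OF md] by simp
            next
              case False
              then have "?E * (v * (yp (Suc i) (m - d) * ?E)) = 1 * ?E * yp i (- (m - d))" using a(3) by (simp only: ew eEe mult.left_neutral) (simp add: ew eEe)
              then show ?thesis using Ehr[OF T[OF H_ring(1)] yp_H[OF order_refl]] by simp
            qed
            then have "yp i d * (?E * (v * (yp (Suc i) (m - d) * ?E))) \<in> ?T" by (rule Tl[OF yp_H[OF order_refl]])
            then show "?E * a \<in> ?T" by (simp add: a(1) mult.assoc Hc[OF yp_H[of i i d]])
          qed
          have "?E * (yp i m * Xi i * ?E) = (la * yp i m) * ?E"
            using eXie[OF adj] by (simp add: mult.assoc Hc yp_H central_left params)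
          then have "?E * (yp i m * Xi i * ?E) \<in> ?T" using T[OF H_ring(6)[OF params(2) yp_H[of i i m]]] by simp
          then have a2: "?E * (Xi i * (yp (Suc i) m * ?E)) \<in> ?T"
          proof -
            have "?E * (Xi i * (yp (Suc i) m * ?E)) = ?E * ((Xi i * yp (Suc i) m - yp i m * Xi i) * ?E) + ?E * (yp i m * Xi i * ?E)"
              by (simp add: left_diff_distrib right_diff_distrib mult.assoc)
            then show "?E * (yp i m * Xi i * ?E) \<in> ?T \<Longrightarrow> ?thesis" using zspan_add[OF a1] by presburger
          qed
          obtain z where z: "z \<in> Z" "V' = Xi i + z * (1 - e i)" using V'cases by blast
          have "?E * (e i * (yp (Suc i) m * ?E)) = ?E * (yp i (- m))" by (simp add: ew eEe)
          then have a3: "?E * (e i * (yp (Suc i) m * ?E)) \<in> ?T"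
            using Ehr[OF T[OF H_ring(1)] yp_H[of i i]] by simp
          have "?E * (V' * (yp (Suc i) m * ?E)) = ?E * (Xi i * (yp (Suc i) m * ?E)) + z * (?E * (yp (Suc i) m * ?E)) - z * (?E * (e i * (yp (Suc i) m * ?E)))"
            unfolding z(2) by (simp add: distrib_right distrib_left left_diff_distrib right_diff_distrib mult.assoc central_left[OF z(1)])
          then show ?thesis using a2 a3 IH[OF m] by (simp add: zspan_add zs_diff zspan_scale[OF z(1)])
        qed
        show ?thesis
        proof (cases "v = 1")
          case True
          \<comment> \<open>The power of \<open>y i\<close> is blocked by \<open>V'\<close> on the
            left, but commutes with everything to its right; as a right factor it is absorbed by
            \<open>Ehr\<close>.\<close>
          have "?E * (V' * (yp i d * v * yp (Suc i) m * ?E)) = ?E * (V' * (yp (Suc i) m * ?E)) * yp i d"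
          proof -
            have "yp i d * yp (Suc i) m * ?E = yp (Suc i) m * ?E * yp i d"
            proof -
              have "yp i d * yp (Suc i) m = yp (Suc i) m * yp i d" "yp i d * ?E = ?E * yp i d"
                using yp_comm[of "Suc i" i m d] H_comm_XE(2)[OF yp_H[of i i d], of "Suc i"] i by auto
              then show ?thesis by (simp only: mult.assoc)
            qed
            then show ?thesis using True by (simp add: mult.assoc)
          qed
          then show ?thesis using Ehr[OF a yp_H[of i i]] by simp
        next
          case False
          then have v: "v = e i" using v by simp
          have "V' * (yp i d * e i) \<in> zs {h * e i | h. h \<in> H i}"
          proof -
            have *: "X i * (yp i d * e i) \<in> zs {h * e i | h. h \<in> H i}" by (rule X_yp_e[OF i(1) i' F])
            have b: "yp i d * e i \<in> zs {h * e i | h. h \<in> H i}" using yp_H[of i i d] by (intro zspan_base) blast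
            obtain h where h: "h \<in> H (i - 1)" "e i * (yp i d * e i) = h * e i" using F unfolding sandwich_def by blast
            have h': "h \<in> H i" using H_mono[OF h(1)] by simp
            have "e i * (yp i d * e i) \<in> zs {h * e i | h. h \<in> H i}" unfolding h(2) using h' by (intro zspan_base) blast
            moreover have "Xi i * (yp i d * e i) = X i * (yp i d * e i) - dl * (yp i d * e i) + dl * (e i * (yp i d * e i))"
              by (subst Xi_X[OF i(1) i']) (simp add: distrib_right left_diff_distrib mult.assoc)
            ultimately have "Xi i * (yp i d * e i) \<in> zs {h * e i | h. h \<in> H i}"
              using * b by (simp add: zspan_add zs_diff zspan_scale params)
            then show ?thesis using VV * by auto
          qed
          then have "?E * (V' * (yp i d * e i) * ?E) * yp i (- m) \<in> ?T" by (intro Ehr eh yp_H) auto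
          then show ?thesis by (simp add: v mult.assoc ew)
        qed
      qed
      have "?E * (V' * ((V * yp (Suc i) c - yp i c * V) * ?E)) \<in> ?T"
      proof -
        have "(V * yp (Suc i) c - yp i c * V) * ?E \<in> zs {yp i d * v * yp (Suc i) (c - d) * ?E | d v. \<bar>c - d\<bar> < \<bar>c\<bar> \<and> v \<in> {1, e i}}"
          using V by (rule zs_rmult) (auto intro: zspan_base)
        then have "?E * V' * ((V * yp (Suc i) c - yp i c * V) * ?E) \<in> ?T"
          by (rule zs_lmult) (use 2 in \<open>auto simp: mult.assoc\<close>)
        then show ?thesis by (simp add: mult.assoc)
      qed
      then show ?thesis unfolding eq distrib_left using 1 by (rule zspan_add[rotated])
    qed
  qed
  show ?thesis unfolding sandwich_def using zs_Hr[OF main] by simp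
qed

lemma sandwich: "1 \<le> i \<Longrightarrow> i < n \<Longrightarrow> sandwich i"
proof (induction i)
  case (Suc i) then show ?case using sandwich_1 sandwich_Suc by (cases "i = 0") auto
qed simp

section \<open>Words with one arc\<close>

definition XP :: "nat \<Rightarrow> nat \<Rightarrow> 'b" where "XP i j = prod_list (map X [i..<j])"
definition XiR :: "nat \<Rightarrow> nat \<Rightarrow> 'b" where "XiR i j = prod_list (map Xi (rev [i..<j]))"
definition EP :: "nat \<Rightarrow> nat \<Rightarrow> 'b" where "EP j N = prod_list (map e [j..<Suc N])"
text \<open>As a diagram, an arc from point \<open>i\<close> to point \<open>j + 1\<close>. The
  argument \<open>N\<close> is the largest generator index, so there are \<open>N + 1\<close>
  strands, and \<open>H (N - 1)\<close> acts on the strands that remain.\<close>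

definition AL :: "nat \<Rightarrow> nat \<Rightarrow> nat \<Rightarrow> 'b" where "AL i j N = XP i j * EP j N"

lemma XP_nil: "j \<le> i \<Longrightarrow> XP i j = 1" and XP_Cons: "i < j \<Longrightarrow> XP i j = X i * XP (Suc i) j" and XP_snoc: "i \<le> j \<Longrightarrow> XP i (Suc j) = XP i j * X j"
  by (auto simp: XP_def upt_conv_Cons)

lemma XiR_simps: "j \<le> i \<Longrightarrow> XiR i j = 1" "i \<le> j \<Longrightarrow> XiR i (Suc j) = Xi j * XiR i j"
  by (auto simp: XiR_def)

lemma EP_nil: "N < j \<Longrightarrow> EP j N = 1" and EP_Cons: "j \<le> N \<Longrightarrow> EP j N = e j * EP (Suc j) N"
  by (auto simp: EP_def upt_conv_Cons simp del: upt_Suc)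

lemma EP_snoc: "j \<le> Suc N \<Longrightarrow> EP j (Suc N) = EP j N * e (Suc N)"
  unfolding EP_def by (subst upt_Suc_append) (simp_all del: upt_Suc)

lemma prod_list_split: "i \<le> m \<Longrightarrow> m \<le> j \<Longrightarrow>
    prod_list (map f [i..<j]) = prod_list (map f [i..<m]) * (prod_list (map f [m..<j]) :: 'b)"
  by (metis map_append prod_list.append upt_add_eq_append le_add_diff_inverse)

lemma XP_split: "i \<le> m \<Longrightarrow> m \<le> j \<Longrightarrow> XP i j = XP i m * XP m j"
  unfolding XP_def by (rule prod_list_split)

lemma EP_split: "1 \<le> m \<Longrightarrow> i \<le> m \<Longrightarrow> m \<le> Suc N \<Longrightarrow> EP i N = EP i (m - 1) * EP m N"
  using prod_list_split[of i m "Suc N" e] unfolding EP_def by simp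

lemma K_prod_list: "(\<And>x. x \<in> set xs \<Longrightarrow> x \<in> K m l) \<Longrightarrow> prod_list xs \<in> K m l"
  unfolding K_def by (rule ag_prod_list)

lemma XP_K: "m \<le> i \<Longrightarrow> j \<le> l \<Longrightarrow> XP i j \<in> K m l"
  unfolding XP_def by (rule K_prod_list) (auto intro!: K_gen)

lemma XiR_K: "m \<le> i \<Longrightarrow> j \<le> l \<Longrightarrow> XiR i j \<in> K m l"
  unfolding XiR_def by (rule K_prod_list) (auto intro!: K_gen)

lemma EP_K: "m \<le> i \<Longrightarrow> j < l \<Longrightarrow> EP i j \<in> K m l"
  unfolding EP_def by (rule K_prod_list) (auto intro!: K_gen simp del: upt_Suc)

lemma AL_K: "m \<le> i \<Longrightarrow> i \<le> j \<Longrightarrow> j \<le> N \<Longrightarrow> N < l \<Longrightarrow> AL i j N \<in> K m l"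
  unfolding AL_def by (intro K_ring(3) XP_K EP_K) auto

lemma K_comm_XE:
  assumes "g \<in> K m l" "1 \<le> m" "l \<le> n" "1 \<le> b" "b < n" "l < b \<or> b + 1 < m"
  shows "X b * g = g * X b" "e b * g = g * e b" "Xi b * g = g * Xi b"
proof -
  have 1: "h * X b = X b * h \<and> h * e b = e b * h \<and> h * Xi b = Xi b * h"
    if "h \<in> {g. \<exists>b. m \<le> b \<and> b < l \<and> g \<in> {X b, Xi b, e b}}" for h
  proof -
    from that obtain a where a: "m \<le> a" "a < l" "h \<in> {X a, Xi a, e a}" by blast
    have "a + 2 \<le> b \<or> b + 2 \<le> a" using a assms(6) by linarith
    then show ?thesis using far_comm[of a b] a assms by auto
  qed
  show "X b * g = g * X b" "e b * g = g * e b" "Xi b * g = g * Xi b"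
    using ag_commute[OF assms(1)[unfolded K_def], of "X b"] ag_commute[OF assms(1)[unfolded K_def], of "e b"]
      ag_commute[OF assms(1)[unfolded K_def], of "Xi b"] 1 by (metis (lifting))+
qed

lemma lcomm: "a * b = b * (a::'b) \<Longrightarrow> a * (b * z) = b * (a * z)"
  by (metis mult.assoc)

text \<open>The predicate \<open>\<Phi>\<close> keeps track of how the starting point and the exponent of an arc change
  under left multiplication.\<close>

definition GN :: "nat \<Rightarrow> (nat \<Rightarrow> int \<Rightarrow> bool) \<Rightarrow> 'b set" where
  "GN N \<Phi> = zs {yp i c * (AL i j N * h) | i j c h. \<Phi> i c \<and> 1 \<le> i \<and> i \<le> j \<and> j \<le> N \<and> h \<in> H (N - 1)}"

lemma GN_I: "\<Phi> i c \<Longrightarrow> 1 \<le> i \<Longrightarrow> i \<le> j \<Longrightarrow> j \<le> N \<Longrightarrow> h \<in> H (N - 1) \<Longrightarrow> yp i c * (AL i j N * h) \<in> GN N \<Phi>"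
  unfolding GN_def by (rule zspan_base) blast

lemma GN_I0: "\<Phi> i 0 \<Longrightarrow> 1 \<le> i \<Longrightarrow> i \<le> j \<Longrightarrow> j \<le> N \<Longrightarrow> h \<in> H (N - 1) \<Longrightarrow> AL i j N * h \<in> GN N \<Phi>"
  using GN_I[of \<Phi> i 0 j N h] by simp

lemma GN_I1: "\<Phi> i c \<Longrightarrow> 1 \<le> i \<Longrightarrow> i \<le> j \<Longrightarrow> j \<le> N \<Longrightarrow> yp i c * AL i j N \<in> GN N \<Phi>"
  using GN_I[of \<Phi> i c j N 1] H_ring(1) by simp

lemma GN_I01: "\<Phi> i 0 \<Longrightarrow> 1 \<le> i \<Longrightarrow> i \<le> j \<Longrightarrow> j \<le> N \<Longrightarrow> AL i j N \<in> GN N \<Phi>"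
  using GN_I0[of \<Phi> i j N 1] H_ring(1) by simp

lemma GN_add: "x \<in> GN N \<Phi> \<Longrightarrow> x' \<in> GN N \<Phi> \<Longrightarrow> x + x' \<in> GN N \<Phi>"
  and GN_diff: "x \<in> GN N \<Phi> \<Longrightarrow> x' \<in> GN N \<Phi> \<Longrightarrow> x - x' \<in> GN N \<Phi>"
  and GN_scale: "z \<in> Z \<Longrightarrow> x \<in> GN N \<Phi> \<Longrightarrow> z * x \<in> GN N \<Phi>"
  and GN_uminus: "x \<in> GN N \<Phi> \<Longrightarrow> - x \<in> GN N \<Phi>"
  unfolding GN_def by (auto intro: zspan_add zs_diff zspan_scale zs_uminus)

lemma GN_r: assumes "x \<in> GN N \<Phi>" "h \<in> H (N - 1)" shows "x * h \<in> GN N \<Phi>"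
  using assms(1) unfolding GN_def
proof (rule zs_rmult, clarify)
  fix i j c h' assume *: "\<Phi> i c" "1 \<le> i" "i \<le> j" "j \<le> N" "h' \<in> H (N - 1)"
  then show "yp i c * (AL i j N * h') * h \<in> zs {yp i c * (AL i j N * h) | i j c h. \<Phi> i c \<and> 1 \<le> i \<and> i \<le> j \<and> j \<le> N \<and> h \<in> H (N - 1)}"
    using GN_I[of \<Phi> i c j N "h' * h"] H_ring(3)[OF _ assms(2)] by (simp add: mult.assoc GN_def)
qed

lemma GN_l:
  assumes "x \<in> GN N \<Phi>"
    and "\<And>i c j. \<Phi> i c \<Longrightarrow> 1 \<le> i \<Longrightarrow> i \<le> j \<Longrightarrow> j \<le> N \<Longrightarrow> g * (yp i c * AL i j N) \<in> GN N \<Psi>"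
  shows "g * x \<in> GN N \<Psi>"
  using assms(1) unfolding GN_def[of N \<Phi>] GN_def[of N \<Psi>]
proof (rule zs_lmult, clarify)
  fix i j c h' assume *: "\<Phi> i c" "1 \<le> i" "i \<le> j" "j \<le> N" "h' \<in> H (N - 1)"
  have "g * (yp i c * AL i j N) * h' \<in> GN N \<Psi>" by (intro GN_r assms(2) *)
  then show "g * (yp i c * (AL i j N * h')) \<in> zs {yp i c * (AL i j N * h) | i j c h. \<Psi> i c \<and> 1 \<le> i \<and> i \<le> j \<and> j \<le> N \<and> h \<in> H (N - 1)}"
    by (simp add: mult.assoc GN_def)
qed

lemma GN_mono: "x \<in> GN N \<Phi> \<Longrightarrow> (\<And>i c. \<Phi> i c \<Longrightarrow> 1 \<le> i \<Longrightarrow> i \<le> N \<Longrightarrow> \<Psi> i c) \<Longrightarrow> x \<in> GN N \<Psi>"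
  using GN_l[of x N \<Phi> 1 \<Psi>] GN_I1 by simp

context
  fixes N assumes N: "1 \<le> N" "N < n"
begin

lemma AL_le: "i < j \<Longrightarrow> AL i j N = X i * AL (Suc i) j N"
  by (simp add: AL_def XP_Cons mult.assoc)

text \<open>Each crossing next to the last cap becomes a new cap and an inverse crossing one place
  lower (\<open>ej_Xi\<close>). The inverse crossings commute with the later generators and collect
  on the right in reversed order.\<close>

lemma e_XP: "1 \<le> i \<Longrightarrow> i < j \<Longrightarrow> j \<le> N \<Longrightarrow> e i * XP (Suc i) j = EP i (j - 1) * XiR i (j - 1)"
proof (induction j)
  case (Suc j)
  show ?case
  proof (cases "i = j")
    case True then show ?thesis by (simp add: XP_nil EP_Cons EP_nil XiR_simps)
  next
    case False
    then obtain j' where j': "j = Suc j'" "i \<le> j'" using Suc by (metis Suc_le_eq less_Suc_eq less_imp_Suc_add Suc_leI Suc_le_mono le_add1 nat_less_le)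
    have adj: "adj j j'" using j' Suc N by (auto simp: adj_def)
    have c: "XiR i j' * X j = X j * XiR i j'"
      using K_comm_XE(1)[OF XiR_K[OF order_refl order_refl, of i j'], of j] j' Suc N by simp
    have "e i * XP (Suc i) (Suc j) = EP i j' * XiR i j' * X j"
    proof -
      have "XP (Suc i) (Suc j) = XP (Suc i) j * X j" using j' by (intro XP_snoc) simp
      moreover have "e i * XP (Suc i) j = EP i j' * XiR i j'" using Suc False j' by simp
      ultimately show ?thesis by (metis mult.assoc)
    qed
    also have "\<dots> = EP i j' * X j * XiR i j'" by (simp add: mult.assoc c)
    also have "EP i j' * X j = EP i (j' - 1) * (e j' * X j)"
    proof -
      have "EP i j' = EP i (j' - 1) * e j'" using j' EP_split[of j' i j'] Suc by (simp add: EP_Cons EP_nil)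
      then show ?thesis by (simp add: mult.assoc)
    qed
    also have "e j' * X j = e j' * (e j * Xi j')" using ej_Xi[OF adj] .
    also have "EP i (j' - 1) * (e j' * (e j * Xi j')) = EP i j * Xi j'"
    proof -
      have "EP i j' = EP i (j' - 1) * e j'" using j' EP_split[of j' i j'] Suc by (simp add: EP_Cons EP_nil)
      moreover have "EP i j = EP i j' * e j" using j' by (simp add: EP_snoc)
      ultimately show ?thesis by (simp add: mult.assoc)
    qed
    finally show ?thesis using j' by (simp add: XiR_simps mult.assoc)
  qed
qed simp

lemma XiR_EP: "1 \<le> i \<Longrightarrow> j \<le> N \<Longrightarrow> XiR i (j - 1) * EP j N = EP j N * XiR i (j - 1)"
proof (cases "j = 0")
  case False
  assume *: "1 \<le> i" "j \<le> N"
  have "XiR i (j - 1) \<in> H (j - 1)" using * K_H[OF XiR_K[OF order_refl order_refl]] by blast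
  moreover have "EP j N \<in> K j (Suc N)" by (intro EP_K) auto
  ultimately show ?thesis using H_comm_K[of "XiR i (j - 1)" "j - 1" "EP j N" j "Suc N"] N False by simp
qed (simp add: XiR_simps)

text \<open>A cap on the strands \<open>i\<close> and \<open>i + 1\<close> joins \<open>i\<close> to
  the arc starting at \<open>i + 1\<close>. The inverse crossings left by \<open>e_XP\<close> lie in
  \<open>H (j - 1)\<close>, hence pass the caps from \<open>j\<close> on.\<close>

lemma e_AL_Suc: "1 \<le> i \<Longrightarrow> i < j \<Longrightarrow> j \<le> N \<Longrightarrow> e i * AL (Suc i) j N = AL i i N * XiR i (j - 1)"
proof -
  assume *: "1 \<le> i" "i < j" "j \<le> N"
  have "e i * AL (Suc i) j N = EP i (j - 1) * (XiR i (j - 1) * EP j N)"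
    using e_XP[OF *] by (simp add: AL_def mult.assoc[symmetric])
  also have "\<dots> = EP i (j - 1) * EP j N * XiR i (j - 1)" by (simp only: XiR_EP[OF *(1,3)] mult.assoc)
  finally show ?thesis using EP_split[of j i N] * by (simp add: AL_def XP_nil mult.assoc)
qed

lemma XiR_H: "1 \<le> i \<Longrightarrow> j \<le> l \<Longrightarrow> XiR i j \<in> H l" and XP_H: "1 \<le> i \<Longrightarrow> j \<le> l \<Longrightarrow> XP i j \<in> H l"
  using K_H[OF XiR_K[OF order_refl]] K_H[OF XP_K[OF order_refl]] by auto

lemma XP_comm: assumes "1 \<le> i" "j < b" "1 \<le> b" "b < n"
  shows "X b * XP i j = XP i j * X b \<and> e b * XP i j = XP i j * e b \<and> Xi b * XP i j = XP i j * Xi b"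
  using K_comm_XE[OF XP_K[OF order_refl order_refl, of i j], of b] assms by auto

lemma EP_comm: assumes "b + 1 < j" "1 \<le> b"
  shows "X b * EP j N = EP j N * X b" "e b * EP j N = EP j N * e b" "Xi b * EP j N = EP j N * Xi b"
  using K_comm_XE[OF EP_K[OF order_refl, of N "Suc N" j], of b] assms N by (cases "j \<le> N"; simp add: EP_nil)+

text \<open>Strands beyond the right end of the arc have both its ends on their left, so their
  numbers differ by two on the two sides. For strands between the ends the shift is one
  (\<open>inner_AL\<close>).\<close>

lemma far_AL: assumes "1 \<le> i" "i \<le> j" "j + 2 \<le> b" "b \<le> N"
  shows "X b * AL i j N = AL i j N * X (b - 2)" "e b * AL i j N = AL i j N * e (b - 2)"
proof -
  define a where "a = b - 2"
  have b: "b = Suc (Suc a)" "j \<le> a" "1 \<le> a" using assms by (auto simp: a_def)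
  have adj: "adj a (Suc a)" "adj (Suc a) b" using b assms N by (auto simp: adj_def)
  have EP1: "EP j N = EP j (a - 1) * (e a * (e (Suc a) * (e b * EP (Suc b) N)))"
    using EP_split[of a j N] b assms by (simp add: EP_Cons)
  have s: "X b * (e a * (e (Suc a) * (e b * z))) = e a * (e (Suc a) * (e b * (X a * z)))"
    "e b * (e a * (e (Suc a) * (e b * z))) = e a * (e (Suc a) * (e b * (e a * z)))" for z
  proof -
    have f: "X b * e a = e a * X b" "e b * e a = e a * e b" "X a * e b = e b * X a" using far_comm[of a b] b assms N by auto
    have "X b * (e a * (e (Suc a) * (e b * z))) = e a * (X b * (e (Suc a) * e b) * z)" by (simp add: lcomm[OF f(1)] mult.assoc)
    also have "\<dots> = e a * (Xi (Suc a) * (e b * z))" using Xi_ej_ei[OF adj_sym[OF adj(2)]] by (simp add: mult.assoc)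
    also have "\<dots> = e a * (e (Suc a) * X a) * (e b * z)" using ei_ej_Xi[OF adj(1)] by (simp add: mult.assoc[symmetric])
    also have "\<dots> = e a * (e (Suc a) * (e b * (X a * z)))" by (simp add: mult.assoc lcomm[OF f(3)])
    finally show "X b * (e a * (e (Suc a) * (e b * z))) = e a * (e (Suc a) * (e b * (X a * z)))" .
    have "e b * (e a * (e (Suc a) * (e b * z))) = e a * (e b * (e (Suc a) * e b) * z)" by (simp add: lcomm[OF f(2)] mult.assoc)
    also have "\<dots> = e a * (e b * z)" using adj_rels(6)[OF adj(2)] by (simp add: mult.assoc)
    also have "\<dots> = e a * (e (Suc a) * e a) * (e b * z)" using adj_rels(3)[OF adj(1)] by (simp add: mult.assoc)
    also have "\<dots> = e a * (e (Suc a) * (e b * (e a * z)))" by (simp add: mult.assoc lcomm[OF f(2)[symmetric]])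
    finally show "e b * (e a * (e (Suc a) * (e b * z))) = e a * (e (Suc a) * (e b * (e a * z)))" .
  qed
  define P where "P = XP i j * EP j (a - 1)"
  have "P \<in> H a" unfolding P_def using b assms by (intro H_ring(3) XP_H K_H[OF EP_K, of 1]) auto
  from H_comm_XE[OF this, of b]
  have c: "X b * P = P * X b" "e b * P = P * e b"
    using b assms N by auto
  have d: "X a * EP (Suc b) N = EP (Suc b) N * X a" "e a * EP (Suc b) N = EP (Suc b) N * e a"
    using EP_comm[of a "Suc b"] b by auto
  have al: "AL i j N = P * (e a * (e (Suc a) * (e b * EP (Suc b) N)))"
    by (simp add: AL_def EP1 P_def mult.assoc)
  show "X b * AL i j N = AL i j N * X (b - 2)" "e b * AL i j N = AL i j N * e (b - 2)"
    unfolding al a_def[symmetric] by (simp_all only: lcomm[OF c(1)] lcomm[OF c(2)] s d mult.assoc)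
qed

lemma inner_AL: assumes "1 \<le> i" "i < b" "b < j" "j \<le> N"
  shows "X b * AL i j N = AL i j N * X (b - 1)" "e b * AL i j N = AL i j N * e (b - 1)"
proof -
  define a where "a = b - 1"
  have b: "b = Suc a" "i \<le> a" "1 \<le> a" using assms by (auto simp: a_def)
  have adj: "adj a b" using b assms N by (auto simp: adj_def)
  have XP1: "XP i j = XP i a * (X a * (X b * XP (Suc b) j))"
    using XP_split[of i a j] b assms by (simp add: XP_Cons)
  have s: "X b * (X a * (X b * z)) = X a * (X b * (X a * z))" "e b * (X a * (X b * z)) = X a * (X b * (e a * z))" for z
    using braid'[OF adj] XXe_conj[OF adj] by (metis mult.assoc)+
  have c: "X b * XP i a = XP i a * X b" "e b * XP i a = XP i a * e b" using XP_comm[of i a b] b assms N by auto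
  define W where "W = XP (Suc b) j * EP j N"
  have "W \<in> K (Suc b) (Suc N)" unfolding W_def using assms by (intro K_ring(3) XP_K EP_K) auto
  from K_comm_XE[OF this, of a]
  have d: "X a * W = W * X a" "e a * W = W * e a"
    using b assms N by auto
  have al: "AL i j N = XP i a * (X a * (X b * W))"
    by (simp add: AL_def XP1 W_def mult.assoc)
  show "X b * AL i j N = AL i j N * X (b - 1)" "e b * AL i j N = AL i j N * e (b - 1)"
    unfolding al a_def[symmetric] by (simp_all only: lcomm[OF c(1)] lcomm[OF c(2)] s d mult.assoc)
qed

text \<open>The generator meets the right end \<open>j + 1\<close> of the arc and the strand just
  inside it: a crossing moves the end one place inwards, a cap cuts off a shortest arc and sends the
  remaining crossings to the other side.\<close>

lemma end_AL: assumes "1 \<le> i" "i < j" "j \<le> N"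
  shows "X j * AL i j N = AL i (j - 1) N" "e j * AL i j N = lai * (AL j j N * XP i (j - 1))"
proof -
  define a where "a = j - 1"
  have b: "j = Suc a" "i \<le> a" "1 \<le> a" using assms by (auto simp: a_def)
  have adj: "adj a j" using b assms N by (auto simp: adj_def)
  have al: "AL i j N = XP i a * (X a * (e j * EP (Suc j) N))"
  proof -
    have "XP i j = XP i a * X a" using b by (simp add: XP_snoc)
    moreover have "EP j N = e j * EP (Suc j) N" using assms by (simp add: EP_Cons)
    ultimately show ?thesis by (simp add: AL_def mult.assoc)
  qed
  have c: "X j * XP i a = XP i a * X j" "e j * XP i a = XP i a * e j" using XP_comm[of i a j] b assms N by auto
  have "X j * AL i j N = XP i a * ((X j * (X a * e j)) * EP (Suc j) N)" by (simp add: al lcomm[OF c(1)] mult.assoc)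
  also have "\<dots> = AL i a N"
  proof -
    have "EP a N = e a * (e j * EP (Suc j) N)" using b assms by (simp add: EP_Cons)
    then show ?thesis by (simp add: adj_rels(4)[OF adj] AL_def mult.assoc)
  qed
  finally show "X j * AL i j N = AL i (j - 1) N" by (simp add: a_def)
  have d: "XP i (j - 1) * EP j N = EP j N * XP i (j - 1)" unfolding a_def[symmetric]
    using H_comm_K[OF XP_H[of i a a] EP_K[of j j N "Suc N"]] b assms N by simp
  have "e j * AL i j N = XP i a * ((e j * (X a * e j)) * EP (Suc j) N)" by (simp add: al lcomm[OF c(2)] mult.assoc)
  also have "\<dots> = lai * (XP i a * EP j N)" using assms EP_Cons[of j N] by (simp add: eXe[OF adj] mult.assoc central_left params)
  finally show "e j * AL i j N = lai * (AL j j N * XP i (j - 1))" by (simp only: a_def d AL_def XP_nil[OF order_refl] mult.left_neutral)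
qed

text \<open>Here the right end meets the strand just outside and moves outwards. The relations
  produce \<open>Xi j\<close> where \<open>AL\<close> requires \<open>X j\<close>; the skein
  relation between the two is the source of the correction terms.\<close>

lemma Suc_end_AL: assumes "1 \<le> i" "i \<le> j" "j < N"
  shows "X (Suc j) * AL i j N = AL i (Suc j) N - dl * (AL (Suc j) (Suc j) N * XP i j) + dl * AL i j N"
     "e (Suc j) * AL i j N = AL (Suc j) (Suc j) N * XP i j"
proof -
  have adj: "adj j (Suc j)" using assms N by (auto simp: adj_def)
  have al: "AL i j N = XP i j * (e j * (e (Suc j) * EP (Suc (Suc j)) N))"
    using assms by (simp add: AL_def EP_Cons)
  have c: "X (Suc j) * XP i j = XP i j * X (Suc j)" "e (Suc j) * XP i j = XP i j * e (Suc j)" using XP_comm[of i j "Suc j"] assms N by auto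
  have d: "XP i j * EP (Suc j) N = EP (Suc j) N * XP i j"
    using H_comm_K[OF XP_H[of i j j] EP_K[of "Suc j" "Suc j" N "Suc N"]] assms N by simp
  have "X (Suc j) * AL i j N = XP i j * ((X (Suc j) * (e j * e (Suc j))) * EP (Suc (Suc j)) N)" by (simp add: al lcomm[OF c(1)] mult.assoc)
  also have "\<dots> = XP i j * (Xi j * EP (Suc j) N)" using assms EP_Cons[of "Suc j" N] by (simp add: Xi_ej_ei[OF adj_sym[OF adj]] mult.assoc)
  also have "Xi j * EP (Suc j) N = X j * EP (Suc j) N - dl * EP (Suc j) N + dl * (e j * EP (Suc j) N)"
    by (subst Xi_X) (use assms N in \<open>simp_all add: distrib_right left_diff_distrib mult.assoc\<close>)
  finally show "X (Suc j) * AL i j N = AL i (Suc j) N - dl * (AL (Suc j) (Suc j) N * XP i j) + dl * AL i j N"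
  proof -
    have "AL i (Suc j) N = XP i j * (X j * EP (Suc j) N)" using assms by (simp add: AL_def XP_snoc mult.assoc)
    moreover have "AL (Suc j) (Suc j) N * XP i j = XP i j * EP (Suc j) N" by (simp add: AL_def XP_nil d)
    moreover have "AL i j N = XP i j * (e j * EP (Suc j) N)" using assms EP_Cons[of j N] by (simp add: AL_def)
    ultimately show "X (Suc j) * AL i j N = XP i j * (X j * EP (Suc j) N - dl * EP (Suc j) N + dl * (e j * EP (Suc j) N)) \<Longrightarrow> ?thesis"
      by (simp only: distrib_left right_diff_distrib central_left[OF params(1)])
  qed
  have "e (Suc j) * AL i j N = XP i j * ((e (Suc j) * (e j * e (Suc j))) * EP (Suc (Suc j)) N)" by (simp add: al lcomm[OF c(2)] mult.assoc)
  also have "\<dots> = XP i j * EP (Suc j) N" using assms EP_Cons[of "Suc j" N] by (simp add: adj_rels(6)[OF adj] mult.assoc)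
  finally show "e (Suc j) * AL i j N = AL (Suc j) (Suc j) N * XP i j" by (simp add: d AL_def XP_nil)
qed

lemma low_AL: assumes "b + 1 < i" "1 \<le> b" "i \<le> j" "j \<le> N"
  shows "X b * AL i j N = AL i j N * X b" "e b * AL i j N = AL i j N * e b"
  using K_comm_XE[OF AL_K[OF order_refl, of i j N "Suc N"], of b] assms N by auto

text \<open>Excluding \<open>b = i\<close> and \<open>b + 1 = i\<close> keeps the generator away
  from the left end of the arc, where its power of Y' sits; then no arc starts to the left of
  \<open>i\<close> and no power is created.\<close>

lemma XE_AL:
  assumes "1 \<le> b" "b \<le> N" "1 \<le> i" "i \<le> j" "j \<le> N" "b \<noteq> i" "b + 1 \<noteq> i" "g \<in> {X b, e b}"
  shows "g * AL i j N \<in> GN N (\<lambda>i' c'. i \<le> i' \<and> c' = 0)"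
proof -
  consider "b + 1 < i" | "i < b" "b < j" | "i < b" "b = j" | "i < b" "b = Suc j" | "j + 2 \<le> b" using assms by linarith
  then show ?thesis
  proof cases
    case 1
    then have "X b \<in> H (N - 1)" "e b \<in> H (N - 1)" using assms by (auto intro!: H_gen)
    then show ?thesis using low_AL[OF 1 assms(1,4,5)] assms(8) by (auto intro!: GN_I0 assms)
  next
    case 2
    then have "X (b - 1) \<in> H (N - 1)" "e (b - 1) \<in> H (N - 1)" using assms by (auto intro!: H_gen)
    then show ?thesis using inner_AL[OF assms(3) 2 assms(5)] assms(8) by (auto intro!: GN_I0 assms)
  next
    case 3
    then have "XP i (j - 1) \<in> H (N - 1)" using assms by (auto intro!: XP_H)
    then have "AL j j N * XP i (j - 1) \<in> GN N (\<lambda>i' c'. i \<le> i' \<and> c' = 0)" "AL i (j - 1) N \<in> GN N (\<lambda>i' c'. i \<le> i' \<and> c' = 0)"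
      using 3 assms by (auto intro!: GN_I0 GN_I01)
    then show ?thesis using end_AL[of i j] 3 assms GN_scale[OF params(3)] by auto
  next
    case 4
    then have "XP i j \<in> H (N - 1)" using assms by (auto intro!: XP_H)
    then have "AL (Suc j) (Suc j) N * XP i j \<in> GN N (\<lambda>i' c'. i \<le> i' \<and> c' = 0)"
        "AL i (Suc j) N \<in> GN N (\<lambda>i' c'. i \<le> i' \<and> c' = 0)" "AL i j N \<in> GN N (\<lambda>i' c'. i \<le> i' \<and> c' = 0)"
      using 4 assms by (auto intro!: GN_I0 GN_I01)
    moreover from this have "AL i (Suc j) N - dl * (AL (Suc j) (Suc j) N * XP i j) + dl * AL i j N \<in> GN N (\<lambda>i' c'. i \<le> i' \<and> c' = 0)"
      by (intro GN_add GN_diff GN_scale[OF params(1)])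
    ultimately show ?thesis using Suc_end_AL[of i j] 4 assms by auto
  next
    case 5
    then have "X (b - 2) \<in> H (N - 1)" "e (b - 2) \<in> H (N - 1)" using assms by (auto intro!: H_gen)
    then show ?thesis using far_AL[OF assms(3,4) 5 assms(2)] assms(8) by (auto intro!: GN_I0 assms)
  qed
qed

lemma yp_AL: "b < i \<Longrightarrow> i \<le> j \<Longrightarrow> j \<le> N \<Longrightarrow> yp b c * AL i j N = AL i j N * yp b c"
  using yp_comm_K[OF AL_K[OF order_refl, of i j N "Suc N"], of b c] N by simp

lemma yp_AL': "b < i \<Longrightarrow> i \<le> j \<Longrightarrow> j \<le> N \<Longrightarrow> yp b c * (AL i j N * z) = AL i j N * (yp b c * z)"
  by (rule lcomm[OF yp_AL])

text \<open>A power of \<open>y i\<close> passes an arc that starts to the right of \<open>i\<close>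
  and is then absorbed into \<open>H (N - 1)\<close>. In front of an arc that starts at
  \<open>i\<close> it stays as its prefix.\<close>

lemma yp_GN:
  assumes "x \<in> GN N (\<lambda>i' c'. i \<le> i' \<and> c' = 0)"
  shows "yp i c * x \<in> GN N (\<lambda>i' c'. (i' = i \<and> c' = c) \<or> (i < i' \<and> c' = 0))"
  using assms
proof (rule GN_l)
  fix i' and c' :: int and j assume *: "i \<le> i' \<and> c' = 0" "1 \<le> i'" "i' \<le> j" "j \<le> N"
  show "yp i c * (yp i' c' * AL i' j N) \<in> GN N (\<lambda>i' c'. (i' = i \<and> c' = c) \<or> (i < i' \<and> c' = 0))"
  proof (cases "i' = i")
    case True then show ?thesis using * by (auto intro!: GN_I1)
  next
    case False
    then show ?thesis using * by (auto simp: yp_AL intro!: GN_I0 yp_H)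
  qed
qed

lemma XE_yp_AL:
  assumes "1 \<le> b" "b \<le> N" "1 \<le> i" "i \<le> j" "j \<le> N" "b \<noteq> i" "b + 1 \<noteq> i" "g \<in> {X b, e b}"
  shows "g * (yp i c * AL i j N) \<in> GN N (\<lambda>i' c'. (i' = i \<and> c' = c) \<or> (i < i' \<and> c' = 0))"
proof -
  have "g * yp i c = yp i c * g" using yp_comm_XE[of b i c] assms N by auto
  then have "g * (yp i c * AL i j N) = yp i c * (g * AL i j N)" by (rule lcomm)
  then show ?thesis using yp_GN[OF XE_AL[OF assms]] by (simp only:)
qed

text \<open>If the arc is shortest this is \<open>sandwich i\<close>. Otherwise the cap moves the
  power to strand \<open>Suc i\<close>, past the first crossing of the arc, which the cap then turns
  into \<open>la\<close>; what remains is a cap on an arc starting at \<open>Suc i\<close>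
  (\<open>e_AL_Suc\<close>), or errors in which \<open>sandwich i\<close> applies again.\<close>

lemma e_yp_AL_factor:
  assumes "1 \<le> i" "i \<le> j" "j \<le> N"
  shows "\<exists>h\<in>H (N - 1). e i * (yp i m * AL i j N) = AL i i N * h"
proof -
  have i: "i < n" using assms N by simp
  let ?T = "zs {AL i i N * h | h. h \<in> H (N - 1)}"
  have T: "AL i i N * h \<in> ?T" if "h \<in> H (N - 1)" for h using that by (intro zspan_base) blast
  have ex: "\<exists>h\<in>H (N - 1). x = AL i i N * h" if "x \<in> ?T" for x
    using that
  proof (induction rule: zspan.induct)
    case zspan_zero then show ?case using H_ring(2) by (metis mult_zero_right)
  next
    case (zspan_add x y)
    then obtain h h' where "h \<in> H (N - 1)" "x = AL i i N * h" "h' \<in> H (N - 1)" "y = AL i i N * h'" by blast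
    then show ?case by (intro bexI[of _ "h + h'"]) (auto simp: distrib_left intro: H_ring)
  next
    case (zspan_scale z x)
    then obtain h where "h \<in> H (N - 1)" "x = AL i i N * h" by blast
    then show ?case using zspan_scale(1) by (intro bexI[of _ "z * h"]) (auto simp: central_left intro: H_ring)
  qed auto
  have Fi: "\<exists>h\<in>H (i - 1). e i * (yp i c * e i) = h * e i" for c using sandwich[OF assms(1) i] by (auto simp: sandwich_def)
  have ez: "\<exists>h\<in>H (i - 1). e i * (yp i c * (e i * z)) = e i * (h * z)" for c z
  proof -
    obtain h where h: "h \<in> H (i - 1)" "e i * (yp i c * e i) = h * e i" using Fi by blast
    have "h * e i = e i * h" using H_comm_XE(2)[OF h(1), of i] assms(1) i by simp
    then have "e i * (yp i c * (e i * z)) = e i * (h * z)" using h(2) by (metis mult.assoc)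
    then show ?thesis using h by blast
  qed
  have hAL: "h * AL i' j' N = AL i' j' N * h" if "h \<in> H (i' - 1)" "1 \<le> i'" "i' \<le> j'" "j' \<le> N" for h i' j'
    using H_comm_K[OF that(1) AL_K[OF order_refl that(3,4), of "Suc N"]] N that by simp
  show ?thesis
  proof (cases "i = j")
    case True
    have al: "AL i i N = e i * EP (Suc i) N" using assms by (simp add: AL_def XP_nil EP_Cons)
    obtain h where h: "h \<in> H (i - 1)" "e i * (yp i m * (e i * EP (Suc i) N)) = e i * (h * EP (Suc i) N)" using ez by blast
    have "h * e i = e i * h" using H_comm_XE(2)[OF h(1), of i] assms(1) i by simp
    then have "e i * (yp i m * AL i j N) = h * AL i i N" using h True al by (metis mult.assoc)
    then show ?thesis using hAL[OF h(1), of i] assms H_mono[OF h(1), of "N - 1"] by auto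
  next
    case False
    then have j: "i < j" "i \<le> N - 1" "Suc i \<le> j" using assms by auto
    let ?al = "AL (Suc i) j N"
    have ea: "e i * ?al = AL i i N * XiR i (j - 1)" using e_AL_Suc[OF assms(1) j(1) assms(3)] .
    have eay: "e i * (?al * h) \<in> ?T" if "h \<in> H (N - 1)" for h
    proof -
      have "e i * (?al * h) = AL i i N * (XiR i (j - 1) * h)" using ea by (simp only: mult.assoc[symmetric])
      moreover have "XiR i (j - 1) \<in> H (N - 1)" using assms by (intro XiR_H) auto
      ultimately show ?thesis using T[OF H_ring(3)[OF _ that]] by presburger
    qed
    have ey: "e i * (yp i c * ?al) \<in> ?T" for c
      using eay[OF yp_H[OF j(2), of c]] yp_AL[of i "Suc i" j c] j assms by simp
    have main: "e i * (yp (Suc i) c * (X i * ?al)) \<in> ?T" for c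
    proof -
      have eq: "yp (Suc i) c * (X i * ?al) = X i * (yp i c * ?al) - (X i * yp i c - yp (Suc i) c * X i) * ?al"
        by (simp add: left_diff_distrib mult.assoc)
      have "e i * ((X i * yp i c - yp (Suc i) c * X i) * ?al) \<in> ?T"
        unfolding mult.assoc[symmetric]
      proof (rule zs_rmult[OF zs_lmult[OF X_yp[OF assms(1) i]]])
        show "e i * a \<in> zs {e i * (yp (Suc i) d * v * yp i (c - d)) | d v. d \<in> rng c \<and> v \<in> {1, e i}}"
          if "a \<in> {yp (Suc i) d * v * yp i (c - d) | d v. d \<in> rng c \<and> v \<in> {1, e i}}" for a
          using that by (intro zspan_base) blast
      next
        fix a assume "a \<in> {e i * (yp (Suc i) d * v * yp i (c - d)) | d v. d \<in> rng c \<and> v \<in> {1, e i}}"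
        then obtain d v where a: "a = e i * (yp (Suc i) d * v * yp i (c - d))" "v \<in> {1, e i}" by blast
        have a1: "a * ?al = e i * (yp i (- d) * (v * (yp i (c - d) * ?al)))"
        proof -
          have "a * ?al = (e i * yp (Suc i) d) * (v * (yp i (c - d) * ?al))" by (simp only: a(1) mult.assoc)
          then show ?thesis by (simp only: yp_Suc_e(2)[OF assms(1) i, of d] mult.assoc)
        qed
        show "a * ?al \<in> ?T"
        proof (cases "v = 1")
          case True
          then have "a * ?al = e i * (yp i (- d + (c - d)) * ?al)" using a1 yp_add[of i "- d" "c - d"] i by (simp add: mult.assoc)
          then show ?thesis using ey by presburger
        next
          case False
          then have v: "v = e i" using a by simp
          obtain h where h: "h \<in> H (i - 1)" "e i * (yp i (- d) * (e i * (yp i (c - d) * ?al))) = e i * (h * (yp i (c - d) * ?al))" using ez by blast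
          have "a * ?al = e i * (?al * (h * yp i (c - d)))"
          proof -
            have "h \<in> H (Suc i - 1)" using H_mono[OF h(1), of i] by simp
            then have "h * ?al = ?al * h" using hAL j assms by simp
            then have "h * (yp i (c - d) * ?al) = ?al * (h * yp i (c - d))"
              using yp_AL[of i "Suc i" j "c - d"] j assms by (simp add: mult.assoc[symmetric])
            then show ?thesis using h(2) a1 v by simp
          qed
          moreover have "h * yp i (c - d) \<in> H (N - 1)" using H_mono[OF h(1), of "N - 1"] j yp_H by (intro H_ring(3)) auto
          ultimately show ?thesis using eay by presburger
        qed
      qed
      moreover have "e i * (X i * (yp i c * ?al)) = la * (e i * (yp i c * ?al))"
        using Xe(2)[OF assms(1) i] by (metis mult.assoc)
      ultimately show ?thesis unfolding eq right_diff_distrib using ey by (simp add: zs_diff zspan_scale params)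
    qed
    have "e i * (yp i m * AL i j N) = e i * (yp (Suc i) (- m) * (X i * ?al))"
    proof -
      have "e i * yp i m = e i * yp (Suc i) (- m)" using yp_Suc_e(2)[OF assms(1) i, of "- m"] by simp
      then have "e i * yp i m * AL i j N = e i * yp (Suc i) (- m) * AL i j N" by simp
      then show ?thesis by (simp only: AL_le[OF j(1)] mult.assoc)
    qed
    then show ?thesis using ex main by presburger
  qed
qed

end

end

lemma zpw_intertwine:
  assumes a: "a * ai = 1" "ai * a = (1::'b::monoid_mult)" and b: "b * bi = 1" "bi * b = 1" and x: "x * a = b * x"
  shows "x * zpw a ai c = zpw b bi c * x"
proof -
  have "bi * (x * a) * ai = bi * (b * x) * ai" by (simp only: x)
  then have xi: "x * ai = bi * x" by (metis a(1) b(2) mult.assoc mult.left_neutral mult.right_neutral)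
  have p: "x * u ^ m = v ^ m * x" if "x * u = v * x" for u v m
  proof (induction m)
    case (Suc m)
    have "x * u ^ Suc m = v * (x * u ^ m)" using that by (metis mult.assoc power_Suc)
    then show ?case using Suc by (simp add: mult.assoc)
  qed simp
  show ?thesis using p[OF x] p[OF xi] by (simp add: zpw_def)
qed

section \<open>Left multiplication of one-arc words by all generators\<close>

context bmw_ring
begin

lemma zs_GN:
  assumes "x \<in> zs A" "\<And>a. a \<in> A \<Longrightarrow> g * (a * g') \<in> GN N \<Phi>"
  shows "g * (x * g') \<in> GN N \<Phi>"
proof -
  have "x * g' \<in> zs ((\<lambda>a. a * g') ` A)" by (rule zs_rmult[OF assms(1)]) (auto intro: zspan_base)
  then show ?thesis unfolding GN_def by (rule zs_lmult) (use assms(2) in \<open>auto simp only: GN_def\<close>)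
qed

lemma zs_GN1: "x \<in> zs A \<Longrightarrow> (\<And>a. a \<in> A \<Longrightarrow> a * g' \<in> GN N \<Phi>) \<Longrightarrow> x * g' \<in> GN N \<Phi>"
  using zs_GN[of x A 1 g'] by simp

lemma ag_GN:
  assumes "h \<in> ag G" "\<And>g i c j. g \<in> G \<Longrightarrow> \<Phi> i c \<Longrightarrow> 1 \<le> i \<Longrightarrow> i \<le> j \<Longrightarrow> j \<le> N \<Longrightarrow> g * (yp i c * AL i j N) \<in> GN N \<Phi>"
    "x \<in> GN N \<Phi>"
  shows "h * x \<in> GN N \<Phi>"
  using assms(1,3)
proof (induction arbitrary: x rule: algen.induct)
  case (algen_scalar z) then show ?case by (simp add: GN_scale)
next
  case (algen_gen g) show ?case by (rule GN_l[OF algen_gen(2)]) (rule assms(2)[OF algen_gen(1)])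
next
  case (algen_mult a b) then show ?case by (simp add: mult.assoc)
next
  case (algen_add a b) then show ?case by (simp add: distrib_right GN_add)
qed

lemma GN_e:
  assumes "\<And>g. g \<in> {X b, e b} \<Longrightarrow> g * x \<in> GN N \<Phi>" "x \<in> GN N \<Phi>" "1 \<le> b" "b < n"
  shows "Xi b * x \<in> GN N \<Phi>"
proof -
  have "Xi b * x = X b * x - dl * x + dl * (e b * x)"
    by (subst Xi_X[OF assms(3,4)]) (simp add: distrib_right left_diff_distrib mult.assoc)
  moreover have "X b * x - dl * x + dl * (e b * x) \<in> GN N \<Phi>"
    by (intro GN_add GN_diff GN_scale params assms) auto
  ultimately show ?thesis by simp
qed

context
  fixes N assumes N: "1 \<le> N" "N < n"
begin

lemma e_AL_Suc_mult: "1 \<le> i \<Longrightarrow> i < j \<Longrightarrow> j \<le> N \<Longrightarrow> e i * (AL (Suc i) j N * h) = AL i i N * (XiR i (j - 1) * h)"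
  using e_AL_Suc[OF N, of i j] by (simp only: mult.assoc[symmetric])

lemma yp_Suc_AL_diag: assumes "1 \<le> i" "i \<le> N" shows "yp (Suc i) c * (AL i i N * h) = yp i (- c) * (AL i i N * h)"
proof -
  have al: "AL i i N = e i * EP (Suc i) N" using assms by (simp add: AL_def XP_nil EP_Cons)
  have "yp (Suc i) c * e i = yp i (- c) * e i" using yp_Suc_e(1)[of i c] assms N by simp
  then show ?thesis unfolding al by (simp only: mult.assoc[symmetric])
qed

text \<open>The power either passes the first crossing of the arc, or meets a cap at
  \<open>i\<close> and slides to the starting point. In the second case its sign changes, whence
  \<open>- c'\<close> in the condition.\<close>

lemma yp_Suc_AL:
  assumes "1 \<le> i" "i \<le> j" "j \<le> N"
  shows "yp (Suc i) c * AL i j N \<in> GN N (\<lambda>i' c'. (i' = Suc i \<and> btw c' c) \<or> (i' = i \<and> btw (- c') c))" (is "_ \<in> GN N ?\<Phi>")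
proof (cases "i = j")
  case True
  have "?\<Phi> i (- c)" by (auto simp: btw_def)
  then show ?thesis using yp_Suc_AL_diag[of i c 1] assms True GN_I1[of ?\<Phi> i "- c" i N] by simp
next
  case False
  then have j: "i < j" "Suc i \<le> j" "i \<le> N - 1" and i: "i < n" using assms N by auto
  let ?al = "AL (Suc i) j N"
  have eq: "yp (Suc i) c * AL i j N = X i * (yp i c * ?al) - (X i * yp i c - yp (Suc i) c * X i) * ?al"
    by (simp add: AL_le[OF N j(1)] left_diff_distrib mult.assoc)
  have "X i * (yp i c * ?al) = AL i j N * yp i c"
    using yp_AL[OF N, of i "Suc i" j c] j assms by (simp add: AL_le[OF N j(1)] mult.assoc)
  moreover have "AL i j N * yp i c \<in> GN N ?\<Phi>"
    by (rule GN_I0) (use assms j yp_H in \<open>auto simp: btw_def\<close>)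
  moreover have "(X i * yp i c - yp (Suc i) c * X i) * ?al \<in> GN N ?\<Phi>"
  proof (rule zs_GN1[OF X_yp[OF assms(1) i]])
    fix a assume "a \<in> {yp (Suc i) d * v * yp i (c - d) | d v. d \<in> rng c \<and> v \<in> {1, e i}}"
    then obtain d v where a: "a = yp (Suc i) d * v * yp i (c - d)" "d \<in> rng c" "v \<in> {1, e i}" by blast
    have d: "btw d c" using rng_btw[OF a(2)] by simp
    have a1: "a * ?al = yp (Suc i) d * (v * (?al * yp i (c - d)))"
      using yp_AL[OF N, of i "Suc i" j "c - d"] j assms by (simp add: a(1) mult.assoc)
    show "a * ?al \<in> GN N ?\<Phi>"
    proof (cases "v = 1")
      case True
      then show ?thesis unfolding a1 using d j assms yp_H by (simp del: One_nat_def) (rule GN_I; simp)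
    next
      case False
      then have "v = e i" using a by simp
      then have "a * ?al = yp i (- d) * (AL i i N * (XiR i (j - 1) * yp i (c - d)))"
        unfolding a1 using e_AL_Suc_mult[of i j] yp_Suc_AL_diag[of i d] j assms by simp
      moreover have "XiR i (j - 1) * yp i (c - d) \<in> H (N - 1)" using assms j by (intro H_ring(3) XiR_H[OF N] yp_H) auto
      ultimately show ?thesis using GN_I[of ?\<Phi> i "- d" i N] d assms by simp
    qed
  qed
  ultimately show ?thesis unfolding eq using GN_diff by presburger
qed

lemma e_yp_AL:
  assumes "1 \<le> i" "i \<le> j" "j \<le> N"
  shows "e i * (yp i c * AL i j N) \<in> GN N (\<lambda>i' c'. i' = i \<and> c' = 0)"
  using e_yp_AL_factor[OF N assms, of c] assms by (auto intro!: GN_I0)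

text \<open>Once it has passed the power, \<open>X i\<close> meets the first generator of the arc: a
  cap gives \<open>la\<close>, another crossing is removed by the quadratic relation
  \<open>XX\<close>. Powers of \<open>y (Suc i)\<close> are then handled by
  \<open>yp_Suc_AL\<close>, which can change signs, so for arcs that still start at \<open>i\<close>
  only the absolute value is bounded.\<close>

lemma X_yp_AL:
  assumes "1 \<le> i" "i \<le> j" "j \<le> N"
  shows "X i * (yp i c * AL i j N) \<in> GN N (\<lambda>i' c'. (i' = Suc i \<and> btw c' c) \<or> (i' = i \<and> \<bar>c'\<bar> \<le> \<bar>c\<bar>))" (is "_ \<in> GN N ?\<Phi>")
proof -
  have i: "i < n" using assms N by simp
  have Lw: "yp (Suc i) c * AL i j N \<in> GN N ?\<Phi>"
    by (rule GN_mono[OF yp_Suc_AL[OF assms]]) (auto simp: btw_def)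
  have 1: "yp (Suc i) c * (X i * AL i j N) \<in> GN N ?\<Phi>"
  proof (cases "i = j")
    case True
    have "AL i i N = e i * EP (Suc i) N" using assms by (simp add: AL_def XP_nil EP_Cons)
    then have "X i * AL i j N = la * AL i j N" using True Xe(1)[OF assms(1) i] by (simp add: mult.assoc[symmetric])
    then show ?thesis using GN_scale[OF params(2) Lw] by (simp add: central_left[OF params(2)])
  next
    case False
    then have j: "i < j" "Suc i \<le> j" using assms by auto
    let ?al = "AL (Suc i) j N"
    have "X i * AL i j N = (X i * X i) * ?al" by (simp add: AL_le[OF N j(1)] mult.assoc)
    also have "\<dots> = ?al + dl * AL i j N - dl * (la * (AL i i N * XiR i (j - 1)))"
      using e_AL_Suc[OF N assms(1) j(1) assms(3)] by (simp add: XX[OF assms(1) i] distrib_right left_diff_distrib mult.assoc AL_le[OF N j(1)])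
    finally have "yp (Suc i) c * (X i * AL i j N) = yp (Suc i) c * ?al + dl * (yp (Suc i) c * AL i j N) - dl * (la * (yp i (- c) * (AL i i N * XiR i (j - 1))))"
      using yp_Suc_AL_diag[of i c "XiR i (j - 1)"] assms
      by (simp only: distrib_left right_diff_distrib central_left[OF params(1), of "yp (Suc i) c"] central_left[OF params(2), of "yp (Suc i) c"])
    moreover have "yp (Suc i) c * ?al \<in> GN N ?\<Phi>" by (rule GN_I1) (use j assms in \<open>auto simp: btw_def\<close>)
    moreover have "yp i (- c) * (AL i i N * XiR i (j - 1)) \<in> GN N ?\<Phi>"
      using assms by (intro GN_I XiR_H[OF N]) auto
    ultimately show ?thesis using Lw by (simp add: GN_add GN_diff GN_scale params)
  qed
  have 2: "(X i * yp i c - yp (Suc i) c * X i) * AL i j N \<in> GN N ?\<Phi>"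
  proof (rule zs_GN1[OF X_yp[OF assms(1) i]])
    fix a assume "a \<in> {yp (Suc i) d * v * yp i (c - d) | d v. d \<in> rng c \<and> v \<in> {1, e i}}"
    then obtain d v where a: "a = yp (Suc i) d * v * yp i (c - d)" "d \<in> rng c" "v \<in> {1, e i}" by blast
    have d: "btw d c" using rng_btw[OF a(2)] by simp
    show "a * AL i j N \<in> GN N ?\<Phi>"
    proof (cases "v = 1")
      case True
      have "yp i (c - d) * (yp (Suc i) d * AL i j N) \<in> GN N ?\<Phi>"
      proof (rule GN_l[OF yp_Suc_AL[OF assms]])
        fix i' c' j' assume *: "(i' = Suc i \<and> btw c' d) \<or> (i' = i \<and> btw (- c') d)" "1 \<le> i'" "i' \<le> j'" "j' \<le> N"
        from *(1) show "yp i (c - d) * (yp i' c' * AL i' j' N) \<in> GN N ?\<Phi>"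
        proof
          assume 1: "i' = Suc i \<and> btw c' d"
          have "yp i (c - d) * (yp i' c' * AL i' j' N) = yp i' c' * (AL i' j' N * yp i (c - d))"
            using lcomm[OF yp_comm[of i "Suc i" "c - d" c']] yp_AL[OF N, of i i' j' "c - d"] 1 * N by simp
          moreover have "?\<Phi> i' c'" using 1 d by (auto simp: btw_def)
          ultimately show ?thesis using 1 * by (simp only:) (rule GN_I; use yp_H in simp)
        next
          assume 1: "i' = i \<and> btw (- c') d"
          have "yp i (c - d) * (yp i' c' * AL i' j' N) = yp i (c - d + c') * AL i j' N"
            using 1 i yp_add[of i "c - d" c'] by (simp add: mult.assoc)
          moreover have "?\<Phi> i (c - d + c')" using 1 d by (auto simp: btw_def)
          ultimately show ?thesis using 1 * by (simp only:) (rule GN_I1; simp)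
        qed
      qed
      moreover have "a * AL i j N = yp i (c - d) * (yp (Suc i) d * AL i j N)"
        using yp_comm[of i "Suc i" "c - d" d] i True a by (simp add: mult.assoc[symmetric])
      ultimately show ?thesis by simp
    next
      case False
      then have v: "v = e i" using a by simp
      obtain h where h: "h \<in> H (N - 1)" "e i * (yp i (c - d) * AL i j N) = AL i i N * h" using e_yp_AL_factor[OF N assms] by blast
      have "a * AL i j N = yp i (- d) * (AL i i N * h)"
        using h(2) yp_Suc_AL_diag[of i d h] assms by (simp add: a(1) v mult.assoc)
      moreover have "?\<Phi> i (- d)" using d by (auto simp: btw_def)
      ultimately show ?thesis using assms h(1) by (simp only:) (rule GN_I; simp)
    qed
  qed
  have "X i * (yp i c * AL i j N) = (X i * yp i c - yp (Suc i) c * X i) * AL i j N + yp (Suc i) c * (X i * AL i j N)"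
    by (simp add: left_diff_distrib mult.assoc)
  then show ?thesis using GN_add[OF 2 1] by simp
qed

context
  fixes b j assumes b: "1 \<le> b" "Suc b \<le> j" "j \<le> N"
begin

lemma b': "b < n" "b < j" "b \<le> N - 1" "b < Suc b" using b N by auto

lemma yp_yp_Suc_AL:
  shows "v \<in> {1, e b} \<Longrightarrow> yp b d * v * yp (Suc b) m * AL (Suc b) j N \<in> GN N (\<lambda>i' c'. (i' = Suc b \<and> c' = m) \<or> (i' = b \<and> c' = d))" (is "_ \<Longrightarrow> _ \<in> GN N ?\<Phi>")
   and "e b * (yp (Suc b) m * AL (Suc b) j N) \<in> GN N (\<lambda>i' c'. i' = b \<and> c' = 0)"
   and "V \<in> {X b, Xi b} \<Longrightarrow> yp b d * (V * AL (Suc b) j N) \<in> GN N (\<lambda>i' c'. (i' = Suc b \<and> c' = 0) \<or> (i' = b \<and> c' = d))"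
proof -
  let ?al = "AL (Suc b) j N"
  have ya: "yp b d * ?al = ?al * yp b d" for d using yp_AL[OF N, of b "Suc b" j d] b by simp
  have e: "e b * (yp (Suc b) m * ?al) = AL b b N * (XiR b (j - 1) * yp b (- m))" for m
  proof -
    have "e b * (yp (Suc b) m * ?al) = e b * yp b (- m) * ?al" using yp_Suc_e(2)[of b m] b b' by (simp add: mult.assoc[symmetric])
    then show ?thesis using e_AL_Suc_mult[of b j "yp b (- m)"] ya b b' by (simp add: mult.assoc)
  qed
  have hH: "XiR b (j - 1) * yp b m \<in> H (N - 1)" for m using b b' by (intro H_ring(3) XiR_H[OF N] yp_H) auto
  show "e b * (yp (Suc b) m * ?al) \<in> GN N (\<lambda>i' c'. i' = b \<and> c' = 0)"
    unfolding e using b hH by (intro GN_I0) auto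
  {
    assume v: "v \<in> {1, e b}"
    show "yp b d * v * yp (Suc b) m * ?al \<in> GN N ?\<Phi>"
    proof (cases "v = 1")
      case True
      then have "yp b d * v * yp (Suc b) m * ?al = yp (Suc b) m * (?al * yp b d)"
        using lcomm[OF yp_comm[of b "Suc b" d m], of ?al] ya b b' by (simp add: mult.assoc)
      then show ?thesis using b b' yp_H by (simp only:) (rule GN_I; simp)
    next
      case False
      then have "yp b d * v * yp (Suc b) m * ?al = yp b d * (AL b b N * (XiR b (j - 1) * yp b (- m)))"
        using v e by (simp add: mult.assoc)
      then show ?thesis using b b' hH by (simp only:) (rule GN_I; simp)
    qed
  }
  assume V: "V \<in> {X b, Xi b}"
  let ?\<Psi> = "\<lambda>i' c'. (i' = Suc b \<and> c' = (0::int)) \<or> (i' = b \<and> c' = d)"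
  have X: "yp b d * (X b * ?al) \<in> GN N ?\<Psi>" using GN_I1[of ?\<Psi> b d j N] b b' AL_le[OF N b'(2)] by simp
  have 1: "yp b d * ?al \<in> GN N ?\<Psi>" unfolding ya using b b' yp_H by (intro GN_I0) auto
  have 2: "yp b d * (e b * ?al) \<in> GN N ?\<Psi>" using e[of 0] hH[of 0] GN_I[of ?\<Psi> b d b N] b b' by simp
  have "Xi b * ?al = X b * ?al - dl * ?al + dl * (e b * ?al)"
    by (subst Xi_X) (use b b' in \<open>simp_all add: distrib_right left_diff_distrib mult.assoc\<close>)
  then have "yp b d * (Xi b * ?al) = yp b d * (X b * ?al) - dl * (yp b d * ?al) + dl * (yp b d * (e b * ?al))"
    by (simp add: distrib_left right_diff_distrib central_left[OF params(1)])
  then have "yp b d * (Xi b * ?al) \<in> GN N ?\<Psi>" using X 1 2 by (simp add: GN_add GN_diff GN_scale params)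
  then show "yp b d * (V * ?al) \<in> GN N ?\<Psi>" using V X by auto
qed

text \<open>The inverse crossing is treated first because it turns \<open>y (Suc b)\<close> into
  \<open>y b\<close> while prolonging the arc to the left; \<open>X b\<close> follows by the skein
  relation. No sign changes here, so the exponents lie between 0 and \<open>c\<close>.\<close>

lemma adj_yp_Suc_AL:
  assumes "V \<in> {X b, Xi b, e b}"
  shows "V * (yp (Suc b) c * AL (Suc b) j N) \<in> GN N (\<lambda>i' c'. (i' = Suc b \<and> btw c' c) \<or> (i' = b \<and> btw c' c))" (is "_ \<in> GN N ?\<Phi>")
proof -
  let ?al = "AL (Suc b) j N"
  have E: "e b * (yp (Suc b) c * ?al) \<in> GN N ?\<Phi>"
    by (rule GN_mono[OF yp_yp_Suc_AL(2)]) (auto simp: btw_def)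
  have "(Xi b * yp (Suc b) c - yp b c * Xi b) * ?al \<in> GN N ?\<Phi>"
  proof (rule zs_GN1[OF Xi_yp[OF b(1) b'(1)]])
    fix a assume "a \<in> {yp b d * v * yp (Suc b) (c - d) | d v. d \<in> rng c \<and> v \<in> {1, e b}}"
    then obtain d v where a: "a = yp b d * v * yp (Suc b) (c - d)" "d \<in> rng c" "v \<in> {1, e b}" by blast
    show "a * ?al \<in> GN N ?\<Phi>" unfolding a(1)
      by (rule GN_mono[OF yp_yp_Suc_AL(1)[OF a(3)]]) (use rng_btw[OF a(2)] in auto)
  qed
  moreover have "yp b c * (Xi b * ?al) \<in> GN N ?\<Phi>"
    by (rule GN_mono[OF yp_yp_Suc_AL(3)]) (auto simp: btw_def)
  moreover have "Xi b * (yp (Suc b) c * ?al) = (Xi b * yp (Suc b) c - yp b c * Xi b) * ?al + yp b c * (Xi b * ?al)"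
    by (simp add: left_diff_distrib mult.assoc)
  ultimately have XI: "Xi b * (yp (Suc b) c * ?al) \<in> GN N ?\<Phi>" using GN_add by presburger
  have 0: "yp (Suc b) c * ?al \<in> GN N ?\<Phi>" using b by (intro GN_I1) (auto simp: btw_def)
  have "X b * (yp (Suc b) c * ?al) = Xi b * (yp (Suc b) c * ?al) + dl * (yp (Suc b) c * ?al) - dl * (e b * (yp (Suc b) c * ?al))"
    by (subst X_Xi) (use b b' in \<open>simp_all add: distrib_right right_diff_distrib left_diff_distrib mult.assoc\<close>)
  then have "X b * (yp (Suc b) c * ?al) \<in> GN N ?\<Phi>" using XI 0 E by (simp add: GN_add GN_diff GN_scale params)
  then show ?thesis using XI E assms by auto
qed

lemma yp_Suc_AL_lower:
  assumes "c \<noteq> 0"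
  obtains V V' where "V \<in> {X b, Xi b}" "V' \<in> {X b, Xi b}" "V' * V = 1"
    "V * (yp (Suc b) c * AL (Suc b) j N) \<in> GN N (\<lambda>i' c'. (i' = Suc b \<and> \<bar>c'\<bar> < \<bar>c\<bar>) \<or> i' = b)"
proof -
  let ?al = "AL (Suc b) j N" and ?\<Phi> = "\<lambda>i' c'. (i' = Suc b \<and> \<bar>c'\<bar> < \<bar>c\<bar>) \<or> i' = b"
  obtain V V' where V: "(V = X b \<and> V' = Xi b) \<or> (V = Xi b \<and> V' = X b)"
    "V * yp (Suc b) c - yp b c * V \<in> zs {yp b d * v * yp (Suc b) (c - d) | d v. \<bar>c - d\<bar> < \<bar>c\<bar> \<and> v \<in> {1, e b}}"
    using yp_lower[OF b(1) b'(1) assms] by blast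
  have "(V * yp (Suc b) c - yp b c * V) * ?al \<in> GN N ?\<Phi>"
  proof (rule zs_GN1[OF V(2)])
    fix a assume "a \<in> {yp b d * v * yp (Suc b) (c - d) | d v. \<bar>c - d\<bar> < \<bar>c\<bar> \<and> v \<in> {1, e b}}"
    then obtain d v where a: "a = yp b d * v * yp (Suc b) (c - d)" "\<bar>c - d\<bar> < \<bar>c\<bar>" "v \<in> {1, e b}" by blast
    show "a * ?al \<in> GN N ?\<Phi>" unfolding a(1)
      by (rule GN_mono[OF yp_yp_Suc_AL(1)[OF a(3)]]) (use a(2) in auto)
  qed
  moreover have "yp b c * (V * ?al) \<in> GN N ?\<Phi>"
    by (rule GN_mono[OF yp_yp_Suc_AL(3)]) (use V(1) assms in auto)
  moreover have "V * (yp (Suc b) c * ?al) = (V * yp (Suc b) c - yp b c * V) * ?al + yp b c * (V * ?al)"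
    by (simp add: left_diff_distrib mult.assoc)
  ultimately have "V * (yp (Suc b) c * ?al) \<in> GN N ?\<Phi>" using GN_add by presburger
  moreover have "V' * V = 1" using V(1) X_inv[OF b(1) b'(1)] by auto
  ultimately show ?thesis using that V(1) by blast
qed

end

text \<open>Collects all positions of the generator. A new starting point is never smaller than both
  \<open>i\<close> and \<open>b\<close>, and an exponent not between 0 and \<open>c\<close> can
  appear only when the generator touches the starting point from the right, \<open>b = i\<close>,
  and then only on an arc still starting at \<open>i\<close>.\<close>

lemma gen_yp_AL:
  assumes "1 \<le> b" "b \<le> N" "1 \<le> i" "i \<le> j" "j \<le> N" "g \<in> {X b, e b, Xi b}"
  shows "g * (yp i c * AL i j N) \<in> GN N (\<lambda>i' c'. (i' = i \<and> c' = c) \<or> (i < i' \<and> c' = 0) \<or> (b \<le> i' \<and> btw c' c) \<or> (b = i \<and> i' = i \<and> \<bar>c'\<bar> \<le> \<bar>c\<bar>))"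
proof -
  let ?\<Phi> = "\<lambda>i' c'. (i' = i \<and> c' = c) \<or> (i < i' \<and> c' = 0) \<or> (b \<le> i' \<and> btw c' c) \<or> (b = i \<and> i' = i \<and> \<bar>c'\<bar> \<le> \<bar>c\<bar>)"
  have 1: "g * (yp i c * AL i j N) \<in> GN N ?\<Phi>" if g: "g \<in> {X b, e b}" for g
  proof -
    consider "b = i" | "i = Suc b" | "b \<noteq> i" "b + 1 \<noteq> i" by linarith
    then show ?thesis
    proof cases
      case 1
      have "X i * (yp i c * AL i j N) \<in> GN N ?\<Phi>"
        by (rule GN_mono[OF X_yp_AL]) (use assms 1 in auto)
      moreover have "e i * (yp i c * AL i j N) \<in> GN N ?\<Phi>"
        by (rule GN_mono[OF e_yp_AL]) (use assms 1 in \<open>auto simp: btw_def\<close>)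
      ultimately show ?thesis using g 1 by auto
    next
      case 2
      have "g * (yp (Suc b) c * AL (Suc b) j N) \<in> GN N ?\<Phi>"
        by (rule GN_mono[OF adj_yp_Suc_AL]) (use assms g 2 in auto)
      then show ?thesis using 2 by simp
    next
      case 3
      show ?thesis by (rule GN_mono[OF XE_yp_AL[OF N assms(1-5) 3 g]]) auto
    qed
  qed
  have "yp i c * AL i j N \<in> GN N ?\<Phi>" using assms by (intro GN_I1) auto
  then have "Xi b * (yp i c * AL i j N) \<in> GN N ?\<Phi>" using 1 assms N by (intro GN_e) auto
  then show ?thesis using 1 assms(6) by auto
qed

text \<open>A generator with index at least \<open>m\<close> cannot move a starting point below
  \<open>m\<close>. The exponent is bounded by absolute value because such a generator may change
  its sign.\<close>

lemma GN_K:
  assumes "g \<in> K m (Suc N)" "1 \<le> m" "x \<in> GN N (\<lambda>i c. m \<le> i \<and> \<bar>c\<bar> \<le> r)"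
  shows "g * x \<in> GN N (\<lambda>i c. m \<le> i \<and> \<bar>c\<bar> \<le> r)"
proof (rule ag_GN[OF assms(1)[unfolded K_def] _ assms(3)])
  fix g i j and c :: int assume g: "g \<in> {g. \<exists>b\<ge>m. b < Suc N \<and> g \<in> {X b, Xi b, e b}}"
    and *: "m \<le> i \<and> \<bar>c\<bar> \<le> r" "1 \<le> i" "i \<le> j" "j \<le> N"
  from g obtain b where b: "m \<le> b" "b \<le> N" "g \<in> {X b, e b, Xi b}" by auto
  show "g * (yp i c * AL i j N) \<in> GN N (\<lambda>i c. m \<le> i \<and> \<bar>c\<bar> \<le> r)"
    by (rule GN_mono[OF gen_yp_AL[of b i j g c]]) (use assms b * in \<open>auto simp: btw_def\<close>)
qed

lemma e_AL: "e N = AL N N N" using N by (simp add: AL_def XP_nil EP_Cons EP_nil)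

lemma K_e:
  assumes "g \<in> K m (Suc N)" "1 \<le> m" "m \<le> N"
  shows "g * e N \<in> GN N (\<lambda>i c. m \<le> i \<and> c = 0)"
proof -
  have "AL N N N \<in> GN N (\<lambda>i c. m \<le> i \<and> \<bar>c\<bar> \<le> 0)" using assms N by (intro GN_I01) auto
  from GN_K[OF assms(1,2) this] show ?thesis by (simp add: e_AL)
qed

lemma y_K_e:
  assumes "g \<in> K m (Suc N)" "1 \<le> m" "m \<le> N"
  shows "yp m c * (g * e N) \<in> GN N (\<lambda>i c'. (i = m \<and> c' = c) \<or> (m < i \<and> c' = 0))"
  by (rule yp_GN[OF N K_e[OF assms]])

lemma K_y_K_e:
  assumes "g \<in> K m (Suc N)" "g' \<in> K m (Suc N)" "1 \<le> m" "m \<le> N"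
  shows "g' * (yp m c * (g * e N)) \<in> GN N (\<lambda>i c'. m \<le> i \<and> \<bar>c'\<bar> \<le> \<bar>c\<bar>)"
  by (rule GN_K[OF assms(2,3)], rule GN_mono[OF y_K_e[OF assms(1,3,4)]]) auto

lemma GN_H:
  assumes "g \<in> H (Suc N)" "x \<in> GN N (\<lambda>i c. True)"
  shows "g * x \<in> GN N (\<lambda>i c. True)"
proof (rule ag_GN[OF assms(1)[unfolded H_def] _ assms(2)])
  fix g i j c assume g: "g \<in> gens (Suc N)" and *: "1 \<le> i" "i \<le> j" "j \<le> N"
  show "g * (yp i c * AL i j N) \<in> GN N (\<lambda>i c. True)"
  proof (cases "g \<in> {Y, Yi}")
    case False
    then obtain b where b: "1 \<le> b" "b \<le> N" "g \<in> {X b, e b, Xi b}" using g by (auto simp: gens_def)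
    show ?thesis
      by (rule GN_mono[OF gen_yp_AL[of b i j g c]]) (use assms b * in auto)
  next
    case True
    show ?thesis
    proof (cases "i = 1")
      case i: True
      have "g = yp 1 1 \<or> g = yp 1 (- 1)" using True by (auto simp: yp_def zpw_def)
      then obtain d where "g = yp i d" using i by blast
      then have "g * (yp i c * AL i j N) = yp i (d + c) * AL i j N" using yp_add[of i d c] N i by (simp add: mult.assoc)
      then show ?thesis using * by (auto intro: GN_I1)
    next
      case False
      then have 2: "1 < i" using * by simp
      have g1: "g \<in> H 1" using True H_gen(4,5)[of 1] by auto
      have "g * yp i c = yp i c * g" using H_comm_yp[OF g1 2] * N by simp
      moreover have "g * AL i j N = AL i j N * g" using H_comm_K[OF g1 AL_K[OF order_refl *(2,3), of "Suc N"]] 2 N by simp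
      ultimately have "g * (yp i c * AL i j N) = yp i c * (AL i j N * g)" by (metis mult.assoc)
      moreover have "g \<in> H (N - 1)" using H_mono[OF g1] 2 * by simp
      ultimately show ?thesis using * by (auto intro: GN_I)
    qed
  qed
qed

text \<open>For starting point 1 this is the order relation. For \<open>Suc b\<close>, multiplying
  by a suitable crossing \<open>V\<close> lowers the exponent or moves the arc to start at
  \<open>b\<close>; both cases are known by induction, and multiplying by \<open>V'\<close> undoes
  the step.\<close>

lemma yp_AL_bounded:
  assumes "1 \<le> i" "i \<le> j" "j \<le> N"
  shows "yp i c * AL i j N \<in> GN N (\<lambda>i c. c \<in> S)"
  using assms
proof (induction i arbitrary: c j)
  case 0 then show ?case by simp
next
  case (Suc b)
  show ?case
  proof (cases "b = 0")
    case True
    have "1 \<le> n" using N by simp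
    from Y_span_S[OF this, of c] have "yp 1 c * AL 1 j N \<in> GN N (\<lambda>i c. c \<in> S)"
      by (rule zs_GN1) (use Suc True in \<open>auto intro!: GN_I1\<close>)
    then show ?thesis using True by simp
  next
    case False
    then have b: "1 \<le> b" by simp
    have IHb: "yp b c * AL b j N \<in> GN N (\<lambda>i c. c \<in> S)" if "b \<le> j" "j \<le> N" for c j
      using Suc.IH[OF b] that by simp
    show ?thesis using Suc.prems
    proof (induction "nat \<bar>c\<bar>" arbitrary: c j rule: less_induct)
      case less
      show ?case
      proof (cases "c = 0")
        case True then show ?thesis using less S_0 by (intro GN_I1) auto
      next
        case False
        obtain V V' where V: "V' \<in> {X b, Xi b}" "V' * V = 1"
          and Vx: "V * (yp (Suc b) c * AL (Suc b) j N) \<in> GN N (\<lambda>i' c'. (i' = Suc b \<and> \<bar>c'\<bar> < \<bar>c\<bar>) \<or> i' = b)"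
          by (rule yp_Suc_AL_lower[OF b less.prems(2,3) False])
        have IH: "yp (Suc b) c' * AL (Suc b) j' N \<in> GN N (\<lambda>i c. c \<in> S)" if "\<bar>c'\<bar> < \<bar>c\<bar>" "Suc b \<le> j'" "j' \<le> N" for c' j'
          using less.hyps[of c' j'] that by auto
        have V'S: "V' * x \<in> GN N (\<lambda>i c. c \<in> S)" if "x \<in> GN N (\<lambda>i c. c \<in> S)" for x
          using that
        proof (rule GN_l)
          fix i s j assume s: "s \<in> S" and *: "1 \<le> i" "i \<le> j" "j \<le> N"
          have "V' * (yp i s * AL i j N) \<in> GN N (\<lambda>i' c'. (i' = i \<and> c' = s) \<or> (i < i' \<and> c' = 0) \<or> (b \<le> i' \<and> btw c' s) \<or> (b = i \<and> i' = i \<and> \<bar>c'\<bar> \<le> \<bar>s\<bar>))"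
            using gen_yp_AL[of b i j V' s] V b less * by auto
          then have "1 * (V' * (yp i s * AL i j N)) \<in> GN N (\<lambda>i c. c \<in> S)"
          proof (rule GN_l)
            fix i' c' j' assume **: "(i' = i \<and> c' = s) \<or> (i < i' \<and> c' = 0) \<or> (b \<le> i' \<and> btw c' s) \<or> (b = i \<and> i' = i \<and> \<bar>c'\<bar> \<le> \<bar>s\<bar>)" "1 \<le> i'" "i' \<le> j'" "j' \<le> N"
            \<comment> \<open>Undoing the step can push an exponent out of the window only by the
              last alternative, where its absolute value is bounded but its sign is not. Then the
              arc starts at \<open>b\<close>, and the outer induction applies.\<close>
            then consider "c' \<in> S" | "i' = b" using s S_0 btw_S by blast
            then show "1 * (yp i' c' * AL i' j' N) \<in> GN N (\<lambda>i c. c \<in> S)"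
            proof cases
              case 1 then show ?thesis using ** by (auto intro: GN_I1)
            next
              case 2 then show ?thesis using IHb ** by simp
            qed
          qed
          then show "V' * (yp i s * AL i j N) \<in> GN N (\<lambda>i c. c \<in> S)" by simp
        qed
        have "V' * (V * (yp (Suc b) c * AL (Suc b) j N)) \<in> GN N (\<lambda>i c. c \<in> S)"
          using Vx
        proof (rule GN_l)
          fix i c' j' assume *: "(i = Suc b \<and> \<bar>c'\<bar> < \<bar>c\<bar>) \<or> i = b" "1 \<le> i" "i \<le> j'" "j' \<le> N"
          from *(1) show "V' * (yp i c' * AL i j' N) \<in> GN N (\<lambda>i c. c \<in> S)"
          proof
            assume 1: "i = Suc b \<and> \<bar>c'\<bar> < \<bar>c\<bar>"
            then show ?thesis using IH * by (intro V'S) auto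
          next
            assume 1: "i = b"
            then show ?thesis using IHb * by (intro V'S) auto
          qed
        qed
        moreover have "V' * (V * x) = x" for x using V(2) by (simp add: mult.assoc[symmetric])
        ultimately show ?thesis by simp
      qed
    qed
  qed
qed

lemma GN_S: "x \<in> GN N \<Phi> \<Longrightarrow> x \<in> GN N (\<lambda>i c. c \<in> S)"
  using GN_l[of x N \<Phi> 1 "\<lambda>i c. c \<in> S"] yp_AL_bounded by simp

lemma H_e_GN: assumes "h \<in> H (Suc N)" shows "h * e N \<in> GN N (\<lambda>i c. True)" "h * e N \<in> GN N (\<lambda>i c. c \<in> S)"
proof -
  have "AL N N N \<in> GN N (\<lambda>i c. True)" using N by (intro GN_I01) auto
  then show "h * e N \<in> GN N (\<lambda>i c. True)" using GN_H[OF assms] e_AL by simp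
  then show "h * e N \<in> GN N (\<lambda>i c. c \<in> S)" by (rule GN_S)
qed

text \<open>The analogue of a conditional expectation. By \<open>H_e_GN\<close> only one-arc words
  have to be placed behind \<open>e N\<close>: if the arc starts at \<open>N\<close>, this is
  \<open>sandwich N\<close>; otherwise its power lies in \<open>H (N - 1)\<close> and
  \<open>e N\<close> collapses with the last generators of the arc.\<close>

lemma e_H_e: assumes "h \<in> H (Suc N)" shows "\<exists>h'\<in>H (N - 1). e N * (h * e N) = h' * e N"
proof (rule zs_Hr, rule zs_lmult[OF H_e_GN(1)[OF assms, unfolded GN_def]], clarify)
  fix i j c h assume *: "1 \<le> i" "i \<le> j" "j \<le> N" "h \<in> H (N - 1)"
  let ?T = "zs {h * e N | h. h \<in> H (N - 1)}"
  have T: "h * e N \<in> ?T" if "h \<in> H (N - 1)" for h using that by (intro zspan_base) blast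
  have Hc: "e N * h = h * e N" if "h \<in> H (N - 1)" for h using H_comm_XE(2)[OF that, of N] N by simp
  show "e N * (yp i c * (AL i j N * h)) \<in> ?T"
  proof (cases "i = N")
    case True
    then have j: "j = N" using * by simp
    obtain h0 where h0: "h0 \<in> H (N - 1)" "e N * (yp N c * e N) = h0 * e N" using sandwich[OF N] by (auto simp: sandwich_def)
    have "e N * (yp N c * (e N * h)) = h0 * e N * h" using h0(2) by (simp only: mult.assoc[symmetric])
    also have "\<dots> = (h0 * h) * e N" using Hc[OF *(4)] by (simp add: mult.assoc)
    finally show ?thesis using T[OF H_ring(3)[OF h0(1) *(4)]] True j e_AL by simp
  next
    case False
    then have i: "i \<le> N - 1" "1 \<le> N - 1" using * by auto
    have adj: "adj (N - 1) N" using i N by (auto simp: adj_def)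
    obtain P where P: "P \<in> H (N - 1)" "e N * AL i j N = P * e N"
    proof (cases "j = N")
      case True
      have "AL i j N = XP i (N - 1) * (X (N - 1) * e N)"
        using True XP_snoc[of i "N - 1"] i e_AL by (simp add: AL_def XP_nil mult.assoc)
      then have "e N * AL i j N = XP i (N - 1) * (e N * (X (N - 1) * e N))"
        using lcomm[OF Hc[OF XP_H[OF N *(1) order_refl]]] by simp
      then have "e N * AL i j N = (lai * XP i (N - 1)) * e N" using eXe[OF adj] by (simp add: mult.assoc central_left params)
      then show ?thesis using that[OF H_ring(6)[OF params(3) XP_H[OF N *(1) order_refl]]] by simp
    next
      case False
      then have j: "j \<le> N - 1" using * by simp
      define Q where "Q = XP i j * EP j (N - 2)"
      have Q: "Q \<in> H (N - 1)" unfolding Q_def using * i j by (intro H_ring(3) XP_H[OF N] K_H[OF EP_K[OF order_refl]]) auto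
      have "EP j N = EP j (N - 2) * (e (N - 1) * e N)"
      proof -
        have "EP (N - 1) N = e (N - 1) * EP N N" using EP_Cons[of "N - 1" N] N by simp
        moreover have "EP N N = e N" by (simp add: EP_Cons EP_nil)
        moreover have "EP j N = EP j (N - 1 - 1) * EP (N - 1) N" using i j by (intro EP_split) auto
        ultimately show ?thesis by (simp add: numeral_2_eq_2)
      qed
      then have "AL i j N = Q * (e (N - 1) * e N)" by (simp add: AL_def Q_def mult.assoc)
      then have "e N * AL i j N = Q * (e N * (e (N - 1) * e N))" using lcomm[OF Hc[OF Q]] by simp
      then show ?thesis using that[OF Q] adj_rels(6)[OF adj] by simp
    qed
    have yH: "yp i c \<in> H (N - 1)" using i(1) by (rule yp_H)
    have "e N * (yp i c * (AL i j N * h)) = yp i c * (e N * AL i j N * h)"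
      using lcomm[OF Hc[OF yH]] by (simp add: mult.assoc)
    also have "\<dots> = (yp i c * P * h) * e N" using P(2) Hc[OF *(4)] by (simp add: mult.assoc)
    finally show ?thesis using T[OF H_ring(3)[OF H_ring(3)[OF yH P(1)] *(4)]] by simp
  qed
qed

end

text \<open>The lower end of \<open>S\<close> is at most 1 minus its upper end, and the upper end is
  at least minus the lower end. If \<open>s\<close> is positive, then \<open>d\<close> is at least 1
  and the bound is \<open>s - 1\<close>; otherwise the bound is \<open>- s\<close>. In both cases
  the interval symmetric about 0 with this bound lies in \<open>S\<close>.\<close>

lemma rng_S: assumes "s \<in> S" "d \<in> rng s" shows "d \<in> S" "\<And>c. \<bar>c\<bar> \<le> \<bar>s - d\<bar> \<Longrightarrow> c \<in> S"
proof -
  show "d \<in> S" using btw_S rng_btw assms by blast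
  fix c assume c: "\<bar>c\<bar> \<le> \<bar>s - d\<bar>"
  have k: "2 * int (k div 2) \<le> int k" "int k \<le> 2 * int (k div 2) + 1" by linarith+
  have s: "int (k div 2) - (int k - 1) \<le> s" "s \<le> int (k div 2)" using assms(1) by (auto simp: S_def)
  consider "1 \<le> d" "d \<le> s" | "s + 1 \<le> d" "d \<le> 0" using assms(2) by (auto simp: rng_def)
  then show "c \<in> S"
  proof cases
    case 1
    then have "\<bar>c\<bar> \<le> s - 1" using c by linarith
    then show ?thesis unfolding S_def atLeastAtMost_iff using s k by linarith
  next
    case 2
    then have "\<bar>c\<bar> \<le> - s" using c by linarith
    then show ?thesis unfolding S_def atLeastAtMost_iff using s k by linarith
  qed
qed

section \<open>Exchanging two consecutive arcs\<close>

context
  fixes N assumes N: "1 \<le> N" "N < n"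
begin

text \<open>On the right of the arc the strands \<open>j - 1\<close> and \<open>j\<close> are
  neighbours; on the left they are \<open>j\<close> and \<open>j + 2\<close>, with the end
  \<open>j + 1\<close> of the arc between them. Conjugation by \<open>X j\<close> brings them
  together. This is the case not covered by \<open>inner_AL\<close> and
  \<open>far_AL\<close>.\<close>

lemma AL_inner:
  assumes "1 \<le> i" "i < j" "j < N"
  shows "AL i j N * X (j - 1) = Xi j * (X (Suc j) * (X j * AL i j N))"
    "AL i j N * e (j - 1) = Xi j * (e (Suc j) * (X j * AL i j N))"
proof -
  define a where "a = j - 1"
  have j: "j = Suc a" "i \<le> a" "1 \<le> a" using assms by (auto simp: a_def)
  have adj: "adj a j" "adj j (Suc j)" using j assms N by (auto simp: adj_def)
  define W where "W = EP (Suc (Suc j)) N"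
  have al: "AL i j N = XP i a * (X a * (e j * (e (Suc j) * W)))"
  proof -
    have "XP i j = XP i a * X a" using j by (simp add: XP_snoc)
    moreover have "EP j N = e j * (e (Suc j) * W)" using assms by (simp add: EP_Cons W_def)
    ultimately show ?thesis by (simp add: AL_def mult.assoc)
  qed
  have "W \<in> K (Suc (Suc j)) (Suc N)" unfolding W_def by (intro EP_K) auto
  from K_comm_XE[OF this, of a] have w: "X a * W = W * X a" "e a * W = W * e a" using j assms N by auto
  have f: "X a * e (Suc j) = e (Suc j) * X a" "e a * e (Suc j) = e (Suc j) * e a" "X (Suc j) * e a = e a * X (Suc j)"
    using far_comm[of a "Suc j"] far_comm[of "Suc j" a] j assms N by auto
  have c: "X j * XP i a = XP i a * X j" "Xi j * XP i a = XP i a * Xi j"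
      "X (Suc j) * XP i a = XP i a * X (Suc j)" "e (Suc j) * XP i a = XP i a * e (Suc j)"
    using XP_comm[OF N, of i a j] XP_comm[OF N, of i a "Suc j"] j assms N by auto
  have Xae: "X a * (e j * z) = Xi j * (e a * (e j * z))" for z
    using Xj_ei[OF adj_sym[OF adj(1)]] by (metis mult.assoc)
  have XXe: "X j * (X a * (e j * z)) = e a * (e j * z)" for z
    using adj_rels(4)[OF adj(1)] by (metis mult.assoc)
  have l1: "X a * (e j * (X a * (e (Suc j) * z))) = Xi j * (e a * (Xi j * (e (Suc j) * z)))" for z
  proof -
    have "e a * (e j * (X a * (e (Suc j) * z))) = e a * (Xi j * (e (Suc j) * z))"
      using ei_ej_Xi[OF adj(1)] by (metis mult.assoc)
    then show ?thesis by (simp only: Xae)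
  qed
  have r1: "X (Suc j) * (e a * (e j * (e (Suc j) * z))) = e a * (Xi j * (e (Suc j) * z))" for z
  proof -
    have "X (Suc j) * (e j * (e (Suc j) * z)) = Xi j * (e (Suc j) * z)"
      using Xi_ej_ei[OF adj_sym[OF adj(2)]] by (metis mult.assoc)
    then show ?thesis by (simp only: lcomm[OF f(3)])
  qed
  have l2: "X a * (e j * (e a * (e (Suc j) * z))) = Xi j * (e a * (e (Suc j) * z))" for z
  proof -
    have "e a * (e j * (e a * (e (Suc j) * z))) = e a * (e (Suc j) * z)"
      using adj_rels(3)[OF adj(1)] by (metis mult.assoc)
    then show ?thesis by (simp only: Xae)
  qed
  have r2: "e (Suc j) * (e a * (e j * (e (Suc j) * z))) = e a * (e (Suc j) * z)" for z
  proof -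
    have "e (Suc j) * (e j * (e (Suc j) * z)) = e (Suc j) * z"
      using adj_rels(6)[OF adj(2)] by (metis mult.assoc)
    then show ?thesis by (simp only: lcomm[OF f(2)[symmetric]])
  qed
  have "AL i j N * X a = XP i a * (X a * (e j * (X a * (e (Suc j) * W))))"
    by (simp only: al mult.assoc w[symmetric] lcomm[OF f(1)])
  also have "\<dots> = Xi j * (X (Suc j) * (X j * AL i j N))"
    by (simp only: l1 al lcomm[OF c(1)] lcomm[OF c(2)] lcomm[OF c(3)] XXe r1)
  finally show "AL i j N * X (j - 1) = Xi j * (X (Suc j) * (X j * AL i j N))" by (simp add: a_def)
  have "AL i j N * e a = XP i a * (X a * (e j * (e a * (e (Suc j) * W))))"
    by (simp only: al mult.assoc w[symmetric] lcomm[OF f(2)])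
  also have "\<dots> = Xi j * (e (Suc j) * (X j * AL i j N))"
    by (simp only: l2 al lcomm[OF c(1)] lcomm[OF c(2)] lcomm[OF c(4)] XXe r2)
  finally show "AL i j N * e (j - 1) = Xi j * (e (Suc j) * (X j * AL i j N))" by (simp add: a_def)
qed

text \<open>The number, in front of an arc from \<open>i\<close> to \<open>j + 1\<close>, of the
  strand that has number \<open>a\<close> behind it, where \<open>i \<le> a\<close>.\<close>

definition shift_strand :: "nat \<Rightarrow> nat \<Rightarrow> nat" where "shift_strand j a = (if j \<le> a then a + 2 else a + 1)"

lemma AL_commute_XE:
  assumes "1 \<le> i" "i \<le> j" "j \<le> N" "i \<le> b" "b + 2 \<le> N" "g \<in> {X b, e b}"
  shows "\<exists>g'\<in>K (shift_strand j b) (Suc N). AL i j N * g = g' * AL i j N"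
proof -
  consider "j \<le> b" | "j = Suc b" | "Suc b < j" by linarith
  then show ?thesis
  proof cases
    case 1
    then have "AL i j N * g = X (b + 2) * AL i j N \<or> AL i j N * g = e (b + 2) * AL i j N"
      using far_AL[OF N, of i j "b + 2"] assms by auto
    moreover have "X (b + 2) \<in> K (shift_strand j b) (Suc N)" "e (b + 2) \<in> K (shift_strand j b) (Suc N)"
      using 1 assms by (auto simp: shift_strand_def intro: K_gen)
    ultimately show ?thesis by blast
  next
    case 2
    then have "AL i j N * g = (Xi j * (X (Suc j) * X j)) * AL i j N \<or> AL i j N * g = (Xi j * (e (Suc j) * X j)) * AL i j N"
      using AL_inner[of i j] assms by (auto simp: mult.assoc)
    moreover have "Xi j * (X (Suc j) * X j) \<in> K (shift_strand j b) (Suc N)" "Xi j * (e (Suc j) * X j) \<in> K (shift_strand j b) (Suc N)"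
      using 2 assms by (auto simp: shift_strand_def intro!: K_gen K_ring(3))
    ultimately show ?thesis by blast
  next
    case 3
    then have "AL i j N * g = X (b + 1) * AL i j N \<or> AL i j N * g = e (b + 1) * AL i j N"
      using inner_AL[OF N, of i "b + 1" j] assms by auto
    moreover have "X (b + 1) \<in> K (shift_strand j b) (Suc N)" "e (b + 1) \<in> K (shift_strand j b) (Suc N)"
      using 3 assms by (auto simp: shift_strand_def intro: K_gen)
    ultimately show ?thesis by blast
  qed
qed

text \<open>What matters is the support of the new factor: it begins beyond \<open>i\<close>, so
  that the power of \<open>y i\<close> in front of the arc commutes with it.\<close>

lemma AL_commute_K:
  assumes "1 \<le> i" "i \<le> j" "j \<le> N" "i \<le> a" "h \<in> K a (N - 1)"
  shows "\<exists>g\<in>K (shift_strand j a) (Suc N). AL i j N * h = g * AL i j N"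
  using assms(5) unfolding K_def[of a]
proof (induction rule: algen.induct)
  case (algen_scalar z)
  then show ?case using central[OF algen_scalar, of "AL i j N"] K_ring(5) by metis
next
  case (algen_gen g)
  then obtain b where b: "a \<le> b" "b < N - 1" "g \<in> {X b, Xi b, e b}" by blast
  have shift_strand: "shift_strand j a \<le> shift_strand j b" using b by (simp add: shift_strand_def)
  have XE: "\<exists>g'\<in>K (shift_strand j a) (Suc N). AL i j N * g = g' * AL i j N" if g: "g \<in> {X b, e b}" for g
  proof -
    have "i \<le> b" "b + 2 \<le> N" using assms b by auto
    from AL_commute_XE[OF assms(1-3) this g] show ?thesis using K_mono[OF _ shift_strand order_refl] by blast
  qed
  obtain g1 g2 where g1: "g1 \<in> K (shift_strand j a) (Suc N)" "AL i j N * X b = g1 * AL i j N"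
    and g2: "g2 \<in> K (shift_strand j a) (Suc N)" "AL i j N * e b = g2 * AL i j N" using XE by blast
  have "AL i j N * Xi b = AL i j N * X b - dl * AL i j N + dl * (AL i j N * e b)"
    by (subst Xi_X) (use assms b N in \<open>simp_all add: distrib_left right_diff_distrib central_left[OF params(1)] central[OF params(1), of "AL i j N", symmetric]\<close>)
  then have "AL i j N * Xi b = (g1 - dl + dl * g2) * AL i j N"
    by (simp add: g1 g2 distrib_right left_diff_distrib mult.assoc)
  moreover have "g1 - dl + dl * g2 \<in> K (shift_strand j a) (Suc N)"
    by (rule K_ring(4)[OF K_ring(7)[OF g1(1) K_ring(5)[OF params(1)]] K_ring(6)[OF params(1) g2(1)]])
  ultimately show ?case using b(3) XE by blast
next
  case (algen_add x y)
  then obtain g g' where "g \<in> K (shift_strand j a) (Suc N)" "AL i j N * x = g * AL i j N"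
     "g' \<in> K (shift_strand j a) (Suc N)" "AL i j N * y = g' * AL i j N" by blast
  then show ?case by (intro bexI[of _ "g + g'"]) (auto simp: distrib_left distrib_right intro: K_ring)
next
  case (algen_mult x y)
  then obtain g g' where *: "g \<in> K (shift_strand j a) (Suc N)" "AL i j N * x = g * AL i j N"
     "g' \<in> K (shift_strand j a) (Suc N)" "AL i j N * y = g' * AL i j N" by blast
  then have "AL i j N * (x * y) = (g * g') * AL i j N" by (metis mult.assoc)
  then show ?case using * by (intro bexI[of _ "g * g'"]) (auto intro: K_ring)
qed

text \<open>The last cap of the second arc is carried in front of the first arc and becomes
  \<open>e N\<close> between factors of restricted support. From this \<open>e N\<close> a new first
  arc starting further to the right is grown by \<open>K_e\<close>.\<close>

lemma AL_commute_e:
  assumes "1 \<le> i" "i \<le> j" "j \<le> N" "i \<le> a" "a + 2 \<le> N"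
  shows "\<exists>g1\<in>K (shift_strand j a) (Suc N). \<exists>g2\<in>K (shift_strand j a) (Suc N). AL i j N * e (N - 2) = g1 * (e N * (g2 * AL i j N))"
proof -
  consider "j + 2 \<le> N" | "Suc j = N" | "j = N" using assms by linarith
  then show ?thesis
  proof cases
    case 1
    then have "AL i j N * e (N - 2) = 1 * (e N * (1 * AL i j N))" using far_AL[OF N assms(1,2), of N] by simp
    then show ?thesis using K_ring(1) by blast
  next
    case 2
    have "j - 1 = N - 2" "i < j" using 2 assms by auto
    then have "AL i j N * e (N - 2) = Xi j * (e N * (X j * AL i j N))" using AL_inner[of i j] 2 assms by auto
    moreover have "Xi j \<in> K (shift_strand j a) (Suc N)" "X j \<in> K (shift_strand j a) (Suc N)" using 2 assms by (auto simp: shift_strand_def intro!: K_gen)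
    ultimately show ?thesis by blast
  next
    case 3
    have adj: "adj (N - 1) N" using assms N by (auto simp: adj_def)
    have "N - 1 - 1 = N - 2" by simp
    then have "AL i j N * e (N - 2) = e (N - 1) * AL i j N" using inner_AL[OF N assms(1), of "N - 1" j] 3 assms by auto
    \<comment> \<open>If the first arc ends at the last point, the cap arrives as
      \<open>e (N - 1)\<close>; the relation \<open>e (N - 1) * e N * e (N - 1) = e (N - 1)\<close>
      supplies the required \<open>e N\<close>.\<close>
    then have "AL i j N * e (N - 2) = e (N - 1) * (e N * (e (N - 1) * AL i j N))"
      using adj_rels(3)[OF adj] by (metis mult.assoc)
    moreover have "e (N - 1) \<in> K (shift_strand j a) (Suc N)" using 3 assms by (auto simp: shift_strand_def intro!: K_gen)
    ultimately show ?thesis by blast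
  qed
qed

lemma AL_commute_AL:
  assumes "1 \<le> i" "i \<le> j" "j \<le> N" "i \<le> a" "a \<le> j2" "j2 + 2 \<le> N"
  shows "\<exists>g1\<in>K (shift_strand j a) (Suc N). \<exists>g2\<in>K (shift_strand j a) (Suc N). AL i j N * AL a j2 (N - 2) = g1 * (e N * (g2 * AL i j N))"
proof -
  obtain M where M: "N - 2 = Suc M" using assms by (metis le_add_diff_inverse2 add.commute le_trans not0_implies_Suc Nat.le_diff_conv2 not_one_le_zero add_leD2)
  define h where "h = XP a j2 * EP j2 M"
  have h: "h \<in> K a (N - 1)" unfolding h_def using assms M by (intro K_ring(3) XP_K EP_K) auto
  have "EP j2 (N - 2) = EP j2 M * e (N - 2)" unfolding M using M assms by (intro EP_snoc) auto
  then have al: "AL a j2 (N - 2) = h * e (N - 2)" by (simp add: AL_def h_def mult.assoc)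
  obtain g where g: "g \<in> K (shift_strand j a) (Suc N)" "AL i j N * h = g * AL i j N" using AL_commute_K[OF assms(1-4) h] by blast
  obtain g1 g2 where g12: "g1 \<in> K (shift_strand j a) (Suc N)" "g2 \<in> K (shift_strand j a) (Suc N)"
    "AL i j N * e (N - 2) = g1 * (e N * (g2 * AL i j N))" using AL_commute_e[OF assms(1-4)] assms by auto
  have "AL i j N * AL a j2 (N - 2) = (g * g1) * (e N * (g2 * AL i j N))"
    using g(2) g12(3) unfolding al by (metis mult.assoc)
  then show ?thesis using g12 K_ring(3)[OF g(1) g12(1)] by blast
qed

text \<open>For \<open>a = j\<close> the power slides through the two caps \<open>e j\<close> and
  \<open>e (Suc j)\<close> in turn, moving up two strands and changing sign twice. Larger
  \<open>a\<close> follow by conjugating with crossings, which \<open>far_AL\<close> shifts by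
  two.\<close>

lemma AL_yp:
  assumes "1 \<le> i" "i \<le> j" "j \<le> a" "a + 2 \<le> N"
  shows "AL i j N * yp a c = yp (a + 2) c * AL i j N"
proof -
  have "AL i j N * y a = y (a + 2) * AL i j N"
    using assms(3,4)
  proof (induction a rule: dec_induct)
    case base
    have nn: "j < n" "Suc j < n" "Suc (Suc j) \<le> n" using base N by auto
    define W where "W = EP (Suc (Suc j)) N"
    have al: "AL i j N = XP i j * (e j * (e (Suc j) * W))"
      using base by (simp add: AL_def EP_Cons W_def)
    have "W \<in> K (Suc (Suc j)) (Suc N)" unfolding W_def by (intro EP_K) auto
    then have w: "W * y j = y j * W" using yp_comm_K[of W _ _ j 1] N by simp
    have c1: "y (Suc (Suc j)) * e j = e j * y (Suc (Suc j))"
      using yp_comm_XE(2)[of j "Suc (Suc j)" 1] assms nn by simp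
    have c2: "y (Suc (Suc j)) * XP i j = XP i j * y (Suc (Suc j))"
      using H_comm_y[OF XP_H[OF N assms(1) order_refl, of j], of "Suc (Suc j)"] nn by (simp del: y.simps)
    have c3: "e (Suc j) * y j = y j * e (Suc j)" using yp_comm_XE(2)[of "Suc j" j 1] assms nn by simp
    have e1: "e j * y j = e j * yp (Suc j) (- 1)" using yp_Suc_e(2)[of j "- 1"] assms nn by simp
    have e2: "yp (Suc j) (- 1) * e (Suc j) = y (Suc (Suc j)) * e (Suc j)" using yp_Suc_e(1)[of "Suc j" 1] nn by simp
    have "e j * (e (Suc j) * y j) = y (Suc (Suc j)) * (e j * e (Suc j))"
    proof -
      have "e j * (e (Suc j) * y j) = e j * y j * e (Suc j)" by (simp only: c3 mult.assoc)
      also have "\<dots> = e j * (yp (Suc j) (- 1) * e (Suc j))" by (simp only: e1 mult.assoc)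
      also have "\<dots> = y (Suc (Suc j)) * e j * e (Suc j)" by (simp only: e2 c1 mult.assoc)
      finally show ?thesis by (simp only: mult.assoc)
    qed
    then have e3: "e j * (e (Suc j) * (y j * z)) = y (Suc (Suc j)) * (e j * (e (Suc j) * z))" for z by (metis mult.assoc)
    have "AL i j N * y j = XP i j * (e j * (e (Suc j) * (y j * W)))" by (simp only: al mult.assoc w)
    also have "\<dots> = y (Suc (Suc j)) * AL i j N" by (simp only: e3 al lcomm[OF c2])
    finally show ?case by simp
  next
    case (step a)
    have IH: "AL i j N * y a = y (a + 2) * AL i j N" using step by simp
    have X: "AL i j N * X a = X (a + 2) * AL i j N" using far_AL(1)[OF N assms(1,2), of "a + 2"] step by simp
    have "y (Suc a) = X a * (y a * X a)" "y (Suc a + 2) = X (a + 2) * (y (a + 2) * X (a + 2))"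
      using y_Suc(1)[of a] y_Suc(1)[of "a + 2"] step assms by (simp_all add: mult.assoc)
    then have "AL i j N * y (Suc a) = AL i j N * X a * (y a * X a)" by (simp only: mult.assoc)
    also have "\<dots> = X (a + 2) * (AL i j N * y a * X a)" by (simp only: X mult.assoc)
    also have "\<dots> = X (a + 2) * (y (a + 2) * (AL i j N * X a))" by (simp only: IH mult.assoc)
    also have "\<dots> = y (Suc a + 2) * AL i j N" by (simp only: X \<open>y (Suc a + 2) = _\<close> mult.assoc)
    finally show ?case .
  qed
  then show ?thesis unfolding yp_def using y_inv[of a] y_inv[of "a + 2"] assms N by (intro zpw_intertwine) auto
qed

text \<open>The old arc ends in \<open>e N\<close>, so by \<open>e_H_e\<close> everything behind the
  first \<open>e N\<close> shrinks to \<open>e N\<close> times an element of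
  \<open>H (N - 1)\<close>. Only the arc grown from that \<open>e N\<close> remains.\<close>

lemma K_y_K_e_AL:
  assumes "g0 \<in> K m (Suc N)" "g1 \<in> K m (Suc N)" "x \<in> H (Suc N)" "1 \<le> m" "m \<le> N" "1 \<le> i" "i \<le> j" "j \<le> N"
  shows "yp m c * (g1 * (e N * (x * AL i j N))) \<in> GN N (\<lambda>i c'. (i = m \<and> c' = c) \<or> (m < i \<and> c' = 0))"
    "g0 * (yp m c * (g1 * (e N * (x * AL i j N)))) \<in> GN N (\<lambda>i c'. m \<le> i \<and> \<bar>c'\<bar> \<le> \<bar>c\<bar>)"
proof -
  define x' where "x' = x * (XP i j * EP j (N - 1))"
  have x': "x' \<in> H (Suc N)" unfolding x'_def using assms by (intro H_ring(3) K_H[OF EP_K[of 1]] XP_H[OF N]) auto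
  have "EP j N = EP j (N - 1) * e N" using EP_snoc[of j "N - 1"] assms by simp
  then have xal: "x * AL i j N = x' * e N" by (simp add: AL_def x'_def mult.assoc)
  obtain h where h: "h \<in> H (N - 1)" "e N * (x' * e N) = h * e N" using e_H_e[OF N x'] by blast
  have "h * e N = e N * h" using H_comm_XE(2)[OF h(1), of N] N by simp
  then have eh: "e N * (x * AL i j N) = e N * h" using h xal by simp
  have 1: "yp m c * (g1 * (e N * (x * AL i j N))) = yp m c * (g1 * e N) * h" by (simp only: eh mult.assoc)
  show "yp m c * (g1 * (e N * (x * AL i j N))) \<in> GN N (\<lambda>i c'. (i = m \<and> c' = c) \<or> (m < i \<and> c' = 0))"
    unfolding 1 by (rule GN_r[OF y_K_e[OF N assms(2,4,5)] h(1)])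
  show "g0 * (yp m c * (g1 * (e N * (x * AL i j N)))) \<in> GN N (\<lambda>i c'. m \<le> i \<and> \<bar>c'\<bar> \<le> \<bar>c\<bar>)"
  proof -
    have "g0 * (yp m c * (g1 * e N)) * h \<in> GN N (\<lambda>i c'. m \<le> i \<and> \<bar>c'\<bar> \<le> \<bar>c\<bar>)"
      by (rule GN_r[OF _ h(1)]) (rule K_y_K_e[OF N assms(2,1,4,5)])
    then show ?thesis by (simp only: 1 mult.assoc)
  qed
qed

text \<open>If the second arc starts beyond the first one, its power passes the whole first arc. If
  it starts between the two ends, its power meets the crossing \<open>X a\<close> of the first arc;
  besides the main term, errors then arise that begin with an arc at \<open>Suc a\<close> or, after
  a cap, at \<open>a + 2\<close> or beyond.\<close>

lemma swap_arcs:
  assumes "1 \<le> i" "i \<le> j" "j \<le> N" "i \<le> a" "a \<le> j2" "j2 + 2 \<le> N" "s1 \<in> S" "s2 \<in> S"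
  shows "yp i s1 * (AL i j N * (yp a s2 * AL a j2 (N - 2))) \<in> GN N (\<lambda>i' c. i < i' \<and> c \<in> S)" (is "_ \<in> GN N ?\<Phi>")
proof -
  have iN: "i < N" "i < n" "a < n" "Suc a < n" "a + 2 \<le> n" using assms N by auto
  have yie: "yp i s1 * e N = e N * yp i s1" using yp_comm_XE(2)[of N i s1] iN assms N by simp
  \<comment> \<open>The exchange once the second power has reached the front as a power of
    \<open>y m\<close>: the arc grown from \<open>e N\<close> starts at \<open>m\<close> and keeps
    that power, or starts further right without one. The power of \<open>y i\<close> commutes with
    \<open>g1\<close> and \<open>e N\<close> and disappears into the factor behind them.\<close>
  have fin: "yp m s2 * (yp i s1 * (AL i j N * AL a j2 (N - 2))) \<in> GN N ?\<Phi>"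
    if m: "m = shift_strand j a" for m
  proof -
    obtain g1 g2 where g: "g1 \<in> K m (Suc N)" "g2 \<in> K m (Suc N)" "AL i j N * AL a j2 (N - 2) = g1 * (e N * (g2 * AL i j N))"
      using AL_commute_AL[OF assms(1-6)] m by blast
    have im: "i < m" "m \<le> N" using m assms by (auto simp: shift_strand_def split: if_splits)
    have c: "yp i s1 * g1 = g1 * yp i s1" using yp_comm_K[OF g(1) im(1)] N by simp
    have "yp i s1 * (AL i j N * AL a j2 (N - 2)) = g1 * (e N * ((yp i s1 * g2) * AL i j N))"
      by (simp only: g(3) lcomm[OF c] lcomm[OF yie] mult.assoc)
    moreover have "yp i s1 * g2 \<in> H (Suc N)" using iN K_H[OF g(2)] im by (intro H_ring(3) yp_H) auto
    ultimately have "yp m s2 * (yp i s1 * (AL i j N * AL a j2 (N - 2))) \<in> GN N (\<lambda>i c'. (i = m \<and> c' = s2) \<or> (m < i \<and> c' = 0))"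
      using K_y_K_e_AL(1)[OF K_ring(1) g(1), of "yp i s1 * g2" i j s2] im assms by simp
    then show ?thesis by (rule GN_mono) (use im assms S_0 in auto)
  qed
  show ?thesis
  proof (cases "j \<le> a")
    case True
    then have "AL i j N * yp a s2 = yp (a + 2) s2 * AL i j N" using AL_yp assms by simp
    then have "yp i s1 * (AL i j N * (yp a s2 * AL a j2 (N - 2))) = yp i s1 * (yp (a + 2) s2 * (AL i j N * AL a j2 (N - 2)))"
      by (simp only: mult.assoc[symmetric])
    also have "\<dots> = yp (a + 2) s2 * (yp i s1 * (AL i j N * AL a j2 (N - 2)))"
      by (rule lcomm[OF yp_comm]) (use iN in auto)
    finally show ?thesis using fin[of "a + 2"] True by (simp add: shift_strand_def)
  next
    case False
    then have aj: "a < j" "Suc a \<le> j" by auto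
    define P where "P = yp i s1 * XP i a"
    define A' where "A' = AL (Suc a) j N"
    define second where "second = AL a j2 (N - 2)"
    have P: "P \<in> H a" unfolding P_def using assms by (intro H_ring(3) yp_H XP_H[OF N]) auto
    have A2H: "second \<in> H (N - 1)" unfolding second_def using assms by (intro K_H[OF AL_K]) auto
    have "XP i j = XP i a * (X a * XP (Suc a) j)" using XP_split[of i a j] XP_Cons[of a j] assms aj by simp
    then have al: "AL i j N = XP i a * (X a * A')" by (simp add: AL_def A'_def mult.assoc)
    have yA: "yp a d * (A' * z) = A' * (yp a d * z)" for d z
      unfolding A'_def by (rule yp_AL'[OF N]) (use aj assms in auto)
    have PA: "h * (A' * z) = A' * (h * z)" if "h \<in> H a" for h z
      unfolding A'_def by (rule lcomm[OF H_comm_K[OF that AL_K[OF order_refl, of "Suc a" j N "Suc N"]]]) (use aj assms N in auto)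
    have PY: "P * (yp (Suc a) d * z) = yp (Suc a) d * (P * z)" for d z
      by (rule lcomm[OF H_comm_yp[OF P]]) (use iN in auto)
    \<comment> \<open>Error of moving the power of the second arc from strand \<open>a\<close> past
      the crossing \<open>X a\<close> of the first arc to strand \<open>Suc a\<close>.\<close>
    define D where "D = X a * yp a s2 - yp (Suc a) s2 * X a"
    have "yp i s1 * (AL i j N * (yp a s2 * second)) = P * (X a * (yp a s2 * (A' * second)))"
      by (simp only: al P_def mult.assoc yA)
    also have "\<dots> = P * (yp (Suc a) s2 * (X a * (A' * second))) + P * (D * (A' * second))"
      by (simp add: D_def left_diff_distrib right_diff_distrib mult.assoc)
    also have "P * (yp (Suc a) s2 * (X a * (A' * second))) = yp (Suc a) s2 * (yp i s1 * (AL i j N * second))"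
      by (simp only: PY) (simp only: al P_def mult.assoc)
    finally have eq: "yp i s1 * (AL i j N * (yp a s2 * second)) = yp (Suc a) s2 * (yp i s1 * (AL i j N * second)) + P * (D * (A' * second))" .
    have 1: "yp (Suc a) s2 * (yp i s1 * (AL i j N * second)) \<in> GN N ?\<Phi>"
      using fin[of "Suc a"] False by (simp add: shift_strand_def second_def)
    have "P * (D * (A' * second)) \<in> GN N ?\<Phi>"
      unfolding D_def
    proof (rule zs_GN[OF X_yp])
      show "1 \<le> a" "a < n" using assms iN by auto
      fix b assume "b \<in> {yp (Suc a) d * v * yp a (s2 - d) | d v. d \<in> rng s2 \<and> v \<in> {1, e a}}"
      then obtain d v where b: "b = yp (Suc a) d * v * yp a (s2 - d)" "d \<in> rng s2" "v \<in> {1, e a}" by blast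
      note dS = rng_S[OF assms(8) b(2)]
      show "P * (b * (A' * second)) \<in> GN N ?\<Phi>"
      proof (cases "v = 1")
        case True
        have "P * (b * (A' * second)) = yp (Suc a) d * (A' * ((P * yp a (s2 - d)) * second))"
          using True by (simp add: b(1) mult.assoc PY yA PA[OF P])
        moreover have "P * yp a (s2 - d) * second \<in> H (N - 1)"
          using A2H H_mono[OF P, of "N - 1"] assms by (intro H_ring(3) yp_H) auto
        ultimately show ?thesis unfolding A'_def using GN_I[of ?\<Phi> "Suc a" d j N] dS aj assms by simp
      next
        case False
        then have v: "v = e a" using b by simp
        let ?r = "s2 - d" and ?m = "a + 2" and ?Aa = "AL a a N"
        \<comment> \<open>The remaining prefix lives on the first \<open>a + 1\<close> strands, so
          it commutes with \<open>e N\<close>, with \<open>y (a + 2)\<close> and with everything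
          supported from strand \<open>a + 2\<close> on, and ends up harmlessly behind
          \<open>e N\<close>.\<close>
        define Q where "Q = P * yp (Suc a) d"
        have Q: "Q \<in> H (Suc a)" unfolding Q_def using H_mono[OF P, of "Suc a"] by (intro H_ring(3) yp_H) auto
        have 2: "P * (b * (A' * second)) = Q * (?Aa * (XiR a (j - 1) * (yp a ?r * second)))"
          unfolding b(1) v Q_def using e_AL_Suc_mult[OF N, of a j "yp a ?r * second"] aj assms
          by (simp only: mult.assoc yA) (simp add: A'_def)
        have "XiR a (j - 1) \<in> K a (N - 1)" using assms by (intro XiR_K) auto
        from AL_commute_K[OF _ order_refl _ order_refl this] obtain g0 where g0: "g0 \<in> K ?m (Suc N)" "?Aa * XiR a (j - 1) = g0 * ?Aa"
          using assms by (auto simp: shift_strand_def)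
        obtain g1 g2 where g: "g1 \<in> K ?m (Suc N)" "g2 \<in> K ?m (Suc N)" "?Aa * second = g1 * (e N * (g2 * ?Aa))"
          using AL_commute_AL[of a a a j2] assms by (auto simp: shift_strand_def second_def)
        have ay: "?Aa * yp a ?r = yp ?m ?r * ?Aa" using AL_yp[of a a a ?r] assms by simp
        have "?Aa * (XiR a (j - 1) * (yp a ?r * second)) = g0 * (?Aa * yp a ?r * second)" using g0(2) by (metis mult.assoc)
        also have "\<dots> = g0 * (yp ?m ?r * (g1 * (e N * (g2 * ?Aa))))" by (simp only: ay mult.assoc g(3))
        finally have 3: "P * (b * (A' * second)) = Q * (g0 * (yp ?m ?r * (g1 * (e N * (g2 * ?Aa)))))" using 2 by simp
        have c: "Q * g0 = g0 * Q" "Q * g1 = g1 * Q" "Q * yp ?m ?r = yp ?m ?r * Q" "Q * e N = e N * Q"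
          using H_comm_K[OF Q g0(1)] H_comm_K[OF Q g(1)] H_comm_yp[OF Q, of ?m ?r] H_comm_XE(2)[OF Q, of N] iN N assms by auto
        have "P * (b * (A' * second)) = g0 * (yp ?m ?r * (g1 * (e N * ((Q * g2) * ?Aa))))"
          by (simp only: 3 lcomm[OF c(1)] lcomm[OF c(2)] lcomm[OF c(3)] lcomm[OF c(4)] mult.assoc)
        moreover have "Q * g2 \<in> H (Suc N)" using H_mono[OF Q, of "Suc N"] K_H[OF g(2)] assms by (intro H_ring(3)) auto
        ultimately have "P * (b * (A' * second)) \<in> GN N (\<lambda>i c'. ?m \<le> i \<and> \<bar>c'\<bar> \<le> \<bar>?r\<bar>)"
          using K_y_K_e_AL(2)[OF g0(1) g(1), of "Q * g2" a a ?r] assms by simp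
        then show ?thesis by (rule GN_mono) (use dS assms in auto)
      qed
    qed
    then show ?thesis using eq 1 GN_add by (simp only: second_def)
  qed
qed

end

section \<open>Half diagrams with several arcs\<close>

fun E :: "nat \<Rightarrow> nat \<Rightarrow> 'b" where
  "E 0 N = 1" | "E (Suc f) N = e N * E f (N - 2)"

text \<open>The bound \<open>p\<close> is the starting point of the preceding arc and forces a
  strict decrease. Each power stands directly before its own arc; \<open>sorted_arcs_unroll\<close>
  later collects the powers in front.\<close>

fun sorted_arcs :: "nat \<Rightarrow> nat \<Rightarrow> nat \<Rightarrow> 'b set" where
  "sorted_arcs 0 N p = {1}"
| "sorted_arcs (Suc f) N p = {yp i s * (AL i j N * t) | i j s t. 1 \<le> i \<and> i \<le> j \<and> j \<le> N \<and> i < p \<and> s \<in> S \<and> t \<in> sorted_arcs f (N - 2) i}"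

lemma sorted_arcs_H: "2 * f \<le> Suc N \<Longrightarrow> N < n \<Longrightarrow> t \<in> sorted_arcs f N p \<Longrightarrow> \<exists>h\<in>H (Suc N). t = h * E f N"
proof (induction f arbitrary: N p t)
  case 0 then show ?case using H_ring(1)[of "Suc N"] by auto
next
  case (Suc f)
  from Suc.prems(3) obtain i j s t' where t: "t = yp i s * (AL i j N * t')" "1 \<le> i" "i \<le> j" "j \<le> N" "t' \<in> sorted_arcs f (N - 2) i"
    by auto
  have N: "1 \<le> N" using t by simp
  have "\<exists>h\<in>H (N - 1). t' = h * E f (N - 2)"
  \<comment> \<open>The hypothesis speaks about \<open>Suc (N - 2)\<close> strands, which are
    \<open>N - 1\<close> strands only for \<open>N \<ge> 2\<close>. For \<open>N = 1\<close> no
    further arc is possible, and \<open>t'\<close> is 1.\<close>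
  proof (cases "f = 0")
    case True then show ?thesis using t(5) H_ring(1)[of "N - 1"] by auto
  next
    case False
    then have "Suc (N - 2) = N - 1" using Suc.prems by simp
    then show ?thesis using Suc.IH[of "N - 2" t' i] Suc.prems t(5) False by auto
  qed
  then obtain h where h: "h \<in> H (N - 1)" "t' = h * E f (N - 2)" by blast
  have "EP j N = EP j (N - 1) * e N" using EP_snoc[of j "N - 1"] t N by simp
  then have al: "AL i j N = (XP i j * EP j (N - 1)) * e N" by (simp add: AL_def mult.assoc)
  have he: "h * e N = e N * h" using H_comm_XE(2)[OF h(1), of N] N Suc.prems by simp
  have "t = (yp i s * (XP i j * EP j (N - 1)) * h) * E (Suc f) N"
    unfolding t(1) h(2) al using he by (simp add: mult.assoc) (metis mult.assoc)
  moreover have "yp i s * (XP i j * EP j (N - 1)) * h \<in> H (Suc N)"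
    using h(1) H_mono[OF h(1), of "Suc N"] t N Suc.prems by (intro H_ring(3) yp_H XP_H[OF N] K_H[OF EP_K[of 1]]) auto
  ultimately show ?case by blast
qed

text \<open>Left ideals are spanned by the sorted half diagrams; unsorted ones are removed by downward
  induction on the first index, using the swap lemma.\<close>

lemma sort_arcs:
  "2 * f \<le> Suc N \<Longrightarrow> N < n \<Longrightarrow> x \<in> H (Suc N) \<Longrightarrow>
    x * E f N \<in> zs {t * h | t h. t \<in> sorted_arcs f N (Suc N) \<and> h \<in> H (Suc N - 2 * f)}"
proof (induction f arbitrary: N x)
  case 0
  then have "x * E 0 N \<in> {t * h | t h. t \<in> sorted_arcs 0 N (Suc N) \<and> h \<in> H (Suc N - 2 * 0)}" by auto
  then show ?case by (rule zspan_base)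
next
  case (Suc f)
  have N: "1 \<le> N" "N < n" using Suc.prems by auto
  let ?T = "{t * h | t h. t \<in> sorted_arcs (Suc f) N (Suc N) \<and> h \<in> H (Suc N - 2 * Suc f)}"
  let ?T' = "{t * h | t h. t \<in> sorted_arcs f (N - 2) (N - 1) \<and> h \<in> H (Suc N - 2 * Suc f)}"
  have IH: "x * E f (N - 2) \<in> zs ?T'" if x: "x \<in> H (N - 1)" for x
  proof (cases "f = 0")
    case True
    then have "x * E f (N - 2) \<in> ?T'" using x by auto
    then show ?thesis by (rule zspan_base)
  next
    case False
    then have "Suc (N - 2) = N - 1" "N - 1 - 2 * f = Suc N - 2 * Suc f" using Suc.prems by auto
    then show ?thesis using Suc.IH[of "N - 2" x] Suc.prems x False by simp
  qed
  have main: "yp i s * (AL i j N * (t * h)) \<in> zs ?T"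
    if "1 \<le> i" "i \<le> j" "j \<le> N" "s \<in> S" "t \<in> sorted_arcs f (N - 2) (N - 1)" "h \<in> H (Suc N - 2 * Suc f)" for i j s t h
    using that
  proof (induction "N - i" arbitrary: i j s t h rule: less_induct)
    case less
    show ?case
    proof (cases "t \<in> sorted_arcs f (N - 2) i")
      case True
      have "i < Suc N" using less.prems by simp
      then have "yp i s * (AL i j N * t) \<in> sorted_arcs (Suc f) N (Suc N)" unfolding sorted_arcs.simps using less.prems True by blast
      then have "yp i s * (AL i j N * t) * h \<in> ?T" using less.prems(6) by blast
      then show ?thesis by (simp add: mult.assoc zspan_base)
    next
      case False
      then obtain f' where f': "f = Suc f'" using less.prems by (cases f) auto
      then obtain a j2 s2 t' where t: "t = yp a s2 * (AL a j2 (N - 2) * t')" "1 \<le> a" "a \<le> j2" "j2 \<le> N - 2" "s2 \<in> S"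
          "t' \<in> sorted_arcs f' (N - 2 - 2) a" using less.prems(5) by auto
      have ia: "i \<le> a"
      proof (rule ccontr)
        assume "\<not> i \<le> a"
        then have "t \<in> sorted_arcs (Suc f') (N - 2) i" unfolding sorted_arcs.simps using t by (intro CollectI exI conjI) auto
        then show False using False f' by simp
      qed
      have ia2: "j2 + 2 \<le> N" using t(2-4) by linarith
      let ?U = "yp i s * (AL i j N * (yp a s2 * AL a j2 (N - 2)))"
      have Sw: "?U \<in> GN N (\<lambda>i' c. i < i' \<and> c \<in> S)"
        using swap_arcs[OF N less.prems(1-3) ia t(3) ia2 less.prems(4) t(5)] .
      have ev: "EP j2 (N - 2) = EP j2 (N - 3) * e (N - 2)"
      proof -
        have "Suc (N - 3) = N - 2" using t(2,3) ia2 by linarith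
        then show ?thesis using EP_snoc[of j2 "N - 3"] t(4) by simp
      qed
      \<comment> \<open>The exchange consumes the second arc. Its last cap is therefore duplicated
        first: one copy stays in the exchanged pair, the other joins the caps of \<open>t'\<close>
        to form \<open>E f (N - 2)\<close>, to which the induction hypothesis for \<open>f\<close>
        applies again.\<close>
      have ee': "AL a j2 (N - 2) = A0i * (AL a j2 (N - 2) * e (N - 2))"
      proof -
        have "A0i * (e (N - 2) * e (N - 2)) = e (N - 2)" using A0_e[of "N - 2"] t(2,3) ia2 N by simp
        then show ?thesis unfolding AL_def ev
          by (simp add: mult.assoc) (metis central_left[OF params(5)])
      qed
      have "N - 2 - 2 < n" "2 * f' \<le> Suc (N - 2 - 2)" using N Suc.prems f' by auto
      then obtain x' where x': "x' \<in> H (Suc (N - 2 - 2))" "t' = x' * E f' (N - 2 - 2)"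
        using sorted_arcs_H[OF _ _ t(6)] by blast
      \<comment> \<open>If no arcs follow, the truncated subtraction gives no room between
        \<open>x'\<close> and \<open>e (N - 2)\<close>, but then \<open>x'\<close> is 1.\<close>
      have cx: "e (N - 2) * x' = x' * e (N - 2) \<and> x' \<in> H (N - 1)"
      proof (cases "f' = 0")
        case True
        then have "x' = 1" using t(6) x'(2) by simp
        then show ?thesis using H_ring(1) by simp
      next
        case False
        then have "Suc (N - 2 - 2) = N - 3" "N - 3 < N - 2" using Suc.prems f' by auto
        then show ?thesis using H_comm_XE(2)[OF x'(1), of "N - 2"] H_mono[OF x'(1), of "N - 1"] N by simp
      qed
      have "yp i s * (AL i j N * (t * h)) = A0i * (?U * (e (N - 2) * (t' * h)))"
        unfolding t(1) by (subst ee') (simp only: mult.assoc central_left[OF params(5)])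
      also have "e (N - 2) * (t' * h) = x' * (E f (N - 2) * h)"
        unfolding x'(2) f' using cx by (simp add: mult.assoc) (metis mult.assoc)
      finally have eq: "yp i s * (AL i j N * (t * h)) = A0i * (?U * (x' * (E f (N - 2) * h)))" .
      have "?U * (x' * (E f (N - 2) * h)) \<in> zs ?T"
        using Sw unfolding GN_def
      proof (rule zs_rmult, clarify)
        fix i' c j' h' assume *: "i < i'" "c \<in> S" "1 \<le> i'" "i' \<le> j'" "j' \<le> N" "h' \<in> H (N - 1)"
        have "h' * x' * E f (N - 2) \<in> zs ?T'" using * cx by (intro IH H_ring(3)) auto
        then have "h' * x' * E f (N - 2) * h \<in> zs ?T'"
        proof (rule zs_rmult, clarify)
          fix t h'' assume "t \<in> sorted_arcs f (N - 2) (N - 1)" "h'' \<in> H (Suc N - 2 * Suc f)"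
          then have "t * (h'' * h) \<in> ?T'" using H_ring(3)[OF _ less.prems(6)] by blast
          then show "t * h'' * h \<in> zs ?T'" by (simp add: mult.assoc zspan_base)
        qed
        then have "(yp i' c * AL i' j' N) * (h' * x' * E f (N - 2) * h) \<in> zs ?T"
        proof (rule zs_lmult, clarify)
          fix t h'' assume "t \<in> sorted_arcs f (N - 2) (N - 1)" "h'' \<in> H (Suc N - 2 * Suc f)"
          then show "yp i' c * AL i' j' N * (t * h'') \<in> zs ?T"
            using less.hyps[of i' j' c t h''] * by (simp add: mult.assoc)
        qed
        then show "yp i' c * (AL i' j' N * h') * (x' * (E f (N - 2) * h)) \<in> zs ?T" by (simp add: mult.assoc)
      qed
      then show ?thesis unfolding eq by (rule zspan_scale[OF params(5)])
    qed
  qed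
  have "x * e N * E f (N - 2) \<in> zs ?T"
    using H_e_GN(2)[OF N Suc.prems(3)] unfolding GN_def
  proof (rule zs_rmult, clarify)
    fix i c j h' assume *: "c \<in> S" "1 \<le> i" "i \<le> j" "j \<le> N" "h' \<in> H (N - 1)"
    from IH[OF *(5)] have "yp i c * AL i j N * (h' * E f (N - 2)) \<in> zs ?T"
      by (rule zs_lmult) (use main * in \<open>auto simp: mult.assoc\<close>)
    then show "yp i c * (AL i j N * h') * E f (N - 2) \<in> zs ?T" by (simp add: mult.assoc)
  qed
  then show ?case by (simp add: mult.assoc)
qed

end

section \<open>Right multiplication via the opposite ring\<close>

datatype 'a opp = Opp (unopp: 'a)

instantiation opp :: ("{ring,monoid_mult}") "{ring,monoid_mult}"
begin
definition "0 = Opp 0"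
definition "1 = Opp 1"
definition "x + y = Opp (unopp x + unopp y)"
definition "x - y = Opp (unopp x - unopp y)"
definition "- x = Opp (- unopp x)"
definition "x * y = Opp (unopp y * unopp x)"
instance
  by standard (auto simp: zero_opp_def one_opp_def plus_opp_def minus_opp_def uminus_opp_def times_opp_def
      algebra_simps mult.assoc intro!: opp.expand)
end

lemma unopp_simps [simp]: "unopp 0 = 0" "unopp 1 = 1" "unopp (x + y) = unopp x + unopp y"
    "unopp (x - y) = unopp x - unopp y" "unopp (- x) = - unopp x" "unopp (x * y) = unopp y * unopp x"
  by (simp_all add: zero_opp_def one_opp_def plus_opp_def minus_opp_def uminus_opp_def times_opp_def)

lemma unopp_power [simp]: "unopp (x ^ m) = unopp x ^ m"
  by (induction m) (simp_all add: power_commutes)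

lemma unopp_zpw: "unopp (zpw x xi c) = zpw (unopp x) (unopp xi) c"
  by (simp add: zpw_def)

lemma unopp_sum: "unopp (sum f A) = (\<Sum>a\<in>A. unopp (f a))"
  by (induction A rule: infinite_finite_induct) auto

lemma unopp_prod_list: "unopp (prod_list xs) = prod_list (rev (map unopp xs))"
  by (induction xs) auto

lemma opp_eq_iff: "x = y \<longleftrightarrow> unopp x = unopp y"
  by (metis opp.expand)

lemma unopp_zspan: "x \<in> zspan (Opp ` Z) A \<Longrightarrow> \<forall>z\<in>Z. \<forall>x. z * x = x * z \<Longrightarrow> unopp x \<in> zspan Z (unopp ` A)"
proof (induction rule: zspan.induct)
  case (zspan_scale z x)
  then obtain c where c: "c \<in> Z" "z = Opp c" by blast
  have "unopp x * c = c * unopp x" using c zspan_scale.prems by metis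
  then show ?case using zspan.zspan_scale[OF c(1) zspan_scale.IH[OF zspan_scale.prems]] c by simp
qed (auto intro: zspan.intros)

lemma Opp_algen: "x \<in> algen Z G \<Longrightarrow> Opp x \<in> algen (Opp ` Z) (Opp ` G)"
proof (induction rule: algen.induct)
  case (algen_add x y)
  then have "Opp x + Opp y \<in> algen (Opp ` Z) (Opp ` G)" by (intro algen.algen_add)
  then show ?case by (simp add: plus_opp_def)
next
  case (algen_mult x y)
  then have "Opp y * Opp x \<in> algen (Opp ` Z) (Opp ` G)" by (intro algen.algen_mult)
  then show ?case by (simp add: times_opp_def)
qed (auto intro: algen.intros)

lemma unopp_algen: "x \<in> algen (Opp ` Z) (Opp ` G) \<Longrightarrow> unopp x \<in> algen Z G"
  by (induction rule: algen.induct) (auto intro: algen.intros)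

context bmw_ring
begin

definition ypl :: "nat \<Rightarrow> (nat \<Rightarrow> nat) \<Rightarrow> (nat \<Rightarrow> int) \<Rightarrow> 'b list" where
  "ypl f i s = map (\<lambda>m. yp (i m) (s m)) [1..<f + 1]"
definition ALl :: "nat \<Rightarrow> nat \<Rightarrow> (nat \<Rightarrow> nat) \<Rightarrow> (nat \<Rightarrow> nat) \<Rightarrow> 'b list" where
  "ALl N f i j = map (\<lambda>m. AL (i m) (j m) (N + 2 - 2 * m)) [1..<f + 1]"

definition idx :: "nat \<Rightarrow> nat \<Rightarrow> (nat \<Rightarrow> nat) \<Rightarrow> (nat \<Rightarrow> nat) \<Rightarrow> (nat \<Rightarrow> int) \<Rightarrow> bool" where
  "idx N f i j s \<longleftrightarrow> (\<forall>m. 1 \<le> m \<and> m \<le> f \<longrightarrow> 1 \<le> i m \<and> i m \<le> j m \<and> j m \<le> N + 2 - 2 * m \<and> s m \<in> S) \<and>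
     (\<forall>m m'. 1 \<le> m \<and> m < m' \<and> m' \<le> f \<longrightarrow> i m > i m')"

lemma comm_prod_list: "(\<And>x. x \<in> set xs \<Longrightarrow> x * u = u * x) \<Longrightarrow> prod_list xs * u = u * (prod_list xs :: 'b)"
  by (induction xs) (auto simp: mult.assoc lcomm)

text \<open>The decreasing order of the starting points is what separates powers and arcs: a later
  power belongs to a strand to the left of an earlier arc, hence commutes with it and can be moved
  to the front.\<close>

lemma sorted_arcs_unroll:
  "t \<in> sorted_arcs f N p \<Longrightarrow> N < n \<Longrightarrow> \<exists>i j s. idx N f i j s \<and> (\<forall>m. 1 \<le> m \<and> m \<le> f \<longrightarrow> i m < p) \<and>
     t = prod_list (ypl f i s) * prod_list (ALl N f i j)"
proof (induction f arbitrary: N p t)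
  case 0 then show ?case by (simp add: idx_def ypl_def ALl_def)
next
  case (Suc f)
  from Suc.prems(1) obtain i0 j0 s0 t' where t: "t = yp i0 s0 * (AL i0 j0 N * t')" "1 \<le> i0" "i0 \<le> j0" "j0 \<le> N"
     "i0 < p" "s0 \<in> S" "t' \<in> sorted_arcs f (N - 2) i0" by auto
  have N: "1 \<le> N" "N < n" using t Suc.prems by auto
  from N have "N - 2 < n" by simp
  with Suc.IH[OF t(7)] obtain i j s where IH: "idx (N - 2) f i j s" "\<And>m. 1 \<le> m \<Longrightarrow> m \<le> f \<Longrightarrow> i m < i0"
     "t' = prod_list (ypl f i s) * prod_list (ALl (N - 2) f i j)" by blast
  define i1 where "i1 m = (if m \<le> 1 then i0 else i (m - 1))" for m
  define j1 where "j1 m = (if m \<le> 1 then j0 else j (m - 1))" for m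
  define s1 where "s1 m = (if m \<le> 1 then s0 else s (m - 1))" for m
  have upt: "[1..<Suc f + 1] = 1 # map Suc [1..<f + 1]"
    by (subst upt_conv_Cons) (simp_all add: map_Suc_upt del: upt_Suc)
  have y: "ypl (Suc f) i1 s1 = yp i0 s0 # ypl f i s"
    unfolding ypl_def upt by (simp add: i1_def s1_def del: upt_Suc)
  have jb: "1 \<le> j m \<and> j m \<le> N - 2 + 2 - 2 * m" if "1 \<le> m" "m \<le> f" for m using IH(1) that unfolding idx_def by fastforce
  have Nm: "N - 2 + 2 - 2 * m = N + 2 - 2 * Suc m" if "1 \<le> m" "m \<le> f" for m using jb[OF that] that(1) by arith
  have al: "ALl N (Suc f) i1 j1 = AL i0 j0 N # ALl (N - 2) f i j"
    unfolding ALl_def upt using Nm by (auto simp: i1_def j1_def simp del: upt_Suc)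
  have "x * AL i0 j0 N = AL i0 j0 N * x" if "x \<in> set (ypl f i s)" for x
    using that IH(2) yp_AL[OF N _ t(3,4)] by (auto simp: ypl_def)
  then have "AL i0 j0 N * prod_list (ypl f i s) = prod_list (ypl f i s) * AL i0 j0 N"
    by (rule comm_prod_list[symmetric])
  then have "t = prod_list (ypl (Suc f) i1 s1) * prod_list (ALl N (Suc f) i1 j1)"
    unfolding t(1) IH(3) y al by (simp add: mult.assoc lcomm)
  moreover have "idx N (Suc f) i1 j1 s1"
    unfolding idx_def
  proof (intro conjI allI impI)
    fix m assume m: "1 \<le> m \<and> m \<le> Suc f"
    show "1 \<le> i1 m" "i1 m \<le> j1 m" "j1 m \<le> N + 2 - 2 * m" "s1 m \<in> S"
    proof -
      have "m = 1 \<or> (\<exists>m'. m = Suc m' \<and> 1 \<le> m' \<and> m' \<le> f)" using m by (cases m) auto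
      then have "1 \<le> i1 m \<and> i1 m \<le> j1 m \<and> j1 m \<le> N + 2 - 2 * m \<and> s1 m \<in> S"
      proof
        assume "m = 1" then show ?thesis using t by (simp add: i1_def j1_def s1_def)
      next
        assume "\<exists>m'. m = Suc m' \<and> 1 \<le> m' \<and> m' \<le> f"
        then obtain m' where m': "m = Suc m'" "1 \<le> m'" "m' \<le> f" by blast
        then have "1 \<le> i m' \<and> i m' \<le> j m' \<and> j m' \<le> N - 2 + 2 - 2 * m' \<and> s m' \<in> S" using IH(1) by (simp add: idx_def)
        then show ?thesis using m' Nm[OF m'(2,3)] by (simp add: i1_def j1_def s1_def)
      qed
      then show "1 \<le> i1 m" "i1 m \<le> j1 m" "j1 m \<le> N + 2 - 2 * m" "s1 m \<in> S" by auto
    qed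
  next
    fix m m' assume m: "1 \<le> m \<and> m < m' \<and> m' \<le> Suc f"
    show "i1 m > i1 m'"
    proof (cases "m = 1")
      case True
      then have "1 \<le> m' - 1" "m' - 1 \<le> f" using m by auto
      then show ?thesis using IH(2)[of "m' - 1"] True m by (simp add: i1_def)
    next
      case False
      then have "1 \<le> m - 1 \<and> m - 1 < m' - 1 \<and> m' - 1 \<le> f" using m by auto
      then have "i (m - 1) > i (m' - 1)" using IH(1) unfolding idx_def by blast
      then show ?thesis using m False by (simp add: i1_def)
    qed
  qed
  moreover have "i1 m < p" if "1 \<le> m \<and> m \<le> Suc f" for m
  proof (cases "m \<le> 1")
    case False
    then have "1 \<le> m - 1" "m - 1 \<le> f" using that by auto
    then show ?thesis using IH(2)[of "m - 1"] t(5) by (simp add: i1_def)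
  qed (use t(5) in \<open>simp add: i1_def\<close>)
  ultimately show ?case by blast
qed

lemma E_H: "2 * f \<le> Suc N \<Longrightarrow> E f N \<in> H (Suc N)"
proof (induction f arbitrary: N)
  case 0 then show ?case by (simp add: H_ring)
next
  case (Suc f)
  show ?case
  proof (cases "f = 0")
    case True then show ?thesis using H_gen(3)[of N "Suc N"] Suc.prems by simp
  next
    case False
    then have "Suc (N - 2) = N - 1" using Suc.prems by simp
    then have "E f (N - 2) \<in> H (N - 1)" using Suc.IH[of "N - 2"] Suc.prems False by simp
    then show ?thesis using H_gen(3)[of N "Suc N"] Suc.prems H_mono[of _ "N - 1" "Suc N"] by (auto intro!: H_ring(3))
  qed
qed

lemma E_comm:
  assumes "h \<in> H (Suc N - 2 * f)" "2 * f \<le> Suc N" "N < n" shows "h * E f N = E f N * h"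
  using assms
proof (induction f arbitrary: N)
  case (Suc f)
  have "h * e N = e N * h" using H_comm_XE(2)[OF H_mono[OF Suc.prems(1)], of "N - 1" N] Suc.prems by auto
  moreover have "h * E f (N - 2) = E f (N - 2) * h"
  proof (cases "f = 0")
    case False
    then have "Suc (N - 2) - 2 * f = Suc N - 2 * Suc f" "2 * f \<le> Suc (N - 2)" using Suc.prems by auto
    then show ?thesis using Suc.IH[of "N - 2"] Suc.prems by simp
  qed simp
  ultimately show ?case by (simp add: comm_mult)
qed simp

lemma E_e_comm:
  assumes "2 * Suc f \<le> Suc N" "N < n" shows "e N * E f (N - 2) = E f (N - 2) * e N"
proof (cases "f = 0")
  case False
  then have "Suc (N - 2) = N - 1" using assms by simp
  then have "E f (N - 2) \<in> H (N - 1)" using E_H[of f "N - 2"] False assms by simp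
  then show ?thesis using H_comm_XE(2)[of _ "N - 1" N] assms by simp
qed simp

lemma E_Suc:
  assumes "2 * Suc f \<le> Suc N" shows "E f N * e (N - 2 * f) = E (Suc f) N"
  using assms
proof (induction f arbitrary: N)
  case (Suc f)
  have "E f (N - 2) * e (N - 2 - 2 * f) = E (Suc f) (N - 2)" using Suc.prems by (intro Suc.IH) auto
  then show ?case by (simp add: mult.assoc)
qed simp

fun A0i_power :: "nat \<Rightarrow> 'b \<Rightarrow> 'b" where "A0i_power 0 x = x" | "A0i_power (Suc f) x = A0i * A0i_power f x"

lemma A0p_l: "g * A0i_power f x = A0i_power f (g * x)"
  by (induction f) (auto simp: central_left[OF params(5), of g])

lemma A0p_zs: "x \<in> zs A \<Longrightarrow> A0i_power f x \<in> zs A"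
  by (induction f) (auto intro: zspan_scale params)

text \<open>The caps in \<open>E f N\<close> commute and each has square \<open>A0\<close> times
  itself. So up to a scalar \<open>E f N\<close> is idempotent, and a two-sided product can be cut
  in its middle into a left and a right half.\<close>

lemma E_idem:
  assumes "2 * f \<le> Suc N" "N < n" shows "A0i_power f (E f N * E f N) = E f N"
  using assms
proof (induction f arbitrary: N)
  case (Suc f)
  have IH: "A0i_power f (E f (N - 2) * E f (N - 2)) = E f (N - 2)" using Suc by (cases "f = 0") auto
  have c: "e N * E f (N - 2) = E f (N - 2) * e N" using E_e_comm Suc.prems by simp
  have "E (Suc f) N * E (Suc f) N = e N * e N * (E f (N - 2) * E f (N - 2))"
    by (simp only: E.simps mult.assoc lcomm[OF c[symmetric]])
  then have "A0i_power (Suc f) (E (Suc f) N * E (Suc f) N) = A0i * (e N * e N * A0i_power f (E f (N - 2) * E f (N - 2)))"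
    by (simp only: A0i_power.simps A0p_l)
  also have "\<dots> = A0i * (e N * e N) * E f (N - 2)" by (simp only: IH mult.assoc)
  finally show ?case using A0_e[of N] Suc.prems by simp
qed simp

text \<open>Iterating \<open>e a = e a * e (a + 1) * e a\<close>, all caps generate the same
  two-sided ideal as the last one.\<close>

lemma e_conj:
  assumes "1 \<le> a" "a \<le> M" "M < n"
  shows "\<exists>u\<in>H (Suc M). \<exists>v\<in>H (Suc M). e a = u * e M * v"
  using assms(2,1)
proof (induction a rule: inc_induct)
  case base then show ?case using H_ring(1) by (intro bexI[of _ 1]) auto
next
  case (step a)
  then obtain u v where uv: "u \<in> H (Suc M)" "v \<in> H (Suc M)" "e (Suc a) = u * e M * v" by auto
  have adj: "adj a (Suc a)" using step assms by (auto simp: adj_def)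
  have "e a = (e a * u) * e M * (v * e a)" using adj_rels(3)[OF adj] uv(3) by (simp add: mult.assoc)
  moreover have "e a \<in> H (Suc M)" using step by (intro H_gen) auto
  ultimately show ?case using uv H_ring(3) by blast
qed

text \<open>Reversing products permutes the relations: those for adjacent indices are exchanged with
  the two indices swapped, and a scalar may stand on either side because it is central.\<close>

lemma opp_bmw_ring:
  "bmw_ring (Opp ` Z) n k (Opp Y) (Opp Yi) (\<lambda>i. Opp (X i)) (\<lambda>i. Opp (Xi i)) (\<lambda>i. Opp (e i))
    (Opp dl) (Opp la) (Opp lai) (Opp A0) (Opp A0i) (Opp q0i) (\<lambda>i. Opp (qs i)) (\<lambda>i. Opp (Am i))"
proof (unfold_locales, goal_cases)
  case (1 z x)
  then show ?case using central by (auto simp: opp_eq_iff)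
next
  case 2 show ?case using one_Z by (simp add: one_opp_def)
next
  case 3 show ?case using imageI[OF minus_one_Z, of Opp] by (simp add: one_opp_def uminus_opp_def)
next
  case 4 show ?case using imageI[OF zero_Z, of Opp] by (simp add: zero_opp_def)
next
  case (21 i)
  have "(1 - e i) * dl = dl * (1 - e i)" using central[OF params(1)] by simp
  then show ?case using skein[OF 21] by (simp add: opp_eq_iff)
next
  case (22 i j)
  then show ?case using far[of i j] far[of j i] by (auto simp: opp_eq_iff)
next
  case (26 i j)
  then show ?case using XXe[of j i] XXe[of i j] by (auto simp: opp_eq_iff mult.assoc)
next
  case 28
  have "(\<Sum>i<k. Y ^ i * qs i) = (\<Sum>i<k. qs i * Y ^ i)" using central[OF params(7)] by (intro sum.cong) auto
  then show ?case using Y_order[OF 28] by (simp add: opp_eq_iff unopp_sum)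
next
  case (34 m)
  then show ?case using eYe[OF 34] central[OF params(8)[OF 34(2)], of "e 1"] by (simp add: opp_eq_iff mult.assoc)
qed (use params k_pos units Y_inv X_inv braid Xe ee YX1 YX YXYe central in
     \<open>auto simp: opp_eq_iff mult.assoc[symmetric]\<close>)

interpretation opp: bmw_ring "Opp ` Z" n k "Opp Y" "Opp Yi" "\<lambda>i. Opp (X i)" "\<lambda>i. Opp (Xi i)" "\<lambda>i. Opp (e i)"
    "Opp dl" "Opp la" "Opp lai" "Opp A0" "Opp A0i" "Opp q0i" "\<lambda>i. Opp (qs i)" "\<lambda>i. Opp (Am i)"
  by (rule opp_bmw_ring)

definition ALR :: "nat \<Rightarrow> nat \<Rightarrow> nat \<Rightarrow> 'b" where
  "ALR i j N = prod_list (map e (rev [j..<Suc N])) * prod_list (map X (rev [i..<j]))"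

definition ALRl :: "nat \<Rightarrow> nat \<Rightarrow> (nat \<Rightarrow> nat) \<Rightarrow> (nat \<Rightarrow> nat) \<Rightarrow> 'b list" where
  "ALRl N f i j = map (\<lambda>m. ALR (i m) (j m) (N + 2 - 2 * m)) (rev [1..<f + 1])"

definition left_diagrams :: "nat \<Rightarrow> nat \<Rightarrow> 'b set" where
  "left_diagrams f N = {prod_list (ypl f i s) * prod_list (ALl N f i j) | i j s. idx N f i j s}"

definition right_diagrams :: "nat \<Rightarrow> nat \<Rightarrow> 'b set" where
  "right_diagrams f N = {prod_list (ALRl N f i j) * prod_list (rev (ypl f i s)) | i j s. idx N f i j s}"

lemma opp_y: "opp.y i = Opp (y i) \<and> opp.yi i = Opp (yi i)"
  by (induction i rule: y.induct) (auto simp: opp_eq_iff mult.assoc)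

lemma opp_yp: "unopp (opp.yp i c) = yp i c"
  by (simp add: opp.yp_def yp_def unopp_zpw opp_y)

lemma opp_gens: "opp.gens l = Opp ` gens l"
  by (auto simp: opp.gens_def gens_def image_iff)

lemma opp_H: "x \<in> H l \<Longrightarrow> Opp x \<in> opp.H l" "x' \<in> opp.H l \<Longrightarrow> unopp x' \<in> H l"
  unfolding H_def opp.H_def opp_gens by (auto intro: Opp_algen unopp_algen)

lemma opp_AL: "unopp (opp.AL i j N) = ALR i j N"
  by (simp add: opp.AL_def opp.XP_def opp.EP_def ALR_def unopp_prod_list rev_map comp_def del: upt_Suc)

text \<open>The caps commute, so reversal fixes their product, and left ideals in the opposite ring
  become right ideals generated by the same element.\<close>

lemma opp_E: "2 * f \<le> Suc N \<Longrightarrow> N < n \<Longrightarrow> unopp (opp.E f N) = E f N"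
proof (induction f arbitrary: N)
  case (Suc f)
  have "unopp (opp.E f (N - 2)) = E f (N - 2)" using Suc by (cases "f = 0") auto
  then show ?case using E_e_comm[of f N] Suc.prems by simp
qed simp

lemma unopp_sorted_arcs:
  assumes "t \<in> opp.sorted_arcs f N p" "N < n" shows "unopp t \<in> right_diagrams f N"
proof -
  obtain i j s where *: "idx N f i j s" "t = prod_list (opp.ypl f i s) * prod_list (opp.ALl N f i j)"
    using opp.sorted_arcs_unroll[OF assms] by blast
  have "map unopp (opp.ypl f i s) = ypl f i s" by (simp add: opp.ypl_def ypl_def opp_yp comp_def del: upt_Suc)
  moreover have "rev (map unopp (opp.ALl N f i j)) = ALRl N f i j"
    by (simp add: opp.ALl_def ALRl_def opp_AL comp_def rev_map del: upt_Suc)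
  ultimately have "unopp t = prod_list (ALRl N f i j) * prod_list (rev (ypl f i s))"
    by (simp add: *(2) unopp_prod_list)
  then show ?thesis using *(1) unfolding right_diagrams_def by blast
qed

text \<open>That each half diagram is recorded as a multiple of \<open>E f N\<close>, here and in
  \<open>left_span\<close>, allows \<open>spanning\<close> to combine a cap from the middle with
  these caps into \<open>E (Suc f) N\<close>.\<close>

lemma right_span:
  assumes "2 * f \<le> Suc N" "N < n" "x \<in> H (Suc N)"
  shows "E f N * x \<in> zs {h * r | h r. h \<in> H (Suc N - 2 * f) \<and> r \<in> right_diagrams f N \<and> (\<exists>x\<in>H (Suc N). r = E f N * x)}"
proof -
  let ?A = "{t * h | t h. t \<in> opp.sorted_arcs f N (Suc N) \<and> h \<in> opp.H (Suc N - 2 * f)}"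
  have "Opp x * opp.E f N \<in> zspan (Opp ` Z) ?A"
    using opp.sort_arcs[OF assms(1,2)] opp_H(1)[OF assms(3)] by simp
  from unopp_zspan[OF this] have 1: "E f N * x \<in> zs (unopp ` ?A)"
    unfolding unopp_simps opp_E[OF assms(1,2)] opp.sel using central by blast
  show ?thesis
  proof (rule zspan_mono[OF 1], clarsimp)
    fix t h assume t: "t \<in> opp.sorted_arcs f N (Suc N)" and h: "h \<in> opp.H (Suc N - 2 * f)"
    obtain x where x: "x \<in> opp.H (Suc N)" "t = x * opp.E f N" using opp.sorted_arcs_H[OF assms(1,2) t] by blast
    have "unopp t = E f N * unopp x" "unopp x \<in> H (Suc N)" using x opp_H(2) opp_E[OF assms(1,2)] by auto
    then show "unopp h * unopp t \<in> zs {h * r | h r. h \<in> H (Suc N - 2 * f) \<and> r \<in> right_diagrams f N \<and> (\<exists>x\<in>H (Suc N). r = E f N * x)}"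
      using unopp_sorted_arcs[OF t assms(2)] opp_H(2)[OF h] by (intro zspan_base) blast
  qed
qed

lemma left_span:
  assumes "2 * f \<le> Suc N" "N < n" "x \<in> H (Suc N)"
  shows "x * E f N \<in> zs {l * h | l h. h \<in> H (Suc N - 2 * f) \<and> l \<in> left_diagrams f N \<and> (\<exists>x\<in>H (Suc N). l = x * E f N)}"
proof (rule zspan_mono[OF sort_arcs[OF assms]], clarify)
  fix t h assume t: "t \<in> sorted_arcs f N (Suc N)" and h: "h \<in> H (Suc N - 2 * f)"
  have "t \<in> left_diagrams f N" using sorted_arcs_unroll[OF t assms(2)] unfolding left_diagrams_def by blast
  then show "t * h \<in> zs {l * h | l h. h \<in> H (Suc N - 2 * f) \<and> l \<in> left_diagrams f N \<and> (\<exists>x\<in>H (Suc N). l = x * E f N)}"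
    using sorted_arcs_H[OF assms(1,2) t] h by (intro zspan_base) blast
qed

lemma A0p_r: "A0i_power f x * g = A0i_power f (x * g)"
  by (induction f) (auto simp: mult.assoc)

definition diagrams :: "(nat \<Rightarrow> 'b set) \<Rightarrow> nat \<Rightarrow> 'b set" where
  "diagrams W N = {l * (w * r) | f l w r. 2 * f \<le> Suc N \<and> l \<in> left_diagrams f N \<and> w \<in> W (Suc N - 2 * f) \<and> r \<in> right_diagrams f N}"

lemma y_prod: "1 \<le> i \<Longrightarrow> y i = prod_list (map X (rev [1..<i]) @ [Y] @ map X [1..<i])"
proof (induction i rule: dec_induct)
  case (step i)
  then show ?case by (simp add: y_Suc mult.assoc)
qed simp

text \<open>Descending induction on the number of arcs: modulo the ideal generated by \<open>E (Suc f)\<close>, the middle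
  factor only matters modulo the ideal generated by the \<open>e a\<close>. The idempotent \<open>\<epsilon>\<close> restricts
  the hypothesis to one component of a product ring.\<close>

theorem spanning:
  assumes N: "N < n" and eps: "\<epsilon> \<in> Z" "\<epsilon> * \<epsilon> = \<epsilon>"
    and W: "\<And>l x. l \<le> Suc N \<Longrightarrow> x \<in> H l \<Longrightarrow> \<exists>w\<in>zs (W l).
        \<exists>d\<in>zs {u * e a * v | u a v. u \<in> H l \<and> v \<in> H l \<and> 1 \<le> a \<and> a < l}. \<epsilon> * x = \<epsilon> * w + \<epsilon> * d"
    and x: "x \<in> H (Suc N)"
  shows "\<epsilon> * x \<in> zs (diagrams W N)"
proof -
  have main: "2 * f \<le> Suc N \<Longrightarrow> a \<in> H (Suc N) \<Longrightarrow> b \<in> H (Suc N) \<Longrightarrow> \<epsilon> * (a * E f N * b) \<in> zs (diagrams W N)" for f a b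
  proof (induction "Suc N - 2 * f" arbitrary: f a b rule: less_induct)
    case less
    let ?H = "H (Suc N - 2 * f)"
    have HN: "h \<in> H (Suc N)" if "h \<in> ?H" for h using H_mono[OF that] by simp
    have EH: "E f N \<in> H (Suc N)" by (rule E_H[OF less.prems(1)])
    have Ec: "h * E f N = E f N * h" if "h \<in> ?H" for h using E_comm[OF that less.prems(1) N] .
    have elt: "l * h * (h' * r) * \<epsilon> \<in> zs (diagrams W N)"
      if *: "h \<in> ?H" "h' \<in> ?H" "l \<in> left_diagrams f N" "r \<in> right_diagrams f N" "u \<in> H (Suc N)" "l = u * E f N" "v \<in> H (Suc N)" "r = E f N * v"
      for l h h' r u v
    proof -
      obtain w d where w: "w \<in> zs (W (Suc N - 2 * f))"
        and d: "d \<in> zs {u * e a * v | u a v. u \<in> ?H \<and> v \<in> ?H \<and> 1 \<le> a \<and> a < Suc N - 2 * f}"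
        and eq: "\<epsilon> * (h * h') = \<epsilon> * w + \<epsilon> * d"
        using W[of "Suc N - 2 * f" "h * h'"] H_ring(3)[OF *(1,2)] by auto
      have "l * h * (h' * r) * \<epsilon> = l * (\<epsilon> * (h * h')) * r"
        using central[OF eps(1), of "l * h * (h' * r)"] central_left[OF eps(1)] by (simp add: mult.assoc)
      also have "\<dots> = \<epsilon> * (l * w * r) + \<epsilon> * (l * d * r)"
        unfolding eq using central_left[OF eps(1)] by (simp add: distrib_left distrib_right mult.assoc)
      finally have 1: "l * h * (h' * r) * \<epsilon> = \<epsilon> * (l * w * r) + \<epsilon> * (l * d * r)" .
      have "l * (w * r) \<in> zs (diagrams W N)"
      proof (rule zs_lmult[OF zs_rmult[OF w]])
        fix a assume "a \<in> W (Suc N - 2 * f)"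
        then show "a * r \<in> zs {a * r | a. a \<in> W (Suc N - 2 * f)}" by (intro zspan_base) blast
      next
        fix b assume "b \<in> {a * r | a. a \<in> W (Suc N - 2 * f)}"
        then show "l * b \<in> zs (diagrams W N)" using less.prems(1) *(3,4) unfolding diagrams_def by (intro zspan_base) blast
      qed
      then have 2: "\<epsilon> * (l * w * r) \<in> zs (diagrams W N)" by (simp add: mult.assoc zspan_scale[OF eps(1)])
      have 3: "\<epsilon> * l * (d * r) \<in> zs (diagrams W N)"
      proof (rule zs_lmult[OF zs_rmult[OF d]])
        fix b assume "b \<in> {u * e a * v | u a v. u \<in> ?H \<and> v \<in> ?H \<and> 1 \<le> a \<and> a < Suc N - 2 * f}"
        then show "b * r \<in> zs {u * e a * v * r | u a v. u \<in> ?H \<and> v \<in> ?H \<and> 1 \<le> a \<and> a < Suc N - 2 * f}" by (intro zspan_base) blast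
      next
        fix b assume "b \<in> {u * e a * v * r | u a v. u \<in> ?H \<and> v \<in> ?H \<and> 1 \<le> a \<and> a < Suc N - 2 * f}"
        then obtain u' a v' where b: "b = u' * e a * v' * r" "u' \<in> ?H" "v' \<in> ?H" "1 \<le> a" "a < Suc N - 2 * f" by blast
        have a: "a \<le> N - 2 * f" "N - 2 * f < n" "Suc (N - 2 * f) = Suc N - 2 * f" using b N by auto
        \<comment> \<open>The cap is replaced by the last cap on the middle strands. Since
          \<open>E f N\<close> commutes with the middle algebra, one copy of \<open>E f N\<close>
          can be brought next to it, and their product is \<open>E (Suc f) N\<close>, for which the
          claim is already known.\<close>
        obtain p q where pq: "p \<in> ?H" "q \<in> ?H" "e a = p * e (N - 2 * f) * q"
          using e_conj[OF b(4) a(1,2)] a(3) by auto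
        have f1: "2 * Suc f \<le> Suc N" using b(4,5) by arith
        have up: "u' * p \<in> ?H" "q * v' \<in> ?H" using H_ring(3) pq b by auto
        have "l * b = u * (E f N * (u' * p)) * e (N - 2 * f) * ((q * v') * E f N) * v"
          by (simp add: b(1) pq(3) *(6,8) mult.assoc)
        also have "\<dots> = (u * (u' * p)) * (E f N * e (N - 2 * f)) * (E f N * (q * v') * v)"
          by (simp add: Ec[OF up(1), symmetric] Ec[OF up(2)]) (simp add: mult.assoc)
        also have "E f N * e (N - 2 * f) = E (Suc f) N" using E_Suc[OF f1] .
        finally have lb: "l * b = (u * (u' * p)) * E (Suc f) N * (E f N * (q * v') * v)" .
        have "\<epsilon> * ((u * (u' * p)) * E (Suc f) N * (E f N * (q * v') * v)) \<in> zs (diagrams W N)"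
          using f1 * HN[OF up(1)] HN[OF up(2)] EH by (intro less.hyps) (auto intro!: H_ring(3))
        then show "\<epsilon> * l * b \<in> zs (diagrams W N)" by (simp add: lb mult.assoc)
      qed
      then have "\<epsilon> * (l * d * r) \<in> zs (diagrams W N)" by (simp add: mult.assoc)
      then show ?thesis unfolding 1 using 2 by (rule zspan_add[rotated])
    qed
    have p: "(a * E f N) * (E f N * b) \<in> zs {l * h * (h' * r) | l h h' r. h \<in> ?H \<and> h' \<in> ?H \<and> l \<in> left_diagrams f N \<and> r \<in> right_diagrams f N \<and>
        (\<exists>u\<in>H (Suc N). l = u * E f N) \<and> (\<exists>v\<in>H (Suc N). r = E f N * v)}"
      by (rule zs_mult[OF left_span[OF less.prems(1) N less.prems(2)] right_span[OF less.prems(1) N less.prems(3)]])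
         (rule zspan_base, blast)
    have "(a * E f N) * (E f N * b) * \<epsilon> \<in> zs (diagrams W N)"
      by (rule zs_rmult[OF p]) (use elt in blast)
    then have "A0i_power f ((a * E f N) * (E f N * b) * \<epsilon>) \<in> zs (diagrams W N)" by (rule A0p_zs)
    moreover have "\<epsilon> * (a * E f N * b) = A0i_power f ((a * E f N) * (E f N * b) * \<epsilon>)"
    proof -
      \<comment> \<open>The square of \<open>E f N\<close> is inserted at the cost of a scalar, so
        that \<open>left_span\<close> applies to \<open>a * E f N\<close> and
        \<open>right_span\<close> to \<open>E f N * b\<close>.\<close>
      have "\<epsilon> * (a * E f N * b) = \<epsilon> * (a * A0i_power f (E f N * E f N) * b)" using E_idem[OF less.prems(1) N] by simp
      also have "\<dots> = A0i_power f (\<epsilon> * (a * (E f N * E f N))) * b" by (simp add: A0p_l mult.assoc[symmetric])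
      also have "\<dots> = A0i_power f (\<epsilon> * (a * (E f N * E f N)) * b)"
        by (rule A0p_r)
      finally show ?thesis using central[OF eps(1), of "a * E f N * (E f N * b)"] by (simp add: mult.assoc)
    qed
    ultimately show ?case by simp
  qed
  show ?thesis using main[of 0 x 1] x H_ring(1) by simp
qed

end

section \<open>Free algebras and presentations\<close>

lemma free_alg_sum: "p = (\<Sum>w\<in>Poly_Mapping.keys p. Poly_Mapping.single w (Poly_Mapping.lookup p w))"
  by (rule poly_mapping_eqI)
     (simp add: lookup_sum lookup_single when_def in_keys_iff sum.delta' cong: if_cong)

lemma fconst_add: "fconst (a + b) = fconst a + fconst b"
  and fconst_diff: "fconst (a - b) = fconst a - fconst b"
  and fconst_mult: "fconst (a * b) = fconst a * fconst b"
  and fconst_1 [simp]: "fconst 1 = 1" and fconst_0 [simp]: "fconst 0 = 0"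
  by (simp_all add: fconst_def single_add single_diff mult_single)

lemma single_Word: "Poly_Mapping.single (w :: 'g free_word) (c :: 'r::comm_ring_1) = fconst c * prod_list (map fgen (letters w))"
proof -
  have "prod_list (map fgen ws) = Poly_Mapping.single (Word ws) (1::'r::comm_ring_1)" for ws :: "'g list"
    by (induction ws) (simp_all add: fgen_def mult_single plus_free_word_def flip: zero_free_word_def)
  then show ?thesis by (cases w) (simp add: fconst_def mult_single)
qed

lemma fconst_central: "fconst c * p = p * (fconst c :: ('g, 'r::comm_ring_1) free_alg)"
proof -
  have "fconst c * (\<Sum>w\<in>Poly_Mapping.keys p. Poly_Mapping.single w (Poly_Mapping.lookup p w)) =
     (\<Sum>w\<in>Poly_Mapping.keys p. Poly_Mapping.single w (Poly_Mapping.lookup p w)) * fconst c"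
    by (simp add: sum_distrib_left sum_distrib_right fconst_def mult_single mult.commute)
  then show ?thesis by (simp flip: free_alg_sum)
qed

definition FA :: "'g set \<Rightarrow> ('g, 'r::comm_ring_1) free_alg set" where
  "FA G = carrier (free_alg_on G)"

lemma FA_iff: "p \<in> FA G \<longleftrightarrow> (\<forall>w\<in>Poly_Mapping.keys p. set (letters w) \<subseteq> G)"
  by (simp add: FA_def free_alg_on_def)

lemma FA_sel: "carrier (free_alg_on G) = FA G" "monoid.mult (free_alg_on G) = (*)" "one (free_alg_on G) = 1"
    "ring.zero (free_alg_on G) = 0" "ring.add (free_alg_on G) = (+)"
  by (simp_all add: FA_def free_alg_on_def)

lemma FA_add: "p \<in> FA G \<Longrightarrow> q \<in> FA G \<Longrightarrow> p + q \<in> FA G"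
  unfolding FA_iff using keys_add[of p q] by blast

lemma FA_uminus: "p \<in> FA G \<Longrightarrow> - p \<in> FA G"
  unfolding FA_iff by simp

lemma FA_diff: "p \<in> FA G \<Longrightarrow> q \<in> FA G \<Longrightarrow> p - q \<in> FA G"
  using FA_add[of p G "- q"] FA_uminus[of q G] by simp

lemma FA_mult: "p \<in> FA G \<Longrightarrow> q \<in> FA G \<Longrightarrow> p * q \<in> FA G"
  unfolding FA_iff using keys_mult[of p q] by (fastforce simp: plus_free_word_def)

lemma FA_fconst: "fconst c \<in> FA G"
  unfolding FA_iff fconst_def by (auto simp: zero_free_word_def split: if_splits)

lemma FA_0: "0 \<in> FA G" and FA_1: "1 \<in> FA G"
  using FA_fconst[of 0 G] FA_fconst[of 1 G] by simp_all

lemma FA_fgen: "g \<in> G \<Longrightarrow> fgen g \<in> FA G"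
  unfolding FA_iff fgen_def by auto

lemma FA_power: "p \<in> FA G \<Longrightarrow> p ^ m \<in> FA G"
  by (induction m) (auto intro: FA_1 FA_mult)

lemma FA_sum: "(\<And>i. i \<in> I \<Longrightarrow> f i \<in> FA G) \<Longrightarrow> sum f I \<in> FA G"
  by (induction I rule: infinite_finite_induct) (auto intro: FA_0 FA_add)

lemma FA_mono: "p \<in> FA G \<Longrightarrow> G \<subseteq> G' \<Longrightarrow> p \<in> FA G'"
  unfolding FA_iff by blast

lemmas FA_intros = FA_add FA_diff FA_mult FA_power FA_fconst FA_0 FA_1 FA_fgen FA_sum

lemma FA_induct [consumes 1, case_names const gen add mult]:
  fixes p :: "('g, 'r::comm_ring_1) free_alg"
  assumes "p \<in> FA G" and c: "\<And>c. P (fconst c)" and g: "\<And>g. g \<in> G \<Longrightarrow> P (fgen g)"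
    and a: "\<And>p q. p \<in> FA G \<Longrightarrow> q \<in> FA G \<Longrightarrow> P p \<Longrightarrow> P q \<Longrightarrow> P (p + q)"
    and m: "\<And>p q. p \<in> FA G \<Longrightarrow> q \<in> FA G \<Longrightarrow> P p \<Longrightarrow> P q \<Longrightarrow> P (p * q)"
  shows "P p"
proof -
  have w: "(prod_list (map fgen ws) :: ('g, 'r) free_alg) \<in> FA G \<and> P (prod_list (map fgen ws))" if "set ws \<subseteq> G" for ws
    using that
  proof (induction ws)
    case (Cons a ws)
    then have *: "a \<in> G" "(prod_list (map fgen ws) :: ('g, 'r) free_alg) \<in> FA G" "P (prod_list (map fgen ws))" by auto
    show ?case using m[OF FA_fgen[OF *(1)] *(2) g[OF *(1)] *(3)] FA_mult[OF FA_fgen[OF *(1)] *(2)] by simp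
  qed (use c[of 1] FA_1 in simp)
  have "(\<Sum>w\<in>I. Poly_Mapping.single w (Poly_Mapping.lookup p w)) \<in> FA G \<and> P (\<Sum>w\<in>I. Poly_Mapping.single w (Poly_Mapping.lookup p w))"
    if "finite I" "I \<subseteq> Poly_Mapping.keys p" for I
    using that
  proof (induction I rule: finite_induct)
    case empty then show ?case using c[of 0] FA_0 by simp
  next
    case (insert w I)
    have "set (letters w) \<subseteq> G" using insert.prems assms(1) unfolding FA_iff by auto
    from w[OF this] have "Poly_Mapping.single w (Poly_Mapping.lookup p w) \<in> FA G \<and> P (Poly_Mapping.single w (Poly_Mapping.lookup p w))"
      unfolding single_Word using m[OF FA_fconst _ c] FA_mult[OF FA_fconst] by blast
    then show ?case using insert a FA_add by auto
  qed
  from this[of "Poly_Mapping.keys p"] show ?thesis by (simp flip: free_alg_sum)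
qed

lemma free_alg_ring: "ring (free_alg_on G)"
proof (rule ringI)
  show "abelian_group (free_alg_on G)"
    by (rule abelian_groupI) (auto simp: FA_sel algebra_simps intro: FA_intros bexI[of _ "- _"] FA_uminus)
  show "monoid (free_alg_on G)"
    by (rule monoidI) (auto simp: FA_sel mult.assoc intro: FA_intros)
qed (auto simp: FA_sel algebra_simps)

lemma FA_a_inv: "p \<in> FA G \<Longrightarrow> \<ominus>\<^bsub>free_alg_on G\<^esub> p = - p"
  by (rule abelian_group.minus_equality[OF ring.is_abelian_group[OF free_alg_ring]]) (simp_all add: FA_sel FA_uminus)

lemma FA_minus: "p \<in> FA G \<Longrightarrow> q \<in> FA G \<Longrightarrow> p \<ominus>\<^bsub>free_alg_on G\<^esub> q = p - q"
  by (simp add: a_minus_def FA_a_inv FA_sel)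

lemma FA_idealI:
  assumes "I \<subseteq> FA G" "0 \<in> I" "\<And>a b. a \<in> I \<Longrightarrow> b \<in> I \<Longrightarrow> a + b \<in> I"
    "\<And>a p. a \<in> I \<Longrightarrow> p \<in> FA G \<Longrightarrow> p * a \<in> I" "\<And>a p. a \<in> I \<Longrightarrow> p \<in> FA G \<Longrightarrow> a * p \<in> I"
  shows "ideal I (free_alg_on G)"
proof (rule idealI[OF free_alg_ring])
  have neg: "- a \<in> I" if "a \<in> I" for a using assms(4)[OF that FA_uminus[OF FA_1]] by simp
  show "subgroup I (add_monoid (free_alg_on G))"
  proof (rule subgroup.intro)
    fix x assume "x \<in> I"
    moreover have "inv\<^bsub>add_monoid (free_alg_on G)\<^esub> x = \<ominus>\<^bsub>free_alg_on G\<^esub> x" by (simp add: a_inv_def)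
    ultimately show "inv\<^bsub>add_monoid (free_alg_on G)\<^esub> x \<in> I"
      using FA_a_inv[of x G] neg assms(1) by auto
  qed (use assms(1-3) in \<open>auto simp: FA_sel\<close>)
qed (use assms in \<open>auto simp: FA_sel\<close>)

lemma subst_superset:
  assumes "finite I" "Poly_Mapping.keys p \<subseteq> I"
  shows "subst_gens \<sigma> p = (\<Sum>w\<in>I. fconst (Poly_Mapping.lookup p w) * prod_list (map \<sigma> (letters w)))"
  unfolding subst_gens_def using assms by (intro sum.mono_neutral_left) (auto simp: in_keys_iff)

lemma subst_add: "subst_gens \<sigma> (p + q) = subst_gens \<sigma> p + subst_gens \<sigma> q"
proof -
  let ?I = "Poly_Mapping.keys p \<union> Poly_Mapping.keys q"
  have "Poly_Mapping.keys (p + q) \<subseteq> ?I" by (rule keys_add)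
  then show ?thesis
    using subst_superset[of ?I p \<sigma>] subst_superset[of ?I q \<sigma>] subst_superset[of ?I "p + q" \<sigma>]
    by (simp add: lookup_add fconst_add distrib_right sum.distrib)
qed

lemma subst_single: "subst_gens \<sigma> (Poly_Mapping.single w c) = fconst c * prod_list (map \<sigma> (letters w))"
  using subst_superset[of "{w}" "Poly_Mapping.single w c" \<sigma>] by (simp split: if_splits)

lemma subst_0 [simp]: "subst_gens \<sigma> 0 = 0"
  by (simp add: subst_gens_def)

lemma subst_sum: "subst_gens \<sigma> (sum f I) = (\<Sum>i\<in>I. subst_gens \<sigma> (f i))"
  by (induction I rule: infinite_finite_induct) (auto simp: subst_add)

lemma subst_diff: "subst_gens \<sigma> (p - q) = subst_gens \<sigma> p - subst_gens \<sigma> q"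
  using subst_add[of \<sigma> "p - q" q] by simp

lemma subst_mult: "subst_gens \<sigma> (p * q) = subst_gens \<sigma> p * subst_gens \<sigma> q"
proof -
  have s: "subst_gens \<sigma> (Poly_Mapping.single v c * Poly_Mapping.single w d) =
     subst_gens \<sigma> (Poly_Mapping.single v c) * subst_gens \<sigma> (Poly_Mapping.single w d)" for v w c d
  proof -
    have "fconst c * prod_list (map \<sigma> (letters v)) * (fconst d * prod_list (map \<sigma> (letters w))) =
       fconst c * (fconst d * prod_list (map \<sigma> (letters v))) * prod_list (map \<sigma> (letters w))"
      using fconst_central[of d "prod_list (map \<sigma> (letters v))"] by (simp add: mult.assoc)
    then show ?thesis by (simp add: mult_single subst_single fconst_mult plus_free_word_def mult.assoc)
  qed
  let ?p = "\<Sum>w\<in>Poly_Mapping.keys p. Poly_Mapping.single w (Poly_Mapping.lookup p w)"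
  let ?q = "\<Sum>w\<in>Poly_Mapping.keys q. Poly_Mapping.single w (Poly_Mapping.lookup q w)"
  have "subst_gens \<sigma> (?p * ?q) = subst_gens \<sigma> ?p * subst_gens \<sigma> ?q"
    by (simp add: sum_distrib_left sum_distrib_right subst_sum s)
  then show ?thesis by (simp flip: free_alg_sum)
qed

lemma subst_fconst [simp]: "subst_gens \<sigma> (fconst c) = fconst c"
proof -
  have "subst_gens \<sigma> (Poly_Mapping.single 0 c) = fconst c"
    by (simp add: subst_single zero_free_word_def)
  then show ?thesis by (simp only: fconst_def)
qed

lemma subst_1 [simp]: "subst_gens \<sigma> 1 = 1"
  using subst_fconst[of \<sigma> 1] by simp

lemma subst_fgen [simp]: "subst_gens \<sigma> (fgen g) = \<sigma> g"
  by (simp add: fgen_def subst_single)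

lemma subst_power: "subst_gens \<sigma> (p ^ m) = subst_gens \<sigma> p ^ m"
  by (induction m) (simp_all add: subst_mult)

lemma subst_id: "subst_gens fgen p = p"
proof -
  have "p \<in> FA UNIV" by (simp add: FA_iff)
  then show ?thesis by (induction rule: FA_induct) (simp_all add: subst_add subst_mult)
qed

lemma subst_FA: "p \<in> FA G \<Longrightarrow> (\<And>g. g \<in> G \<Longrightarrow> \<sigma> g \<in> FA G') \<Longrightarrow> subst_gens \<sigma> p \<in> FA G'"
  by (induction rule: FA_induct) (auto simp: subst_add subst_mult intro: FA_intros)

lemma FA_idealD:
  assumes "ideal J (free_alg_on G)"
  shows "0 \<in> J" "p \<in> J \<Longrightarrow> r \<in> J \<Longrightarrow> p + r \<in> J"
    "p \<in> FA G \<Longrightarrow> r \<in> J \<Longrightarrow> p * r \<in> J" "p \<in> FA G \<Longrightarrow> r \<in> J \<Longrightarrow> r * p \<in> J"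
    "p \<in> J \<Longrightarrow> r \<in> J \<Longrightarrow> p - r \<in> J"
proof -
  interpret J: ideal J "free_alg_on G" by (rule assms)
  show "0 \<in> J" using additive_subgroup.zero_closed[OF J.additive_subgroup_axioms] by (simp add: FA_sel)
  show add: "p + r \<in> J" if "p \<in> J" "r \<in> J" for p r
    using additive_subgroup.a_closed[OF J.additive_subgroup_axioms that] by (simp add: FA_sel)
  show mult: "p * r \<in> J" if "p \<in> FA G" "r \<in> J" for p r using J.I_l_closed[of r p] that by (simp add: FA_sel)
  show "r * p \<in> J" if "p \<in> FA G" "r \<in> J" using J.I_r_closed[of r p] that by (simp add: FA_sel)
  show "p - r \<in> J" if "p \<in> J" "r \<in> J"
    using add[OF that(1) mult[OF FA_uminus[OF FA_1] that(2)]] by simp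
qed

locale presentation =
  fixes G :: "'g set" and rels :: "(('g, 'r::comm_ring_1) free_alg \<times> ('g, 'r) free_alg) set"
  assumes rels_FA: "\<And>a b. (a, b) \<in> rels \<Longrightarrow> a \<in> FA G \<and> b \<in> FA G"
begin

abbreviation "I \<equiv> rel_ideal G rels"
abbreviation "cls \<equiv> rel_class G rels"
abbreviation "B \<equiv> presented_alg G rels"

sublocale F: ring "free_alg_on G" by (rule free_alg_ring)

lemma gens_sub: "{a - b | a b. (a, b) \<in> rels} \<subseteq> carrier (free_alg_on G)"
  using rels_FA by (auto simp: FA_sel intro: FA_diff)

sublocale I: ideal I "free_alg_on G"
  unfolding rel_ideal_def by (rule F.genideal_ideal[OF gens_sub])

lemma I_rel: "(a, b) \<in> rels \<Longrightarrow> a - b \<in> I"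
  unfolding rel_ideal_def using F.genideal_self[OF gens_sub] by blast

lemma I_minimal: "ideal J (free_alg_on G) \<Longrightarrow> (\<And>a b. (a, b) \<in> rels \<Longrightarrow> a - b \<in> J) \<Longrightarrow> I \<subseteq> J"
  unfolding rel_ideal_def by (rule F.genideal_minimal) auto

lemma I_FA: "p \<in> I \<Longrightarrow> p \<in> FA G" using I.a_subset by (auto simp: FA_sel)
lemma I_0: "0 \<in> I" using I.zero_closed by (simp add: FA_sel)
lemma I_add: "p \<in> I \<Longrightarrow> q \<in> I \<Longrightarrow> p + q \<in> I" using I.a_closed[of p q] by (simp add: FA_sel)
lemma I_l: "p \<in> FA G \<Longrightarrow> q \<in> I \<Longrightarrow> p * q \<in> I" using I.I_l_closed[of q p] by (simp add: FA_sel)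
lemma I_r: "p \<in> I \<Longrightarrow> q \<in> FA G \<Longrightarrow> p * q \<in> I" using I.I_r_closed[of p q] by (simp add: FA_sel)
lemma I_uminus: "p \<in> I \<Longrightarrow> - p \<in> I" using I_l[OF FA_uminus[OF FA_1], of p] by simp
lemma I_diff: "p \<in> I \<Longrightarrow> q \<in> I \<Longrightarrow> p - q \<in> I" using I_add[of p "- q"] I_uminus by simp

lemma B_sel: "carrier B = carrier (free_alg_on G Quot I)" "monoid.mult B = monoid.mult (free_alg_on G Quot I)"
   "\<one>\<^bsub>B\<^esub> = \<one>\<^bsub>free_alg_on G Quot I\<^esub>" "\<zero>\<^bsub>B\<^esub> = \<zero>\<^bsub>free_alg_on G Quot I\<^esub>"
   "ring.add B = ring.add (free_alg_on G Quot I)" "c \<odot>\<^bsub>B\<^esub> x = cls (fconst c) \<otimes>\<^bsub>B\<^esub> x"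
  by (simp_all add: presented_alg_def Let_def)

lemma B_ring: "ring B"
proof -
  interpret Q: ring "free_alg_on G Quot I" by (rule I.quotient_is_ring)
  show ?thesis
  proof (rule ringI)
    show "abelian_group B"
    proof (rule abelian_groupI, goal_cases)
      case (3 x y z) then show ?case unfolding B_sel by (rule Q.a_assoc)
    next
      case (4 x y) then show ?case unfolding B_sel by (rule Q.a_comm)
    next
      case (6 x) then show ?case unfolding B_sel using Q.l_neg Q.a_inv_closed by blast
    qed (simp_all add: B_sel)
    show "monoid B"
      by (rule monoidI) (auto simp: B_sel Q.m_assoc)
  qed (auto simp: B_sel Q.l_distr Q.r_distr)
qed

lemma cls_hom: "cls \<in> ring_hom (free_alg_on G) (free_alg_on G Quot I)"
proof -
  have "cls = (+>\<^bsub>free_alg_on G\<^esub>) I" by (rule ext) (simp add: rel_class_def)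
  then show ?thesis using I.rcos_ring_hom by simp
qed

lemma cls_add: "p \<in> FA G \<Longrightarrow> q \<in> FA G \<Longrightarrow> cls (p + q) = cls p \<oplus>\<^bsub>B\<^esub> cls q"
  using ring_hom_add[OF cls_hom, of p q] by (simp add: FA_sel B_sel)
lemma cls_mult: "p \<in> FA G \<Longrightarrow> q \<in> FA G \<Longrightarrow> cls (p * q) = cls p \<otimes>\<^bsub>B\<^esub> cls q"
  using ring_hom_mult[OF cls_hom, of p q] by (simp add: FA_sel B_sel)
lemma cls_1: "cls 1 = \<one>\<^bsub>B\<^esub>"
  using ring_hom_one[OF cls_hom] by (simp add: FA_sel B_sel)

lemma carrier_B: "carrier B = cls ` FA G"
proof -
  have "carrier (free_alg_on G Quot I) = cls ` FA G"
    by (auto simp: FactRing_def A_RCOSETS_def' rel_class_def FA_sel)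
  then show ?thesis by (simp add: B_sel)
qed

lemma cls_closed: "p \<in> FA G \<Longrightarrow> cls p \<in> carrier B"
  by (simp add: carrier_B)

lemma cls_eq: "p \<in> FA G \<Longrightarrow> q \<in> FA G \<Longrightarrow> cls p = cls q \<longleftrightarrow> p - q \<in> I"
  using F.quotient_eq_iff_same_a_r_cos[OF I.ideal_axioms, of p q] FA_minus[of p G q]
  by (simp add: FA_sel rel_class_def)

lemma cls_self: "p \<in> FA G \<Longrightarrow> p \<in> cls p"
  unfolding rel_class_def by (rule I.a_rcos_self) (simp add: FA_sel)

lemma cls_mem: "p \<in> FA G \<Longrightarrow> q \<in> cls p \<Longrightarrow> q \<in> FA G \<and> q - p \<in> I"
proof -
  assume p: "p \<in> FA G" and q: "q \<in> cls p"
  then obtain i where i: "i \<in> I" "q = i + p"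
    by (auto simp: rel_class_def a_r_coset_def' FA_sel)
  then show ?thesis using I_FA[OF i(1)] p by (simp add: FA_add)
qed

lemma cls_0: "cls 0 = \<zero>\<^bsub>B\<^esub>"
  using ring_hom_zero[OF cls_hom F.ring_axioms I.quotient_is_ring] by (simp add: FA_sel B_sel)

lemma cls_sum:
  assumes "finite F" "\<And>x. x \<in> F \<Longrightarrow> f x \<in> FA G"
  shows "(\<Oplus>\<^bsub>B\<^esub>x\<in>F. cls (f x)) = cls (\<Sum>x\<in>F. f x)"
proof -
  interpret B: ring B by (rule B_ring)
  show ?thesis using assms
  proof (induction F rule: finite_induct)
    case (insert x F)
    then have "(\<Oplus>\<^bsub>B\<^esub>x\<in>insert x F. cls (f x)) = cls (f x) \<oplus>\<^bsub>B\<^esub> (\<Oplus>\<^bsub>B\<^esub>x\<in>F. cls (f x))"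
      by (intro B.finsum_insert) (auto intro: cls_closed)
    then show ?case using insert by (simp add: cls_add FA_sum)
  qed (simp add: cls_0)
qed

lemma cls_smult: "p \<in> FA G \<Longrightarrow> c \<odot>\<^bsub>B\<^esub> cls p = cls (fconst c * p)"
  by (simp add: B_sel(6) cls_mult FA_fconst)

text \<open>\<open>induced_map\<close> reads off the only element of the image of a coset. That
  image is a singleton because two members of the coset differ by an element of the ideal, which the
  substitution sends into the target ideal.\<close>

lemma induced:
  assumes "p \<in> FA G" "\<And>g. g \<in> G \<Longrightarrow> \<sigma> g \<in> FA G'" "presentation G' rels'"
    and "\<And>q. q \<in> I \<Longrightarrow> subst_gens \<sigma> q \<in> rel_ideal G' rels'"
  shows "induced_map G' rels' \<sigma> (cls p) = rel_class G' rels' (subst_gens \<sigma> p)"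
proof -
  interpret P': presentation G' rels' by (rule assms(3))
  have "rel_class G' rels' (subst_gens \<sigma> q) = rel_class G' rels' (subst_gens \<sigma> p)" if "q \<in> cls p" for q
  proof -
    have "q \<in> FA G" "q - p \<in> I" using cls_mem[OF assms(1) that] by auto
    have "p \<in> FA G" by (rule assms(1))
    have "subst_gens \<sigma> q - subst_gens \<sigma> p \<in> rel_ideal G' rels'" using assms(4)[OF \<open>q - p \<in> I\<close>] by (simp only: subst_diff)
    moreover have "subst_gens \<sigma> q \<in> FA G'" "subst_gens \<sigma> p \<in> FA G'"
      using subst_FA[OF \<open>q \<in> FA G\<close> assms(2)] subst_FA[OF assms(1,2)] by simp_all
    ultimately show ?thesis by (simp add: P'.cls_eq)
  qed
  then have "(\<lambda>p. rel_class G' rels' (subst_gens \<sigma> p)) ` cls p = {rel_class G' rels' (subst_gens \<sigma> p)}"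
    unfolding image_def using cls_self[OF assms(1)] by blast
  then show ?thesis by (simp add: induced_map_def)
qed

text \<open>The preimage of \<open>J\<close> under the substitution is an ideal that contains all
  relations, so it contains the smallest such ideal. Checking relations is enough even when
  \<open>J\<close> is not a relation ideal.\<close>

lemma subst_ideal:
  assumes "\<And>g. g \<in> G \<Longrightarrow> \<sigma> g \<in> FA G'" "ideal J (free_alg_on G')"
    and "\<And>a b. (a, b) \<in> rels \<Longrightarrow> subst_gens \<sigma> (a - b) \<in> J" and "q \<in> I"
  shows "subst_gens \<sigma> q \<in> J"
proof -
  interpret J: ideal J "free_alg_on G'" by (rule assms(2))
  have "I \<subseteq> {p \<in> FA G. subst_gens \<sigma> p \<in> J}"
  proof (rule I_minimal)
    show "ideal {p \<in> FA G. subst_gens \<sigma> p \<in> J} (free_alg_on G)"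
    proof (rule FA_idealI)
      show "0 \<in> {p \<in> FA G. subst_gens \<sigma> p \<in> J}" using FA_0 additive_subgroup.zero_closed[OF J.additive_subgroup_axioms] by (auto simp: FA_sel)
    next
      fix a b assume "a \<in> {p \<in> FA G. subst_gens \<sigma> p \<in> J}" "b \<in> {p \<in> FA G. subst_gens \<sigma> p \<in> J}"
      then show "a + b \<in> {p \<in> FA G. subst_gens \<sigma> p \<in> J}"
        using additive_subgroup.a_closed[OF J.additive_subgroup_axioms, of "subst_gens \<sigma> a" "subst_gens \<sigma> b"] by (auto simp: FA_sel subst_add FA_add)
    next
      fix a and p :: "('g, 'r) free_alg" assume *: "a \<in> {p \<in> FA G. subst_gens \<sigma> p \<in> J}" "p \<in> FA G"
      have s: "subst_gens \<sigma> p \<in> FA G'" using subst_FA[OF *(2) assms(1)] .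
      show "p * a \<in> {p \<in> FA G. subst_gens \<sigma> p \<in> J}" "a * p \<in> {p \<in> FA G. subst_gens \<sigma> p \<in> J}"
        using J.I_l_closed[of "subst_gens \<sigma> a" "subst_gens \<sigma> p"] J.I_r_closed[of "subst_gens \<sigma> a" "subst_gens \<sigma> p"] * s
        by (auto simp: FA_sel subst_mult FA_mult)
    qed auto
    show "a - b \<in> {p \<in> FA G. subst_gens \<sigma> p \<in> J}" if "(a, b) \<in> rels" for a b
      using assms(3)[OF that] rels_FA[OF that] FA_diff by auto
  qed
  then show ?thesis using assms(4) by blast
qed

end

section \<open>The presented algebra inside a type class ring\<close>

text \<open>The presented algebra is a ring on a carrier, whereas \<open>bmw_ring\<close> speaks about a ring type. The product of
  all rings with a given type of elements is such a type, and it has the presented algebra as a component.\<close>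

typedef ('c, 'm) prodring = "{f :: ('c, 'm) ring_scheme \<Rightarrow> 'c. \<forall>R. if ring R then f R \<in> carrier R else f R = undefined}"
  morphisms cmp Abs_prodring
  by (rule exI[of _ "\<lambda>R. if ring R then \<zero>\<^bsub>R\<^esub> else undefined"]) (auto intro: ring.ring_simprules)

lemma cmp_closed: "ring R \<Longrightarrow> cmp x R \<in> carrier R"
  using cmp[of x] by auto

lemma cmp_eqI: "(\<And>R. ring R \<Longrightarrow> cmp x R = cmp y R) \<Longrightarrow> x = y"
proof -
  assume *: "\<And>R. ring R \<Longrightarrow> cmp x R = cmp y R"
  have "cmp x R = cmp y R" for R
    using cmp[of x] cmp[of y] * by (cases "ring R") auto
  then show ?thesis by (metis cmp_inject ext)
qed

definition mkp :: "(('c, 'm) ring_scheme \<Rightarrow> 'c) \<Rightarrow> ('c, 'm) prodring" where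
  "mkp f = Abs_prodring (\<lambda>R. if ring R then f R else undefined)"

lemma cmp_mkp: "(\<And>R. ring R \<Longrightarrow> f R \<in> carrier R) \<Longrightarrow> ring R \<Longrightarrow> cmp (mkp f) R = f R"
  unfolding mkp_def by (subst Abs_prodring_inverse) auto

instantiation prodring :: (type, type) "{ring,monoid_mult}"
begin
definition "0 = mkp (\<lambda>R. \<zero>\<^bsub>R\<^esub>)"
definition "1 = mkp (\<lambda>R. \<one>\<^bsub>R\<^esub>)"
definition "x + y = mkp (\<lambda>R. cmp x R \<oplus>\<^bsub>R\<^esub> cmp y R)"
definition "x * y = mkp (\<lambda>R. cmp x R \<otimes>\<^bsub>R\<^esub> cmp y R)"
definition "- x = mkp (\<lambda>R. \<ominus>\<^bsub>R\<^esub> cmp x R)"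
definition "x - y = mkp (\<lambda>R. cmp x R \<ominus>\<^bsub>R\<^esub> cmp y R)"

lemma cmp_simps:
  assumes "ring R"
  shows "cmp 0 R = \<zero>\<^bsub>R\<^esub>" "cmp 1 R = \<one>\<^bsub>R\<^esub>" "cmp (x + y) R = cmp x R \<oplus>\<^bsub>R\<^esub> cmp y R"
    "cmp (x * y) R = cmp x R \<otimes>\<^bsub>R\<^esub> cmp y R" "cmp (- x) R = \<ominus>\<^bsub>R\<^esub> cmp x R" "cmp (x - y) R = cmp x R \<ominus>\<^bsub>R\<^esub> cmp y R"
proof -
  interpret ring R by (rule assms)
  note c = ring.ring_simprules(1-5) ring.ring_simprules(6) cmp_closed
  show "cmp 0 R = \<zero>\<^bsub>R\<^esub>" unfolding zero_prodring_def by (rule cmp_mkp[OF _ assms]) (rule c)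
  show "cmp 1 R = \<one>\<^bsub>R\<^esub>" unfolding one_prodring_def by (rule cmp_mkp[OF _ assms]) (rule c)
  show "cmp (x + y) R = cmp x R \<oplus>\<^bsub>R\<^esub> cmp y R" unfolding plus_prodring_def by (rule cmp_mkp[OF _ assms]) (intro c)
  show "cmp (x * y) R = cmp x R \<otimes>\<^bsub>R\<^esub> cmp y R" unfolding times_prodring_def by (rule cmp_mkp[OF _ assms]) (intro c)
  show "cmp (- x) R = \<ominus>\<^bsub>R\<^esub> cmp x R" unfolding uminus_prodring_def by (rule cmp_mkp[OF _ assms]) (intro c)
  show "cmp (x - y) R = cmp x R \<ominus>\<^bsub>R\<^esub> cmp y R" unfolding minus_prodring_def by (rule cmp_mkp[OF _ assms]) (intro c)
qed

instance
proof
  fix a b c :: "('a, 'b) prodring"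
  show "a + b + c = a + (b + c)"
  proof (rule cmp_eqI)
    fix R :: "('a, 'b) ring_scheme" assume R: "ring R"
    interpret ring R by (rule R)
    show "cmp (a + b + c) R = cmp (a + (b + c)) R" by (simp add: cmp_simps[OF R] cmp_closed[OF R] a_assoc)
  qed
next
  fix a b :: "('a, 'b) prodring"
  show "a + b = b + a"
  proof (rule cmp_eqI)
    fix R :: "('a, 'b) ring_scheme" assume R: "ring R"
    interpret ring R by (rule R)
    show "cmp (a + b) R = cmp (b + a) R" unfolding cmp_simps[OF R] by (rule a_comm; rule cmp_closed[OF R])
  qed
next
  fix a :: "('a, 'b) prodring"
  show "0 + a = a"
  proof (rule cmp_eqI)
    fix R :: "('a, 'b) ring_scheme" assume R: "ring R"
    interpret ring R by (rule R)
    show "cmp (0 + a) R = cmp a R" by (simp add: cmp_simps[OF R] cmp_closed[OF R])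
  qed
next
  fix a :: "('a, 'b) prodring"
  show "- a + a = 0"
  proof (rule cmp_eqI)
    fix R :: "('a, 'b) ring_scheme" assume R: "ring R"
    interpret ring R by (rule R)
    show "cmp (- a + a) R = cmp 0 R" by (simp add: cmp_simps[OF R] cmp_closed[OF R] l_neg)
  qed
next
  fix a b :: "('a, 'b) prodring"
  show "a - b = a + - b"
  proof (rule cmp_eqI)
    fix R :: "('a, 'b) ring_scheme" assume R: "ring R"
    show "cmp (a - b) R = cmp (a + - b) R" by (simp add: cmp_simps[OF R] a_minus_def)
  qed
next
  fix a b c :: "('a, 'b) prodring"
  show "a * b * c = a * (b * c)"
  proof (rule cmp_eqI)
    fix R :: "('a, 'b) ring_scheme" assume R: "ring R"
    interpret ring R by (rule R)
    show "cmp (a * b * c) R = cmp (a * (b * c)) R" by (simp add: cmp_simps[OF R] cmp_closed[OF R] m_assoc)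
  qed
next
  fix a b c :: "('a, 'b) prodring"
  show "(a + b) * c = a * c + b * c"
  proof (rule cmp_eqI)
    fix R :: "('a, 'b) ring_scheme" assume R: "ring R"
    interpret ring R by (rule R)
    show "cmp ((a + b) * c) R = cmp (a * c + b * c) R" by (simp add: cmp_simps[OF R] cmp_closed[OF R] l_distr)
  qed
next
  fix a b c :: "('a, 'b) prodring"
  show "a * (b + c) = a * b + a * c"
  proof (rule cmp_eqI)
    fix R :: "('a, 'b) ring_scheme" assume R: "ring R"
    interpret ring R by (rule R)
    show "cmp (a * (b + c)) R = cmp (a * b + a * c) R" by (simp add: cmp_simps[OF R] cmp_closed[OF R] r_distr)
  qed
next
  fix a :: "('a, 'b) prodring"
  show "1 * a = a"
  proof (rule cmp_eqI)
    fix R :: "('a, 'b) ring_scheme" assume R: "ring R"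
    interpret ring R by (rule R)
    show "cmp (1 * a) R = cmp a R" by (simp add: cmp_simps[OF R] cmp_closed[OF R])
  qed
next
  fix a :: "('a, 'b) prodring"
  show "a * 1 = a"
  proof (rule cmp_eqI)
    fix R :: "('a, 'b) ring_scheme" assume R: "ring R"
    interpret ring R by (rule R)
    show "cmp (a * 1) R = cmp a R" by (simp add: cmp_simps[OF R] cmp_closed[OF R])
  qed
qed

end

lemma cmp_prod_list: "ring R \<Longrightarrow> cmp (prod_list xs) R = mprod R (map (\<lambda>x. cmp x R) xs)"
  by (induction xs) (simp_all add: cmp_simps mprod_def)

lemma unit_inv: "x dvd 1 \<Longrightarrow> x * unit_inv x = (1::'r::comm_ring_1)"
proof -
  assume "x dvd 1"
  then obtain y where y: "x * y = 1" by (metis dvdE)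
  have "z = y" if "x * z = 1" for z
  proof -
    have "z = (x * y) * z" using y by simp
    also have "\<dots> = (x * z) * y" by (simp only: ac_simps)
    finally show ?thesis using that by simp
  qed
  then show ?thesis unfolding unit_inv_def using y by (rule theI[rotated])
qed

lemma rels_gens:
  assumes "(a, b) \<in> bmw_rels n P"
  shows "a \<in> FA (bmw_gens n) \<and> b \<in> FA (bmw_gens n)"
proof -
  have g: "1 \<le> n \<Longrightarrow> GY \<in> bmw_gens n" "1 \<le> n \<Longrightarrow> GYinv \<in> bmw_gens n"
    "\<And>i. 1 \<le> i \<Longrightarrow> i < n \<Longrightarrow> GX i \<in> bmw_gens n" "\<And>i. 1 \<le> i \<Longrightarrow> i < n \<Longrightarrow> GXinv i \<in> bmw_gens n"
    "\<And>i. 1 \<le> i \<Longrightarrow> i < n \<Longrightarrow> GE i \<in> bmw_gens n"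
    by (auto simp: bmw_gens_def)
  note f = g[THEN FA_fgen]
  show ?thesis
    using assms unfolding bmw_rels_def Let_def
    by (elim UnE; auto split: if_splits intro!: FA_mult FA_diff FA_power FA_sum FA_1 FA_fconst f)
qed

lemma bmw_presentation: "presentation (bmw_gens n) (bmw_rels n P)"
  by unfold_locales (rule rels_gens)

lemma bmw_relI:
  fixes P :: "'r::comm_ring_1 cyc_params"
  shows "1 \<le> n \<Longrightarrow> (fgen GY * fgen GYinv, 1) \<in> bmw_rels n P"
    "1 \<le> n \<Longrightarrow> (fgen GYinv * fgen GY, 1) \<in> bmw_rels n P"
    "1 \<le> i \<Longrightarrow> i < n \<Longrightarrow> (fgen (GX i) * fgen (GXinv i), 1) \<in> bmw_rels n P"
    "1 \<le> i \<Longrightarrow> i < n \<Longrightarrow> (fgen (GXinv i) * fgen (GX i), 1) \<in> bmw_rels n P"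
    "1 \<le> i \<Longrightarrow> i < n \<Longrightarrow> (fgen (GX i) - fgen (GXinv i), fconst (par_delta P) * (1 - fgen (GE i))) \<in> bmw_rels n P"
    "1 \<le> i \<Longrightarrow> i < n \<Longrightarrow> 1 \<le> j \<Longrightarrow> j < n \<Longrightarrow> i + 2 \<le> j \<or> j + 2 \<le> i \<Longrightarrow> (fgen (GX i) * fgen (GX j), fgen (GX j) * fgen (GX i)) \<in> bmw_rels n P"
    "1 \<le> i \<Longrightarrow> i < n \<Longrightarrow> 1 \<le> j \<Longrightarrow> j < n \<Longrightarrow> i + 2 \<le> j \<or> j + 2 \<le> i \<Longrightarrow> (fgen (GX i) * fgen (GE j), fgen (GE j) * fgen (GX i)) \<in> bmw_rels n P"
    "1 \<le> i \<Longrightarrow> i < n \<Longrightarrow> 1 \<le> j \<Longrightarrow> j < n \<Longrightarrow> i + 2 \<le> j \<or> j + 2 \<le> i \<Longrightarrow> (fgen (GE i) * fgen (GE j), fgen (GE j) * fgen (GE i)) \<in> bmw_rels n P"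
    "1 \<le> i \<Longrightarrow> i + 1 < n \<Longrightarrow> (fgen (GX i) * fgen (GX (i + 1)) * fgen (GX i), fgen (GX (i + 1)) * fgen (GX i) * fgen (GX (i + 1))) \<in> bmw_rels n P"
    "1 \<le> i \<Longrightarrow> i < n \<Longrightarrow> (fgen (GX i) * fgen (GE i), fconst (par_lam P) * fgen (GE i)) \<in> bmw_rels n P"
    "1 \<le> i \<Longrightarrow> i < n \<Longrightarrow> (fgen (GE i) * fgen (GX i), fconst (par_lam P) * fgen (GE i)) \<in> bmw_rels n P"
    "1 \<le> i \<Longrightarrow> i < n \<Longrightarrow> 1 \<le> j \<Longrightarrow> j < n \<Longrightarrow> j = i + 1 \<or> i = j + 1 \<Longrightarrow> (fgen (GX i) * fgen (GX j) * fgen (GE i), fgen (GE j) * fgen (GE i)) \<in> bmw_rels n P"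
    "1 \<le> i \<Longrightarrow> i < n \<Longrightarrow> 1 \<le> j \<Longrightarrow> j < n \<Longrightarrow> j = i + 1 \<or> i = j + 1 \<Longrightarrow> (fgen (GE j) * fgen (GE i), fgen (GE j) * fgen (GX i) * fgen (GX j)) \<in> bmw_rels n P"
    "1 \<le> i \<Longrightarrow> i < n \<Longrightarrow> 1 \<le> j \<Longrightarrow> j < n \<Longrightarrow> j = i + 1 \<or> i = j + 1 \<Longrightarrow> (fgen (GE i) * fgen (GE j) * fgen (GE i), fgen (GE i)) \<in> bmw_rels n P"
    "1 \<le> i \<Longrightarrow> i < n \<Longrightarrow> (fgen (GE i) * fgen (GE i), fconst (par_A P 0) * fgen (GE i)) \<in> bmw_rels n P"
    "1 \<le> n \<Longrightarrow> (fgen GY ^ par_k P, \<Sum>i<par_k P. fconst (par_qs P i) * fgen GY ^ i) \<in> bmw_rels n P"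
    "2 \<le> n \<Longrightarrow> (fgen (GX 1) * fgen GY * fgen (GX 1) * fgen GY, fgen GY * fgen (GX 1) * fgen GY * fgen (GX 1)) \<in> bmw_rels n P"
    "1 < i \<Longrightarrow> i < n \<Longrightarrow> (fgen GY * fgen (GX i), fgen (GX i) * fgen GY) \<in> bmw_rels n P"
    "1 < i \<Longrightarrow> i < n \<Longrightarrow> (fgen GY * fgen (GE i), fgen (GE i) * fgen GY) \<in> bmw_rels n P"
    "2 \<le> n \<Longrightarrow> (fgen GY * fgen (GX 1) * fgen GY * fgen (GE 1), fconst (unit_inv (par_lam P)) * fgen (GE 1)) \<in> bmw_rels n P"
    "2 \<le> n \<Longrightarrow> (fconst (unit_inv (par_lam P)) * fgen (GE 1), fgen (GE 1) * fgen GY * fgen (GX 1) * fgen GY) \<in> bmw_rels n P"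
    "2 \<le> n \<Longrightarrow> m < par_k P \<Longrightarrow> (fgen (GE 1) * fgen GY ^ m * fgen (GE 1), fconst (par_A P m) * fgen (GE 1)) \<in> bmw_rels n P"
  unfolding bmw_rels_def Let_def
  \<comment> \<open>The unions associate to the left, so the last family of relations is outermost:
    either the membership is settled there, or this family is peeled off by
    \<open>UnI1\<close>.\<close>
  by (((rule UnI2)?, rule CollectI, (rule exI)+, rule conjI, rule refl, auto; fail) | (rule UnI2, simp; fail) | rule UnI1 | (simp; fail))+

locale bmw_lift =
  fixes n :: nat and P :: "'r::comm_ring_1 cyc_params"
  assumes n_pos: "1 \<le> n" and k_pos: "1 \<le> par_k P" and valid: "valid_params P"
begin

sublocale pres: presentation "bmw_gens n" "bmw_rels n P" by (rule bmw_presentation)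

abbreviation "B \<equiv> presented_alg (bmw_gens n) (bmw_rels n P)"
abbreviation "cls \<equiv> rel_class (bmw_gens n) (bmw_rels n P)"

lemma B_ring: "ring B" by (rule pres.B_ring)

text \<open>In the components other than \<open>B\<close>, an element is \<open>1\<close> or \<open>0\<close> according to the flag: units must
  be \<open>1\<close> there, and by the order relation of $Y$ no $q_i$ except $q_0$ can be \<open>1\<close>.\<close>

definition mk :: "(bmw_gen, 'r) free_alg \<Rightarrow> bool \<Rightarrow> ((bmw_gen, 'r) free_alg set, ('r, (bmw_gen, 'r) free_alg set, unit) module_ext) prodring" where
  "mk p u = mkp (\<lambda>R. if R = B then cls p else if u then \<one>\<^bsub>R\<^esub> else \<zero>\<^bsub>R\<^esub>)"

definition rep :: "((bmw_gen, 'r) free_alg set, ('r, (bmw_gen, 'r) free_alg set, unit) module_ext) prodring \<Rightarrow> (bmw_gen, 'r) free_alg \<Rightarrow> bool \<Rightarrow> bool" where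
  "rep x p u \<longleftrightarrow> p \<in> FA (bmw_gens n) \<and> cmp x B = cls p \<and> (\<forall>R. ring R \<longrightarrow> R \<noteq> B \<longrightarrow> cmp x R = (if u then \<one>\<^bsub>R\<^esub> else \<zero>\<^bsub>R\<^esub>))"

lemma rep_mk: "p \<in> FA (bmw_gens n) \<Longrightarrow> rep (mk p u) p u"
proof -
  assume p: "p \<in> FA (bmw_gens n)"
  have "ring R \<Longrightarrow> (if R = B then cls p else if u then \<one>\<^bsub>R\<^esub> else \<zero>\<^bsub>R\<^esub>) \<in> carrier R" for R
    using pres.cls_closed[OF p] by (auto intro: ring.ring_simprules)
  from cmp_mkp[OF this] show ?thesis using p B_ring by (auto simp: rep_def mk_def)
qed

lemma rep_eq: "rep x p u \<Longrightarrow> rep y q v \<Longrightarrow> u = v \<Longrightarrow> cls p = cls q \<Longrightarrow> x = y"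
  unfolding rep_def by (rule cmp_eqI) metis

lemma rep_mult: "rep x p u \<Longrightarrow> rep y q v \<Longrightarrow> rep (x * y) (p * q) (u \<and> v)"
  unfolding rep_def by (auto simp: cmp_simps B_ring pres.cls_mult FA_mult ring.ring_simprules monoid.r_one ring.is_monoid)

text \<open>Components outside \<open>B\<close> are described by 0 and 1 alone, so a sum can be
  described when at most one summand is 1 there.\<close>

lemma rep_add: "rep x p u \<Longrightarrow> rep y q v \<Longrightarrow> \<not> (u \<and> v) \<Longrightarrow> rep (x + y) (p + q) (u \<or> v)"
  unfolding rep_def by (auto simp: cmp_simps B_ring pres.cls_add FA_add ring.ring_simprules)

lemma rep_0: "rep 0 0 False" and rep_1: "rep 1 1 True"
  unfolding rep_def by (auto simp: cmp_simps B_ring pres.cls_0 pres.cls_1 FA_0 FA_1)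

lemma rep_diff: "rep x p u \<Longrightarrow> rep y q u \<Longrightarrow> rep (x - y) (p - q) False"
proof -
  assume x: "rep x p u" and y: "rep y q u"
  have p: "p \<in> FA (bmw_gens n)" "q \<in> FA (bmw_gens n)" using x y by (auto simp: rep_def)
  interpret Br: ring B by (rule B_ring)
  have "cls p = cls (p - q) \<oplus>\<^bsub>B\<^esub> cls q" using pres.cls_add[OF FA_diff[OF p] p(2)] by simp
  then have "cls p \<ominus>\<^bsub>B\<^esub> cls q = cls (p - q)"
    using pres.cls_closed[OF p(2)] pres.cls_closed[OF FA_diff[OF p]] by (simp add: a_minus_def Br.a_assoc Br.r_neg)
  then show ?thesis using x y p unfolding rep_def
    by (auto simp: cmp_simps B_ring FA_diff a_minus_def ring.ring_simprules)
qed

lemma rep_power: "rep x p True \<Longrightarrow> rep (x ^ m) (p ^ m) True"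
proof (induction m)
  case (Suc m) then show ?case using rep_mult[of x p True "x ^ m" "p ^ m" True] by simp
qed (simp add: rep_1)

lemma rep_sum: "finite I \<Longrightarrow> (\<And>i. i \<in> I \<Longrightarrow> rep (f i) (g i) False) \<Longrightarrow> rep (sum f I) (sum g I) False"
proof (induction I rule: finite_induct)
  case (insert a I) then show ?case using rep_add[of "f a" "g a" False "sum f I" "sum g I" False] by simp
qed (simp add: rep_0)

text \<open>Outside \<open>B\<close> only centrality is demanded, not a component 0 or 1:
  \<open>- 1\<close> must be a scalar, and its other components are in general neither. At
  \<open>B\<close> the scalar is the class of a constant, which is how coefficients in the ground
  ring are recovered later.\<close>

definition lscalars :: "((bmw_gen, 'r) free_alg set, ('r, (bmw_gen, 'r) free_alg set, unit) module_ext) prodring set" where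
  "lscalars = {z. (\<forall>x. z * x = x * z) \<and> (\<exists>c. cmp z B = cls (fconst c))}"

lemma rep_lscalars: "rep z (fconst c) u \<Longrightarrow> z \<in> lscalars"
proof -
  assume z: "rep z (fconst c) u"
  have "z * x = x * z" for x
  proof (rule cmp_eqI)
    fix R :: "('r, (bmw_gen, 'r) free_alg set) module" assume R: "ring R"
    interpret R: ring R by (rule R)
    show "cmp (z * x) R = cmp (x * z) R"
    proof (cases "R = B")
      case True
      obtain p where p: "p \<in> FA (bmw_gens n)" "cmp x B = cls p" using cmp_closed[OF B_ring, of x] pres.carrier_B by blast
      then show ?thesis using z True B_ring
        by (simp add: rep_def cmp_simps pres.cls_mult[symmetric] FA_fconst fconst_central)
    next
      case False
      then show ?thesis using z R cmp_closed[OF R, of x] by (simp add: rep_def cmp_simps)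
    qed
  qed
  then show ?thesis using z by (auto simp: lscalars_def rep_def)
qed

definition "lgen g = mk (fgen g) True"
definition "lconst c = mk (fconst c) True"

lemma rep_lgen: "g \<in> bmw_gens n \<Longrightarrow> rep (lgen g) (fgen g) True" and rep_lconst: "rep (lconst c) (fconst c) True"
  and rep_fconst: "rep (mk (fconst c) u) (fconst c) u"
  unfolding lgen_def lconst_def by (auto intro!: rep_mk FA_fgen FA_fconst)

lemma gens_mem: "GY \<in> bmw_gens n" "GYinv \<in> bmw_gens n" "1 \<le> i \<Longrightarrow> i < n \<Longrightarrow> GX i \<in> bmw_gens n"
    "1 \<le> i \<Longrightarrow> i < n \<Longrightarrow> GXinv i \<in> bmw_gens n" "1 \<le> i \<Longrightarrow> i < n \<Longrightarrow> GE i \<in> bmw_gens n"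
  using n_pos by (auto simp: bmw_gens_def)

lemma cls_rel: "(a, b) \<in> bmw_rels n P \<Longrightarrow> cls a = cls b"
  using pres.cls_eq pres.I_rel pres.rels_FA by metis

lemmas rep_gens = rep_lgen[OF gens_mem(1)] rep_lgen[OF gens_mem(2)] rep_lgen[OF gens_mem(3)] rep_lgen[OF gens_mem(4)] rep_lgen[OF gens_mem(5)]

lemma rep_mult_True: "rep x p True \<Longrightarrow> rep y q True \<Longrightarrow> rep (x * y) (p * q) True"
  using rep_mult[of x p True y q True] by simp

lemma rep_mult_False: "rep x p False \<Longrightarrow> rep y q v \<Longrightarrow> rep (x * y) (p * q) False"
  using rep_mult[of x p False y q v] by simp

lemma rep_eq': "rep x p u \<Longrightarrow> rep y q u \<Longrightarrow> cls p = cls q \<Longrightarrow> x = y"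
  by (erule (1) rep_eq) (rule refl)

lemmas rep_intros = rep_mult_True rep_diff rep_power rep_1 rep_lconst rep_gens

lemma bmw_ring_lift:
  "bmw_ring lscalars n (par_k P) (lgen GY) (lgen GYinv) (\<lambda>i. lgen (GX i)) (\<lambda>i. lgen (GXinv i)) (\<lambda>i. lgen (GE i))
    (mk (fconst (par_delta P)) False) (lconst (par_lam P)) (lconst (unit_inv (par_lam P))) (lconst (par_A P 0)) (lconst (unit_inv (par_A P 0)))
    (lconst (unit_inv (par_qs P 0))) (\<lambda>i. mk (fconst (par_qs P i)) (i = 0)) (\<lambda>i. lconst (par_A P i))"
proof (unfold_locales, goal_cases)
  case (1 z x) then show ?case by (simp add: lscalars_def)
next
  case 2 show ?case using rep_lscalars[of 1 1 True] rep_1 by simp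
next
  case 3
  interpret Br: ring B by (rule B_ring)
  have "cls (fconst (- 1)) \<oplus>\<^bsub>B\<^esub> cls 1 = \<zero>\<^bsub>B\<^esub>"
    using pres.cls_add[OF FA_fconst[of "- 1"] FA_1] fconst_add[of "- 1" 1, symmetric] pres.cls_0
    by (metis add.left_inverse fconst_0 fconst_1)
  then have "\<ominus>\<^bsub>B\<^esub> cls 1 = cls (fconst (- 1))"
    by (intro Br.minus_equality) (simp_all add: pres.cls_closed FA_1 FA_fconst)
  then have "cmp (- 1) B = cls (fconst (- 1))" using B_ring pres.cls_1 by (simp add: cmp_simps)
  then show ?case by (auto simp: lscalars_def)
next
  case 4 show ?case using rep_lscalars[of 0 0 False] rep_0 by simp
next
  case 14
  have "cls (fconst (par_lam P) * fconst (unit_inv (par_lam P))) = cls 1"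
    using unit_inv[of "par_lam P"] valid by (simp add: fconst_mult[symmetric] valid_params_def)
  from rep_eq[OF rep_mult[OF rep_lconst rep_lconst] rep_1 _ this] show ?case by simp
next
  case 15
  have "cls (fconst (par_A P 0) * fconst (unit_inv (par_A P 0))) = cls 1"
    using unit_inv[of "par_A P 0"] valid by (simp add: fconst_mult[symmetric] valid_params_def)
  from rep_eq[OF rep_mult[OF rep_lconst rep_lconst] rep_1 _ this] show ?case by simp
next
  case 16
  have "cls (fconst (par_qs P 0) * fconst (unit_inv (par_qs P 0))) = cls 1"
    using unit_inv[of "par_qs P 0"] valid by (simp add: fconst_mult[symmetric] valid_params_def)
  from rep_eq[OF rep_mult[OF rep_fconst[of _ "0 = 0"] rep_lconst] rep_1 _ this] show ?case by simp
next
  case 17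
  then show ?case by (intro rep_eq'[OF _ _ cls_rel[OF bmw_relI(1)], where u = True] rep_intros) simp_all
next
  case 18
  then show ?case by (intro rep_eq'[OF _ _ cls_rel[OF bmw_relI(2)], where u = True] rep_intros) simp_all
next
  case (19 i)
  then show ?case by (intro rep_eq'[OF _ _ cls_rel[OF bmw_relI(3)[of i]], where u = True] rep_intros) simp_all
next
  case (20 i)
  then show ?case by (intro rep_eq'[OF _ _ cls_rel[OF bmw_relI(4)[of i]], where u = True] rep_intros) simp_all
next
  case (21 i)
  have "rep (lgen (GX i) - lgen (GXinv i)) (fgen (GX i) - fgen (GXinv i)) False"
    using 21 by (intro rep_diff[OF rep_gens(3) rep_gens(4)])
  moreover have "rep (mk (fconst (par_delta P)) False * (1 - lgen (GE i))) (fconst (par_delta P) * (1 - fgen (GE i))) False"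
    using 21 by (intro rep_mult_False[OF rep_fconst rep_diff[OF rep_1 rep_gens(5)]])
  ultimately show ?case using 21 by (rule rep_eq'[OF _ _ cls_rel[OF bmw_relI(5)]])
next
  case (22 i j)
  then show ?case
  proof (intro conjI)
    show "lgen (GX i) * lgen (GX j) = lgen (GX j) * lgen (GX i)"
      by (intro rep_eq'[OF _ _ cls_rel[OF bmw_relI(6)[of i n j]], where u = True] rep_intros) (use 22 in simp_all)
    show "lgen (GX i) * lgen (GE j) = lgen (GE j) * lgen (GX i)"
      by (intro rep_eq'[OF _ _ cls_rel[OF bmw_relI(7)[of i n j]], where u = True] rep_intros) (use 22 in simp_all)
    show "lgen (GE i) * lgen (GE j) = lgen (GE j) * lgen (GE i)"
      by (intro rep_eq'[OF _ _ cls_rel[OF bmw_relI(8)[of i n j]], where u = True] rep_intros) (use 22 in simp_all)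
  qed
next
  case (23 i)
  then show ?case by (intro rep_eq'[OF _ _ cls_rel[OF bmw_relI(9)[of i]], where u = True] rep_intros) simp_all
next
  case (24 i)
  then show ?case by (intro rep_eq'[OF _ _ cls_rel[OF bmw_relI(10)[of i]], where u = True] rep_intros) simp_all
next
  case (25 i)
  then show ?case by (intro rep_eq'[OF _ _ cls_rel[OF bmw_relI(11)[of i]], where u = True] rep_intros) simp_all
next
  case (26 i j)
  then show ?case
  proof (intro conjI)
    show "lgen (GX i) * lgen (GX j) * lgen (GE i) = lgen (GE j) * lgen (GE i)"
      by (intro rep_eq'[OF _ _ cls_rel[OF bmw_relI(12)[of i n j]], where u = True] rep_intros) (use 26 in simp_all)
    show "lgen (GE j) * lgen (GX i) * lgen (GX j) = lgen (GE j) * lgen (GE i)"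
      by (intro rep_eq'[OF _ _ cls_rel[OF bmw_relI(13)[of i n j], symmetric], where u = True] rep_intros) (use 26 in simp_all)
    show "lgen (GE i) * lgen (GE j) * lgen (GE i) = lgen (GE i)"
      by (intro rep_eq'[OF _ _ cls_rel[OF bmw_relI(14)[of i n j]], where u = True] rep_intros) (use 26 in simp_all)
  qed
next
  case (27 i)
  then show ?case by (intro rep_eq'[OF _ _ cls_rel[OF bmw_relI(15)[of i]], where u = True] rep_intros) simp_all
next
  case 28
  let ?f = "\<lambda>i. mk (fconst (par_qs P i)) (i = 0) * lgen GY ^ i" and ?g = "\<lambda>i. fconst (par_qs P i) * fgen GY ^ i"
  have k: "{..<par_k P} = insert 0 {1..<par_k P}" using k_pos by auto
  have 1: "rep (?f i) (?g i) False" if "i \<in> {1..<par_k P}" for i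
    using rep_mult[OF rep_fconst[of "par_qs P i" "i = 0"] rep_power[OF rep_gens(1), of i]] that by simp
  have "rep (?f 0 + sum ?f {1..<par_k P}) (?g 0 + sum ?g {1..<par_k P}) (True \<or> False)"
  proof (rule rep_add)
    show "rep (?f 0) (?g 0) True"
      using rep_mult[OF rep_fconst[of "par_qs P 0" "0 = 0"] rep_power[OF rep_gens(1), of 0]] by simp
  qed (use rep_sum[of "{1..<par_k P}" ?f ?g] 1 in auto)
  then have "rep (sum ?f {..<par_k P}) (sum ?g {..<par_k P}) True" unfolding k by simp
  from rep_eq[OF rep_power[OF rep_gens(1)] this _ cls_rel[OF bmw_relI(16)]] show ?case using n_pos by simp
next
  case 29
  then show ?case by (intro rep_eq'[OF _ _ cls_rel[OF bmw_relI(17)], where u = True] rep_intros) simp_all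
next
  case (30 i)
  then show ?case by (intro rep_eq'[OF _ _ cls_rel[OF bmw_relI(18)[of i]], where u = True] rep_intros) simp_all
next
  case (31 i)
  then show ?case by (intro rep_eq'[OF _ _ cls_rel[OF bmw_relI(19)[of i]], where u = True] rep_intros) simp_all
next
  case 32
  then show ?case by (intro rep_eq'[OF _ _ cls_rel[OF bmw_relI(20)], where u = True] rep_intros) simp_all
next
  case 33
  then show ?case by (intro rep_eq'[OF _ _ cls_rel[OF bmw_relI(21), symmetric], where u = True] rep_intros) simp_all
next
  case (34 m)
  then show ?case by (intro rep_eq'[OF _ _ cls_rel[OF bmw_relI(22)[of n m]], where u = True] rep_intros) simp_all
qed (use k_pos in \<open>auto intro: rep_lscalars[OF rep_lconst] rep_lscalars[OF rep_fconst]\<close>)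

end

lemma bmw_gens_mono: "l \<le> n \<Longrightarrow> bmw_gens l \<subseteq> bmw_gens n"
  by (auto simp: bmw_gens_def)

lemma bmw_rels_mono: "l \<le> n \<Longrightarrow> bmw_rels l P \<subseteq> bmw_rels n P"
  unfolding bmw_rels_def Let_def by (intro Un_mono; fastforce split: if_splits)

lemma ak_presentation: "presentation (ak_gens l) (ak_rels l P)"
proof (unfold_locales)
  fix a b assume "(a, b) \<in> ak_rels l P"
  moreover have "\<And>i. i < l \<Longrightarrow> fgen (GT i) \<in> FA (ak_gens l)" "\<And>i. i < l \<Longrightarrow> fgen (GTinv i) \<in> FA (ak_gens l)"
    by (auto simp: ak_gens_def intro!: FA_fgen)
  ultimately show "a \<in> FA (ak_gens l) \<and> b \<in> FA (ak_gens l)"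
    unfolding ak_rels_def Let_def
    by (elim UnE; auto split: if_splits intro!: FA_add FA_mult FA_diff FA_power FA_sum FA_1 FA_fconst)
qed

lemma fgen_pull: "fgen g * (fconst c * y) = fconst c * (fgen g * y)"
  using fconst_central[of c "fgen g"] by (simp add: mult.assoc[symmetric])

lemma fgen_pull': "fgen g * fconst c = fconst c * fgen g"
  using fconst_central[of c "fgen g"] by simp

lemma fconst_merge: "fconst a * (fconst b * y) = fconst (a * b) * y"
  by (simp add: fconst_mult mult.assoc)

lemmas scalar_norm = mult.assoc fgen_pull fgen_pull' fconst_merge

lemma (in presentation) I_word: "(a, b) \<in> rels \<Longrightarrow> fconst c * a - fconst c * b \<in> I"
  using I_l[OF FA_fconst I_rel, of a b c] by (simp add: right_diff_distrib)

section \<open>The Ariki-Koike quotient\<close>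

locale ak_setup =
  fixes l :: nat and P :: "'r::comm_ring_1 cyc_params" and q qi :: 'r
  assumes q: "q = par_q P" and qi: "qi = unit_inv q" and qqi: "q * qi = 1"
begin

sublocale A: presentation "ak_gens l" "ak_rels l P" by (rule ak_presentation)

lemma qiq: "qi * q = 1" using qqi by (simp add: mult.commute)

lemma delta: "par_delta P = q - qi" by (simp add: par_delta_def q qi)

lemma T_FA: "i < l \<Longrightarrow> fgen (GT i) \<in> FA (ak_gens l)" "i < l \<Longrightarrow> fgen (GTinv i) \<in> FA (ak_gens l)"
  by (auto simp: ak_gens_def intro!: FA_fgen)

lemma ak_rel:
  "i < l \<Longrightarrow> (fgen (GT i) * fgen (GTinv i), 1) \<in> ak_rels l P"
    "i < l \<Longrightarrow> (fgen (GTinv i) * fgen (GT i), 1) \<in> ak_rels l P"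
    "2 \<le> l \<Longrightarrow> (fgen (GT 0) * fgen (GT 1) * fgen (GT 0) * fgen (GT 1), fgen (GT 1) * fgen (GT 0) * fgen (GT 1) * fgen (GT 0)) \<in> ak_rels l P"
    "1 \<le> i \<Longrightarrow> i + 2 \<le> l \<Longrightarrow> (fgen (GT i) * fgen (GT (i + 1)) * fgen (GT i), fgen (GT (i + 1)) * fgen (GT i) * fgen (GT (i + 1))) \<in> ak_rels l P"
    "i < l \<Longrightarrow> j < l \<Longrightarrow> i + 2 \<le> j \<or> j + 2 \<le> i \<Longrightarrow> (fgen (GT i) * fgen (GT j), fgen (GT j) * fgen (GT i)) \<in> ak_rels l P"
    "1 \<le> l \<Longrightarrow> (fgen (GT 0) ^ par_k P, \<Sum>i<par_k P. fconst (par_qs P i) * fgen (GT 0) ^ i) \<in> ak_rels l P"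
    "1 \<le> i \<Longrightarrow> i < l \<Longrightarrow> (fgen (GT i) ^ 2, fconst (q ^ 2 - 1) * fgen (GT i) + fconst (q ^ 2)) \<in> ak_rels l P"
  unfolding ak_rels_def Let_def q
  by (((rule UnI2)?, rule CollectI, (rule exI)+, rule conjI, rule refl, auto; fail) | (rule UnI2, simp; fail) | rule UnI1 | (simp; fail))+

text \<open>This is the quadratic relation multiplied by the inverse of \<open>T i\<close> and
  scaled by the inverse of \<open>q\<close>; it is the skein relation with the cap set to 0.\<close>

lemma ak_skein:
  assumes i: "1 \<le> i" "i < l"
  shows "fconst qi * fgen (GT i) - fconst q * fgen (GTinv i) - fconst (par_delta P) \<in> rel_ideal (ak_gens l) (ak_rels l P)"
proof -
  let ?T = "fgen (GT i) :: (ak_gen, 'r) free_alg" and ?T' = "fgen (GTinv i) :: (ak_gen, 'r) free_alg"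
  have 1: "?T ^ 2 - (fconst (q ^ 2 - 1) * ?T + fconst (q ^ 2)) \<in> A.I" using A.I_rel[OF ak_rel(7)] i by simp
  have 2: "?T' * ?T - 1 \<in> A.I" using A.I_rel[OF ak_rel(2)] i by simp
  have eq: "fconst qi * ?T - fconst q * ?T' - fconst (par_delta P) =
     fconst qi * (?T' * (?T ^ 2 - (fconst (q ^ 2 - 1) * ?T + fconst (q ^ 2))) - (?T' * ?T - 1) * ?T + fconst (q ^ 2 - 1) * (?T' * ?T - 1))"
  proof -
    have c: "qi * (q ^ 2) = q" "qi * (q ^ 2 - 1) = q - qi"
      using qiq by (simp_all add: power2_eq_square right_diff_distrib mult.assoc[symmetric])
    have "?T' * (?T ^ 2 - (fconst (q ^ 2 - 1) * ?T + fconst (q ^ 2))) - (?T' * ?T - 1) * ?T + fconst (q ^ 2 - 1) * (?T' * ?T - 1)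
       = ?T - fconst (q ^ 2) * ?T' - fconst (q ^ 2 - 1)"
      by (simp add: power2_eq_square[of ?T] right_diff_distrib left_diff_distrib distrib_left fgen_pull fgen_pull' mult.assoc)
    then show ?thesis
      by (simp only:) (simp add: right_diff_distrib fconst_merge c delta fconst_mult[symmetric])
  qed
  show ?thesis unfolding eq
    by (rule A.I_l[OF FA_fconst], rule A.I_add[OF A.I_diff[OF A.I_l[OF T_FA(2)[OF i(2)] 1] A.I_r[OF 2 T_FA(1)[OF i(2)]]] A.I_l[OF FA_fconst 2]])
qed

text \<open>A relation among crossings is homogeneous, so the substitution multiplies it by a power
  of \<open>qi\<close>. The order relation is kept, the skein relation is \<open>ak_skein\<close>,
  and the remaining relations involving caps become \<open>0 = 0\<close>.\<close>

lemma ak_image_rels: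
  assumes "(a, b) \<in> bmw_rels l P"
  shows "subst_gens (ak_image P) (a - b) \<in> rel_ideal (ak_gens l) (ak_rels l P)"
proof -
  note ig = q[symmetric] qi[symmetric]
  note ss = subst_diff subst_mult subst_power subst_sum ig
  have inv: "fconst qi * fgen g * (fconst q * fgen h) = fgen g * (fgen h :: (ak_gen, 'r) free_alg)"
    "fconst q * fgen g * (fconst qi * fgen h) = fgen g * (fgen h :: (ak_gen, 'r) free_alg)" for g h
    by (simp_all add: scalar_norm qqi qiq)
  show ?thesis
    using assms unfolding bmw_rels_def Let_def
    apply (elim UnE)
    subgoal by (auto simp: ss A.I_rel ak_rel split: if_splits)
    subgoal by (auto simp: ss A.I_rel ak_rel inv)
    subgoal by (auto simp: ss A.I_rel ak_rel inv)
    subgoal using ak_skein by (auto simp: ss)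
    subgoal using A.I_word[OF ak_rel(5), of _ _ "qi * qi"] by (auto simp: ss scalar_norm)
    subgoal by (auto simp: ss A.I_0)
    subgoal by (auto simp: ss A.I_0)
    subgoal using A.I_word[OF ak_rel(4), of _ "qi * (qi * qi)"] by (auto simp: ss scalar_norm)
    subgoal by (auto simp: ss A.I_0)
    subgoal by (auto simp: ss A.I_0)
    subgoal by (auto simp: ss A.I_0)
    subgoal by (auto simp: ss A.I_0)
    subgoal by (auto simp: ss A.I_0)
    subgoal by (auto simp: ss A.I_0)
    subgoal using A.I_rel[OF ak_rel(6)] by (auto simp: ss split: if_splits)
    subgoal using A.I_uminus[OF A.I_word[OF ak_rel(3), of "qi * qi"]] by (auto simp: ss scalar_norm split: if_splits)
    subgoal using A.I_word[OF ak_rel(5), of 0 _ qi] by (auto simp: ss scalar_norm)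
    subgoal by (auto simp: ss A.I_0)
    subgoal by (auto simp: ss A.I_0 split: if_splits)
    subgoal by (auto simp: ss A.I_0)
    done
qed

lemma ak_image_FA: "g \<in> bmw_gens l \<Longrightarrow> ak_image P g \<in> FA (ak_gens l)"
  by (auto simp: bmw_gens_def split: if_splits intro!: FA_mult FA_fconst T_FA FA_0)

lemma ak_proj_cls:
  assumes "p \<in> FA (bmw_gens l)"
  shows "ak_proj l P (rel_class (bmw_gens l) (bmw_rels l P) p) = rel_class (ak_gens l) (ak_rels l P) (subst_gens (ak_image P) p)"
proof -
  interpret Bl: presentation "bmw_gens l" "bmw_rels l P" by (rule bmw_presentation)
  show ?thesis unfolding ak_proj_def
    by (rule Bl.induced[OF assms ak_image_FA ak_presentation])
       (auto intro: Bl.subst_ideal[OF ak_image_FA A.I.ideal_axioms ak_image_rels])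
qed

text \<open>A section of $\pi_l$ modulo the ideal generated by the $e_i$, which is therefore the kernel of $\pi_l$.\<close>

fun ak_section :: "ak_gen \<Rightarrow> (bmw_gen, 'r) free_alg" where
  "ak_section (GT i) = (if i = 0 then fgen GY else fconst q * fgen (GX i))"
| "ak_section (GTinv i) = (if i = 0 then fgen GYinv else fconst qi * fgen (GXinv i))"

lemma ak_section_FA: "g \<in> ak_gens l \<Longrightarrow> ak_section g \<in> FA (bmw_gens l)"
  by (auto simp: ak_gens_def bmw_gens_def split: if_splits intro!: FA_mult FA_fconst FA_fgen)

lemma ak_section_rels:
  assumes J: "ideal J (free_alg_on (bmw_gens l))" and Jr: "\<And>a b. (a, b) \<in> bmw_rels l P \<Longrightarrow> a - b \<in> J"
    and Je: "\<And>i. 1 \<le> i \<Longrightarrow> i < l \<Longrightarrow> fgen (GE i) \<in> J"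
    and ab: "(a, b) \<in> ak_rels l P"
  shows "subst_gens ak_section (a - b) \<in> J"
proof -
  note J0 = FA_idealD(1)[OF J] and Ja = FA_idealD(2)[OF J] and Jl = FA_idealD(3)[OF J] and Jm = FA_idealD(5)[OF J]
  have Jc: "r \<in> J \<Longrightarrow> fconst c * r \<in> J" for c r by (rule Jl[OF FA_fconst])
  have Jw: "(a, b) \<in> bmw_rels l P \<Longrightarrow> fconst c * a - fconst c * b \<in> J" for a b c
    using Jc[OF Jr, of a b c] by (simp add: right_diff_distrib)
  have Jw': "(a, b) \<in> bmw_rels l P \<Longrightarrow> fconst c * b - fconst c * a \<in> J" for a b c
    using Jm[OF J0 Jw, of a b c] by simp
  note ss = subst_diff subst_add subst_mult subst_power subst_sum
  have inv: "fconst qi * fgen g * (fconst q * fgen h) = fgen g * (fgen h :: (bmw_gen, 'r) free_alg)"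
    "fconst q * fgen g * (fconst qi * fgen h) = fgen g * (fgen h :: (bmw_gen, 'r) free_alg)" for g h
    by (simp_all add: scalar_norm qqi qiq)
  have X: "i < l \<Longrightarrow> i \<noteq> 0 \<Longrightarrow> fgen (GX i) \<in> FA (bmw_gens l)" for i by (auto simp: bmw_gens_def intro!: FA_fgen)
  \<comment> \<open>With caps in \<open>J\<close> the skein relation says that X minus its inverse
    is q minus its inverse. Multiplying by q^2 X and writing T for q X gives T^2 - q^2 = (q^2 - 1)
    T.\<close>
  have quad: "(fconst q * fgen (GX i)) ^ 2 - (fconst (q ^ 2 - 1) * (fconst q * fgen (GX i)) + fconst (q ^ 2)) \<in> J"
    if i: "1 \<le> i" "i < l" for i
  proof -
    let ?X = "fgen (GX i) :: (bmw_gen, 'r) free_alg" and ?X' = "fgen (GXinv i) :: (bmw_gen, 'r) free_alg" and ?e = "fgen (GE i) :: (bmw_gen, 'r) free_alg"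
    have "q ^ 2 * par_delta P = (q ^ 2 - 1) * q"
      using qqi by (simp add: delta power2_eq_square right_diff_distrib left_diff_distrib mult.assoc)
    then have "(fconst q * ?X) ^ 2 - (fconst (q ^ 2 - 1) * (fconst q * ?X) + fconst (q ^ 2)) =
      fconst (q ^ 2) * (?X * (?X - ?X' - fconst (par_delta P) * (1 - ?e))) + fconst (q ^ 2) * (?X * ?X' - 1) - fconst (q ^ 2 * par_delta P) * (?X * ?e)"
      by (simp add: power2_eq_square[of "fconst q * ?X"] power2_eq_square[of q] right_diff_distrib scalar_norm)
    moreover have s: "?X - ?X' - fconst (par_delta P) * (1 - ?e) \<in> J" "?X * ?X' - 1 \<in> J"
      using Jr[OF bmw_relI(5)[OF i]] Jr[OF bmw_relI(3)[OF i]] by auto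
    have XF: "?X \<in> FA (bmw_gens l)" using X[of i] i by simp
    have "fconst (q ^ 2) * (?X * (?X - ?X' - fconst (par_delta P) * (1 - ?e))) + fconst (q ^ 2) * (?X * ?X' - 1) - fconst (q ^ 2 * par_delta P) * (?X * ?e) \<in> J"
      by (rule Jm[OF Ja[OF Jc[OF Jl[OF XF s(1)]] Jc[OF s(2)]] Jc[OF Jl[OF XF Je[OF i]]]])
    ultimately show ?thesis by simp
  qed
  show ?thesis
    using ab unfolding ak_rels_def Let_def
    apply (elim UnE)
    subgoal using Jr[OF bmw_relI(1)] Jr[OF bmw_relI(3)] by (auto simp: ss inv)
    subgoal using Jr[OF bmw_relI(2)] Jr[OF bmw_relI(4)] by (auto simp: ss inv)
    subgoal using Jw'[OF bmw_relI(17), of "q * q"] by (auto simp: ss scalar_norm split: if_splits)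
    subgoal using Jw[OF bmw_relI(9), of _ "q * (q * q)"] by (auto simp: ss scalar_norm)
    subgoal using Jw[OF bmw_relI(6), of _ _ "q * q"] Jw[OF bmw_relI(18), of _ q] Jw'[OF bmw_relI(18), of _ q] by (auto simp: ss scalar_norm)
    subgoal using Jr[OF bmw_relI(16)] by (auto simp: ss split: if_splits)
    subgoal using quad by (auto simp: ss q[symmetric])
    done
qed

text \<open>Modulo \<open>J\<close>, substituting with \<open>ak_image\<close> and then
  \<open>ak_section\<close> is the identity, since this holds on generators; and
  \<open>ak_section\<close> carries relations into \<open>J\<close>. The ideal is left arbitrary so
  that it can be \<open>e_preimage\<close>, where membership is decided in the algebra on
  \<open>n\<close> strands.\<close>

lemma ak_kernel:
  assumes J: "ideal J (free_alg_on (bmw_gens l))" and Jr: "\<And>a b. (a, b) \<in> bmw_rels l P \<Longrightarrow> a - b \<in> J"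
    and Je: "\<And>i. 1 \<le> i \<Longrightarrow> i < l \<Longrightarrow> fgen (GE i) \<in> J"
    and p: "p \<in> FA (bmw_gens l)" "subst_gens (ak_image P) p \<in> rel_ideal (ak_gens l) (ak_rels l P)"
  shows "p \<in> J"
proof -
  note J0 = FA_idealD(1)[OF J] and Ja = FA_idealD(2)[OF J] and Jl = FA_idealD(3)[OF J] and Jrr = FA_idealD(4)[OF J]
  note ig = q[symmetric] qi[symmetric]
  let ?b = "\<lambda>p. subst_gens ak_section (subst_gens (ak_image P) p)"
  have bF: "?b p \<in> FA (bmw_gens l)" if "p \<in> FA (bmw_gens l)" for p
    by (rule subst_FA[OF subst_FA[OF that ak_image_FA] ak_section_FA])
  have "p - ?b p \<in> J"
    using p(1)
  proof (induction rule: FA_induct)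
    case (const c) then show ?case using J0 by simp
  next
    case (gen g)
    have "?b (fgen g) = fgen g" if "\<And>i. g \<noteq> GE i"
      using gen that by (cases g) (auto simp: bmw_gens_def subst_mult ig fconst_merge qqi qiq split: if_splits)
    moreover have "fgen (GE i) - ?b (fgen (GE i)) \<in> J" if "g = GE i" for i
      using Je[of i] gen that by (auto simp: bmw_gens_def split: if_splits)
    ultimately show ?case using J0 by (cases "\<exists>i. g = GE i") auto
  next
    case (add p r)
    then show ?case using Ja[of "p - ?b p" "r - ?b r"] by (simp add: subst_add algebra_simps)
  next
    case (mult p r)
    have "p * r - ?b (p * r) = (p - ?b p) * r + ?b p * (r - ?b r)"
      by (simp add: subst_mult left_diff_distrib right_diff_distrib)
    then show ?case using Ja[OF Jrr[OF mult(2,3)] Jl[OF bF[OF mult(1)] mult(4)]] by simp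
  qed
  moreover have "?b p \<in> J"
    by (rule A.subst_ideal[OF ak_section_FA J _ p(2)], assumption) (rule ak_section_rels[OF J Jr Je])
  ultimately have "p - ?b p + ?b p \<in> J" by (rule Ja)
  then show ?thesis by simp
qed

end

section \<open>Transfer between the presented algebra and the product ring\<close>

context bmw_lift
begin

sublocale L: bmw_ring lscalars n "par_k P" "lgen GY" "lgen GYinv" "\<lambda>i. lgen (GX i)" "\<lambda>i. lgen (GXinv i)" "\<lambda>i. lgen (GE i)"
    "mk (fconst (par_delta P)) False" "lconst (par_lam P)" "lconst (unit_inv (par_lam P))" "lconst (par_A P 0)" "lconst (unit_inv (par_A P 0))"
    "lconst (unit_inv (par_qs P 0))" "\<lambda>i. mk (fconst (par_qs P i)) (i = 0)" "\<lambda>i. lconst (par_A P i)"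
  by (rule bmw_ring_lift)

lemma cmp_rep: "rep x p u \<Longrightarrow> cmp x B = cls p" by (simp add: rep_def)

lemma FA_n: "p \<in> FA (bmw_gens l) \<Longrightarrow> l \<le> n \<Longrightarrow> p \<in> FA (bmw_gens n)"
  using FA_mono bmw_gens_mono by blast

lemma cmp_cls_mult: "cmp x B = cls p \<Longrightarrow> cmp y B = cls r \<Longrightarrow> p \<in> FA (bmw_gens n) \<Longrightarrow> r \<in> FA (bmw_gens n) \<Longrightarrow> cmp (x * y) B = cls (p * r)"
  and cmp_cls_add: "cmp x B = cls p \<Longrightarrow> cmp y B = cls r \<Longrightarrow> p \<in> FA (bmw_gens n) \<Longrightarrow> r \<in> FA (bmw_gens n) \<Longrightarrow> cmp (x + y) B = cls (p + r)"
  using B_ring by (simp_all add: cmp_simps pres.cls_mult pres.cls_add)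

lemma H_FA:
  assumes "l \<le> n" "x \<in> L.H l" shows "\<exists>p\<in>FA (bmw_gens l). cmp x B = cls p"
  using assms(2) unfolding L.H_def
proof (induction rule: algen.induct)
  case (algen_scalar z)
  then show ?case using FA_fconst by (auto simp: lscalars_def)
next
  case (algen_gen x)
  have "L.gens l \<subseteq> lgen ` bmw_gens l" unfolding L.gens_def bmw_gens_def image_Un image_image by auto
  then obtain g where g: "g \<in> bmw_gens l" "x = lgen g" using algen_gen by blast
  then have "g \<in> bmw_gens n" using bmw_gens_mono[OF assms(1)] by blast
  then show ?case using cmp_rep[OF rep_lgen] FA_fgen[OF g(1)] g(2) by blast
next
  case (algen_add x y)
  then show ?case using cmp_cls_add FA_n[OF _ assms(1)] FA_add by metis
next
  case (algen_mult x y)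
  then show ?case using cmp_cls_mult FA_n[OF _ assms(1)] FA_mult by metis
qed

lemma FA_H:
  assumes "l \<le> n" "p \<in> FA (bmw_gens l)" shows "\<exists>x\<in>L.H l. cmp x B = cls p"
  using assms(2)
proof (induction rule: FA_induct)
  case (const c)
  show ?case using cmp_rep[OF rep_lconst[of c]] L.H_ring(5)[OF rep_lscalars[OF rep_lconst[of c]]] by blast
next
  case (gen g)
  then have "g \<in> bmw_gens n" using bmw_gens_mono[OF assms(1)] by blast
  moreover have "lgen g \<in> L.H l" using gen by (auto simp: bmw_gens_def intro: L.H_gen split: if_splits)
  ultimately show ?case using cmp_rep[OF rep_lgen] by blast
next
  case (add p r)
  then obtain x y where "x \<in> L.H l" "cmp x B = cls p" "y \<in> L.H l" "cmp y B = cls r" by blast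
  then show ?case using cmp_cls_add[OF _ _ FA_n[OF add(1) assms(1)] FA_n[OF add(2) assms(1)]] L.H_ring(4) by blast
next
  case (mult p r)
  then obtain x y where "x \<in> L.H l" "cmp x B = cls p" "y \<in> L.H l" "cmp y B = cls r" by blast
  then show ?case using cmp_cls_mult[OF _ _ FA_n[OF mult(1) assms(1)] FA_n[OF mult(2) assms(1)]] L.H_ring(3) by blast
qed

lemma cmp_sum: "finite F \<Longrightarrow> (\<And>i. i \<in> F \<Longrightarrow> cmp (f i) B = cls (g i) \<and> g i \<in> FA (bmw_gens n)) \<Longrightarrow> cmp (sum f F) B = cls (sum g F)"
proof (induction F rule: finite_induct)
  case empty then show ?case using cmp_rep[OF rep_0] by simp
next
  case (insert a F)
  then show ?case using cmp_cls_add[of "f a" "g a" "sum f F" "sum g F"] FA_sum[of F g "bmw_gens n"] by simp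
qed

text \<open>The central idempotent that is 1 at \<open>B\<close> and 0 elsewhere. Multiplied by it,
  elements that agree at \<open>B\<close> become equal, whatever their other components are
  (\<open>eps_eq\<close>).\<close>

definition "eps = mk 1 False"

lemma rep_eps: "rep eps 1 False" unfolding eps_def by (rule rep_mk) (rule FA_1)

lemma eps_lscalars: "eps \<in> lscalars" using rep_lscalars[of eps 1 False] rep_eps by simp

lemma eps_idem: "eps * eps = eps" using rep_eq'[OF rep_mult_False[OF rep_eps rep_eps] rep_eps] by simp

lemma eps_eq: "cmp x B = cmp y B \<Longrightarrow> eps * x = eps * y"
proof (rule cmp_eqI)
  fix R :: "('r, (bmw_gen, 'r) free_alg set) module" assume "cmp x B = cmp y B" and R: "ring R"
  interpret ring R by (rule R)
  show "cmp (eps * x) R = cmp (eps * y) R"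
    using \<open>cmp x B = cmp y B\<close> rep_eps R cmp_closed[OF R] by (cases "R = B") (auto simp: cmp_simps rep_def)
qed

lemma incl_cls:
  assumes "l \<le> n" "p \<in> FA (bmw_gens l)"
  shows "bmw_incl n P (rel_class (bmw_gens l) (bmw_rels l P) p) = cls p"
proof -
  interpret Bl: presentation "bmw_gens l" "bmw_rels l P" by (rule bmw_presentation)
  have g: "fgen g \<in> FA (bmw_gens n)" if "g \<in> bmw_gens l" for g
    using that bmw_gens_mono[OF assms(1)] by (auto intro: FA_fgen)
  have "bmw_incl n P (rel_class (bmw_gens l) (bmw_rels l P) p) = cls (subst_gens fgen p)"
    unfolding bmw_incl_def
  proof (rule Bl.induced[OF assms(2) g bmw_presentation])
    fix r assume "r \<in> Bl.I"
    show "subst_gens fgen r \<in> pres.I"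
    proof (rule Bl.subst_ideal[OF g pres.I.ideal_axioms _ \<open>r \<in> Bl.I\<close>])
      fix a b assume "(a, b) \<in> bmw_rels l P"
      then show "subst_gens fgen (a - b) \<in> pres.I"
        unfolding subst_id using bmw_rels_mono[OF assms(1), of P] pres.I_rel by blast
    qed
  qed
  then show ?thesis by (simp add: subst_id)
qed

definition "e_span l = {u * lgen (GE a) * v | u a v. u \<in> L.H l \<and> v \<in> L.H l \<and> 1 \<le> a \<and> a < l}"

text \<open>The polynomials on \<open>l\<close> strands whose class on \<open>n\<close> strands lies
  in the image of the ideal generated by the caps. The conclusion is needed only after the passage
  to \<open>n\<close> strands, so no injectivity of the map between the two algebras enters.\<close>

definition "e_preimage l = {p \<in> FA (bmw_gens l). \<exists>d\<in>L.zs (e_span l). cls p = cmp d B}"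

lemma e_preimage:
  assumes l: "l \<le> n"
  shows "ideal (e_preimage l) (free_alg_on (bmw_gens l))"
    "(a, b) \<in> bmw_rels l P \<Longrightarrow> a - b \<in> e_preimage l" "1 \<le> i \<Longrightarrow> i < l \<Longrightarrow> fgen (GE i) \<in> e_preimage l"
proof -
  interpret Bl: presentation "bmw_gens l" "bmw_rels l P" by (rule bmw_presentation)
  have 0: "cls 0 = cmp 0 B" using cmp_rep[OF rep_0] by simp
  show "ideal (e_preimage l) (free_alg_on (bmw_gens l))"
  proof (rule FA_idealI)
    show "0 \<in> e_preimage l" unfolding e_preimage_def using FA_0 zspan_zero 0 by blast
  next
    fix a b assume "a \<in> e_preimage l" "b \<in> e_preimage l"
    then obtain d d' where *: "a \<in> FA (bmw_gens l)" "d \<in> L.zs (e_span l)" "cls a = cmp d B"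
      "b \<in> FA (bmw_gens l)" "d' \<in> L.zs (e_span l)" "cls b = cmp d' B" by (auto simp: e_preimage_def)
    then have "cls (a + b) = cmp (d + d') B" using cmp_cls_add FA_n[OF _ l] by metis
    then show "a + b \<in> e_preimage l" unfolding e_preimage_def using * FA_add zspan_add by blast
  next
    fix a p :: "(bmw_gen, 'r) free_alg" assume a: "a \<in> e_preimage l" and p: "p \<in> FA (bmw_gens l)"
    obtain d where d: "a \<in> FA (bmw_gens l)" "d \<in> L.zs (e_span l)" "cls a = cmp d B" using a by (auto simp: e_preimage_def)
    obtain x where x: "x \<in> L.H l" "cmp x B = cls p" using FA_H[OF l p] by blast
    have "x * d \<in> L.zs (e_span l)" using d(2)
    proof (rule L.zs_lmult)
      fix a assume "a \<in> e_span l"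
      then obtain u b v where "a = u * lgen (GE b) * v" "u \<in> L.H l" "v \<in> L.H l" "1 \<le> b" "b < l" by (auto simp: e_span_def)
      then have "x * a = (x * u) * lgen (GE b) * v" "x * u \<in> L.H l" using x L.H_ring(3) by (auto simp: mult.assoc)
      then show "x * a \<in> L.zs (e_span l)" unfolding e_span_def using \<open>v \<in> L.H l\<close> \<open>1 \<le> b\<close> \<open>b < l\<close> by (intro zspan_base) blast
    qed
    moreover have "d * x \<in> L.zs (e_span l)" using d(2)
    proof (rule L.zs_rmult)
      fix a assume "a \<in> e_span l"
      then obtain u b v where "a = u * lgen (GE b) * v" "u \<in> L.H l" "v \<in> L.H l" "1 \<le> b" "b < l" by (auto simp: e_span_def)
      then have "a * x = u * lgen (GE b) * (v * x)" "v * x \<in> L.H l" using x L.H_ring(3) by (auto simp: mult.assoc)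
      then show "a * x \<in> L.zs (e_span l)" unfolding e_span_def using \<open>u \<in> L.H l\<close> \<open>1 \<le> b\<close> \<open>b < l\<close> by (intro zspan_base) blast
    qed
    moreover have "cls (p * a) = cmp (x * d) B" "cls (a * p) = cmp (d * x) B"
      using cmp_cls_mult[of x p d a] cmp_cls_mult[of d a x p] x d FA_n[OF p l] FA_n[OF d(1) l] by auto
    ultimately show "p * a \<in> e_preimage l" "a * p \<in> e_preimage l" unfolding e_preimage_def using FA_mult p d(1) by blast+
  qed (auto simp: e_preimage_def)
  show "a - b \<in> e_preimage l" if ab: "(a, b) \<in> bmw_rels l P"
  proof -
    have F: "a - b \<in> FA (bmw_gens l)" using Bl.rels_FA[OF ab] FA_diff by blast
    have "a - b - 0 \<in> pres.I" using pres.I_rel bmw_rels_mono[OF l] ab by auto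
    then have "cls (a - b) = cls 0" using pres.cls_eq[OF FA_n[OF F l] FA_0] by simp
    then show ?thesis unfolding e_preimage_def using F 0 zspan_zero by fastforce
  qed
  show "fgen (GE i) \<in> e_preimage l" if i: "1 \<le> i" "i < l"
  proof -
    have "lgen (GE i) = 1 * lgen (GE i) * 1" by simp
    then have "lgen (GE i) \<in> e_span l" unfolding e_span_def using i L.H_ring(1) by blast
    moreover have "cls (fgen (GE i)) = cmp (lgen (GE i)) B" using cmp_rep[OF rep_gens(5)[of i]] i l by simp
    moreover have "fgen (GE i) \<in> FA (bmw_gens l)" using i by (intro FA_fgen) (auto simp: bmw_gens_def)
    ultimately show ?thesis unfolding e_preimage_def using zspan_base by blast
  qed
qed

text \<open>The image of \<open>x\<close> in the Ariki-Koike algebra is a combination of the basis;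
  the same combination of the chosen preimages differs from \<open>x\<close> by an element of the
  kernel, which by \<open>ak_kernel\<close> is a combination of products containing a cap.\<close>

lemma Wspan:
  assumes l: "l \<le> n" and Wb: "is_basis (ak l P) W" "Wb \<subseteq> carrier (bmw l P)" "ak_proj l P ` Wb = W" and x: "x \<in> L.H l"
  shows "\<exists>w\<in>L.zs {x \<in> L.H l. cmp x B \<in> bmw_incl n P ` Wb}. \<exists>d\<in>L.zs (e_span l). eps * x = eps * w + eps * d"
proof -
  interpret Bl: presentation "bmw_gens l" "bmw_rels l P" by (rule bmw_presentation)
  interpret A: ak_setup l P "par_q P" "unit_inv (par_q P)"
    using unit_inv[of "par_q P"] valid by unfold_locales (auto simp: valid_params_def)
  let ?im = "subst_gens (ak_image P)"
  obtain p where p: "p \<in> FA (bmw_gens l)" "cmp x B = cls p" using H_FA[OF l x] by blast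
  have ipF: "?im r \<in> FA (ak_gens l)" if "r \<in> FA (bmw_gens l)" for r
    by (rule subst_FA[OF that A.ak_image_FA])
  have "A.A.cls (?im p) \<in> lin_span (ak l P) W"
    using Wb(1) A.A.cls_closed[OF ipF[OF p(1)]] by (simp add: is_basis_def ak_def)
  then obtain F c where F: "finite F" "F \<subseteq> W" "A.A.cls (?im p) = (\<Oplus>\<^bsub>A.A.B\<^esub>w\<in>F. c w \<odot>\<^bsub>A.A.B\<^esub> w)"
    by (auto simp: lin_span_def ak_def)
  have "\<forall>w\<in>F. \<exists>r\<in>FA (bmw_gens l). Bl.cls r \<in> Wb \<and> w = A.A.cls (?im r)"
  proof
    fix w assume "w \<in> F"
    then obtain b where b: "b \<in> Wb" "w = ak_proj l P b" using F(2) Wb(3) by blast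
    then obtain r where r: "r \<in> FA (bmw_gens l)" "b = Bl.cls r" using Wb(2) Bl.carrier_B by (auto simp: bmw_def)
    then show "\<exists>r\<in>FA (bmw_gens l). Bl.cls r \<in> Wb \<and> w = A.A.cls (?im r)" using b A.ak_proj_cls[OF r(1)] by blast
  qed
  then obtain r where r: "\<And>w. w \<in> F \<Longrightarrow> r w \<in> FA (bmw_gens l) \<and> Bl.cls (r w) \<in> Wb \<and> w = A.A.cls (?im (r w))" by metis
  define p' where "p' = (\<Sum>w\<in>F. fconst (c w) * r w)"
  have p': "p' \<in> FA (bmw_gens l)" unfolding p'_def using r by (intro FA_sum FA_mult FA_fconst) auto
  have "A.A.cls (?im p) = (\<Oplus>\<^bsub>A.A.B\<^esub>w\<in>F. A.A.cls (fconst (c w) * ?im (r w)))"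
    unfolding F(3)
  proof (rule abelian_monoid.finsum_cong'[OF abelian_group.axioms(1)[OF ring.is_abelian_group[OF A.A.B_ring]]])
    show "(\<lambda>w. A.A.cls (fconst (c w) * ?im (r w))) \<in> F \<rightarrow> carrier A.A.B"
      using r ipF by (auto intro!: A.A.cls_closed FA_mult FA_fconst)
    fix w assume w: "w \<in> F"
    have "c w \<odot>\<^bsub>A.A.B\<^esub> w = c w \<odot>\<^bsub>A.A.B\<^esub> A.A.cls (?im (r w))" using r[OF w] by metis
    then show "c w \<odot>\<^bsub>A.A.B\<^esub> w = A.A.cls (fconst (c w) * ?im (r w))" using A.A.cls_smult ipF r[OF w] by metis
  qed simp
  also have "\<dots> = A.A.cls (\<Sum>w\<in>F. fconst (c w) * ?im (r w))"
    using F(1) r ipF by (intro A.A.cls_sum) (auto intro!: FA_mult FA_fconst)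
  also have "(\<Sum>w\<in>F. fconst (c w) * ?im (r w)) = ?im p'" by (simp add: p'_def subst_sum subst_mult)
  finally have "?im (p - p') \<in> A.A.I" using A.A.cls_eq[OF ipF[OF p(1)] ipF[OF p']] by (simp add: subst_diff)
  then have "p - p' \<in> e_preimage l" by (intro A.ak_kernel[OF e_preimage[OF l] FA_diff[OF p(1) p']])
  then obtain d where d: "d \<in> L.zs (e_span l)" "cls (p - p') = cmp d B" by (auto simp: e_preimage_def)
  have "\<forall>w\<in>F. \<exists>x\<in>L.H l. cmp x B = cls (r w)" using FA_H[OF l] r by blast
  then obtain h where h: "\<And>w. w \<in> F \<Longrightarrow> h w \<in> L.H l \<and> cmp (h w) B = cls (r w)" by metis
  define om where "om = (\<Sum>w\<in>F. lconst (c w) * h w)"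
  have "om \<in> L.zs {x \<in> L.H l. cmp x B \<in> bmw_incl n P ` Wb}" unfolding om_def
  proof (rule L.zs_sum, rule zspan_scale[OF rep_lscalars[OF rep_lconst]], rule zspan_base)
    fix w assume w: "w \<in> F"
    have "cmp (h w) B = bmw_incl n P (Bl.cls (r w))" using incl_cls[OF l, of "r w"] r[OF w] h[OF w] by simp
    then show "h w \<in> {x \<in> L.H l. cmp x B \<in> bmw_incl n P ` Wb}" using r[OF w] h[OF w] by blast
  qed
  moreover have om: "cmp om B = cls p'" unfolding om_def p'_def
  proof (rule cmp_sum[OF F(1)])
    fix w assume w: "w \<in> F"
    have "r w \<in> FA (bmw_gens n)" using FA_n[OF _ l] r[OF w] by blast
    then show "cmp (lconst (c w) * h w) B = cls (fconst (c w) * r w) \<and> fconst (c w) * r w \<in> FA (bmw_gens n)"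
      using cmp_cls_mult[OF cmp_rep[OF rep_lconst]] h[OF w] FA_fconst FA_mult by blast
  qed
  have "cmp (om + d) B = cls (p' + (p - p'))"
    by (rule cmp_cls_add[OF om d(2)[symmetric] FA_n[OF p' l] FA_n[OF FA_diff[OF p(1) p'] l]])
  then have "cmp x B = cmp (om + d) B" using p(2) by simp
  then have "eps * x = eps * om + eps * d" using eps_eq[of x "om + d"] by (simp add: distrib_left)
  ultimately show ?thesis using d(1) by blast
qed

section \<open>Linear spans in the presented module\<close>

definition sel where "sel t = (SOME p. p \<in> FA (bmw_gens n) \<and> cls p = t)"

lemma sel: "t \<in> carrier B \<Longrightarrow> sel t \<in> FA (bmw_gens n) \<and> cls (sel t) = t"
  unfolding sel_def by (rule someI_ex) (auto simp: pres.carrier_B)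

text \<open>Chosen representatives turn sums in the module into classes of sums in the free algebra,
  where coefficients can be handled with type class arithmetic.\<close>

lemma lin_span_iff:
  assumes "T \<subseteq> carrier B"
  shows "v \<in> lin_span B T \<longleftrightarrow> (\<exists>F c. finite F \<and> F \<subseteq> T \<and> v = cls (\<Sum>x\<in>F. fconst (c x) * sel x))"
proof -
  have "(\<Oplus>\<^bsub>B\<^esub>x\<in>F. c x \<odot>\<^bsub>B\<^esub> x) = cls (\<Sum>x\<in>F. fconst (c x) * sel x)" if F: "finite F" "F \<subseteq> T" for F c
  proof -
    have s: "sel x \<in> FA (bmw_gens n)" "cls (sel x) = x" if "x \<in> F" for x using sel that F assms by blast+
    have "(\<Oplus>\<^bsub>B\<^esub>x\<in>F. c x \<odot>\<^bsub>B\<^esub> x) = (\<Oplus>\<^bsub>B\<^esub>x\<in>F. cls (fconst (c x) * sel x))"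
    proof (rule abelian_monoid.finsum_cong'[OF abelian_group.axioms(1)[OF ring.is_abelian_group[OF B_ring]]])
      show "(\<lambda>x. cls (fconst (c x) * sel x)) \<in> F \<rightarrow> carrier B"
        using s by (auto intro!: pres.cls_closed FA_mult FA_fconst)
      fix x assume x: "x \<in> F"
      show "c x \<odot>\<^bsub>B\<^esub> x = cls (fconst (c x) * sel x)" using pres.cls_smult[OF s(1)[OF x], of "c x"] s(2)[OF x] by simp
    qed simp
    also have "\<dots> = cls (\<Sum>x\<in>F. fconst (c x) * sel x)"
      using s F(1) by (intro pres.cls_sum) (auto intro!: FA_mult FA_fconst)
    finally show ?thesis .
  qed
  then show ?thesis unfolding lin_span_def mem_Collect_eq by (intro ex_cong1) auto
qed

lemma lin_span_carrier: "T \<subseteq> carrier B \<Longrightarrow> lin_span B T \<subseteq> carrier B"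
  using sel by (auto simp: lin_span_iff subset_iff intro!: pres.cls_closed FA_sum FA_mult FA_fconst)

lemma zspan_lin_span:
  assumes "y \<in> L.zs A" shows "cmp y B \<in> lin_span B ((\<lambda>a. cmp a B) ` A)"
proof -
  let ?T = "(\<lambda>a. cmp a B) ` A"
  have T: "?T \<subseteq> carrier B" using cmp_closed[OF B_ring] by blast
  have sF: "(\<Sum>x\<in>F. fconst (c x) * sel x) \<in> FA (bmw_gens n)" if "F \<subseteq> ?T" for F c
    using sel T that by (intro FA_sum FA_mult FA_fconst) blast
  show ?thesis using assms unfolding lin_span_iff[OF T]
  proof (induction rule: zspan.induct)
    case zspan_zero
    show ?case using cmp_rep[OF rep_0] by (intro exI[of _ "{}"]) simp
  next
    case (zspan_base a)
    then have "cmp a B \<in> carrier B" using T by blast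
    then show ?case using sel[of "cmp a B"] zspan_base by (intro exI[of _ "{cmp a B}"] exI[of _ "\<lambda>_. 1"]) auto
  next
    case (zspan_add x y)
    from zspan_add.IH(1) obtain F c where 1: "finite F" "F \<subseteq> ?T" "cmp x B = cls (\<Sum>x\<in>F. fconst (c x) * sel x)"
      by (elim exE conjE)
    from zspan_add.IH(2) obtain F' c' where 2: "finite F'" "F' \<subseteq> ?T" "cmp y B = cls (\<Sum>x\<in>F'. fconst (c' x) * sel x)"
      by (elim exE conjE)
    note * = 1 2
    \<comment> \<open>A span element has one coefficient for each vector, so on the union of the two
      supports both coefficient functions are extended by 0 and added.\<close>
    let ?c = "\<lambda>x. (if x \<in> F then c x else 0) + (if x \<in> F' then c' x else 0)"
    have "(\<Sum>x\<in>F \<union> F'. fconst (?c x) * sel x) = (\<Sum>x\<in>F \<union> F'. fconst (if x \<in> F then c x else 0) * sel x) + (\<Sum>x\<in>F \<union> F'. fconst (if x \<in> F' then c' x else 0) * sel x)"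
      by (simp add: fconst_add distrib_right sum.distrib)
    also have "(\<Sum>x\<in>F \<union> F'. fconst (if x \<in> F then c x else 0) * sel x) = (\<Sum>x\<in>F. fconst (c x) * sel x)"
      using *(1,4) by (intro sum.mono_neutral_cong_right) auto
    also have "(\<Sum>x\<in>F \<union> F'. fconst (if x \<in> F' then c' x else 0) * sel x) = (\<Sum>x\<in>F'. fconst (c' x) * sel x)"
      using *(1,4) by (intro sum.mono_neutral_cong_right) auto
    finally have "cmp (x + y) B = cls (\<Sum>x\<in>F \<union> F'. fconst (?c x) * sel x)"
      using cmp_cls_add[OF *(3,6) sF[OF *(2)] sF[OF *(5)]] by simp
    then show ?case using * by (intro exI[of _ "F \<union> F'"] exI[of _ ?c]) blast
  next
    case (zspan_scale z x)
    then obtain F c where *: "finite F" "F \<subseteq> ?T" "cmp x B = cls (\<Sum>x\<in>F. fconst (c x) * sel x)" by blast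
    obtain a where a: "cmp z B = cls (fconst a)" using zspan_scale(1) by (auto simp: lscalars_def)
    have "cmp (z * x) B = cls (\<Sum>x\<in>F. fconst (a * c x) * sel x)"
      using cmp_cls_mult[OF a *(3) FA_fconst sF[OF *(2)]] by (simp add: sum_distrib_left fconst_merge)
    then show ?case using * by (intro exI[of _ F] exI[of _ "\<lambda>x. a * c x"]) blast
  qed
qed

lemma cmp_elt: "g \<in> bmw_gens n \<Longrightarrow> cmp (lgen g) B = bmw_elt n P g"
  using cmp_rep[OF rep_lgen] by (simp add: bmw_elt_def)

lemma cmp_mprod: "cmp (prod_list xs) B = mprod B (map (\<lambda>x. cmp x B) xs)"
  by (rule cmp_prod_list[OF B_ring])

lemma cmp_power: "cmp (x ^ m) B = cmp x B [^]\<^bsub>B\<^esub> m"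
proof (induction m)
  case 0 then show ?case using B_ring by (simp add: cmp_simps)
next
  case (Suc m)
  then show ?case using B_ring by (simp add: power_Suc2 cmp_simps del: power_Suc)
qed

text \<open>A negative integer power in the module is the inverse of a natural power, whereas
  \<open>yp\<close> uses powers of the explicit inverse \<open>yi\<close>; uniqueness of inverses
  identifies the two.\<close>

lemma cmp_yp:
  assumes "1 \<le> i" "i \<le> n" shows "cmp (L.yp i c) B = bmw_Yp n P i [^]\<^bsub>B\<^esub> c"
proof -
  interpret Br: ring B by (rule B_ring)
  have Y: "cmp (L.y i) B = bmw_Yp n P i"
    using assms unfolding L.y_prod[OF assms(1)] cmp_mprod bmw_Yp_def bmw_def
    by (auto simp: cmp_elt gens_mem intro!: arg_cong[where f = "mprod B"])
  show ?thesis
  proof (cases "0 \<le> c")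
    case True
    then have "L.yp i c = L.y i ^ nat c" by (simp add: L.yp_def zpw_def)
    then show ?thesis using True by (simp only: int_pow_def2 cmp_power Y not_less[symmetric] if_False)
  next
    case False
    define m where "m = nat (- c)"
    have "L.y i ^ m * L.yi i ^ m = 1" "L.yi i ^ m * L.y i ^ m = 1"
      using zpw_add[of "L.y i" "L.yi i" "int m" "- int m"] zpw_add[of "L.y i" "L.yi i" "- int m" "int m"] L.y_inv[of i] assms
      by (simp_all add: zpw_of_nat zpw_minus_of_nat)
    then have "cmp (L.y i ^ m) B \<otimes>\<^bsub>B\<^esub> cmp (L.yi i ^ m) B = \<one>\<^bsub>B\<^esub>" "cmp (L.yi i ^ m) B \<otimes>\<^bsub>B\<^esub> cmp (L.y i ^ m) B = \<one>\<^bsub>B\<^esub>"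
      by (simp_all only: cmp_simps(2,4)[OF B_ring, symmetric])
    then have "inv\<^bsub>B\<^esub> (cmp (L.y i ^ m) B) = cmp (L.yi i ^ m) B"
      by (rule Br.inv_char[OF cmp_closed[OF B_ring] cmp_closed[OF B_ring]])
    then have "inv\<^bsub>B\<^esub> (bmw_Yp n P i [^]\<^bsub>B\<^esub> m) = cmp (L.yi i ^ m) B" unfolding cmp_power Y .
    moreover have "L.yp i c = L.yi i ^ m" using False by (simp add: L.yp_def zpw_def m_def)
    ultimately show ?thesis using False by (simp only: int_pow_def2 m_def if_True not_le)
  qed
qed

end

section \<open>Comparison with the words of the theorem\<close>

context bmw_lift
begin

text \<open>The proof counts by the largest generator index \<open>n - 1\<close>, the theorem by the
  number of strands. Both forms of the upper bound agree in truncated subtraction because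
  \<open>2 * m \<le> n\<close>.\<close>

lemma idx_bounds:
  assumes "L.idx (n - 1) f i j s" "2 * f \<le> n" "m \<in> set [1..<f + 1]"
  shows "1 \<le> i m" "i m \<le> n" "i m \<le> j m" "j m \<le> n - 2 * m + 1" "n - 1 + 2 - 2 * m = n - 2 * m + 1" "n - 2 * m + 1 < n"
  using assms n_pos by (auto simp: L.idx_def)

lemma cmp_ypl:
  assumes "L.idx (n - 1) f i j s" "2 * f \<le> n"
  shows "mprod B (map (\<lambda>m. bmw_Yp n P (i m) [^]\<^bsub>B\<^esub> s m) [1..<f + 1]) = cmp (prod_list (L.ypl f i s)) B"
    "mprod B (map (\<lambda>m. bmw_Yp n P (i m) [^]\<^bsub>B\<^esub> s m) (rev [1..<f + 1])) = cmp (prod_list (rev (L.ypl f i s))) B"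
  unfolding cmp_mprod L.ypl_def rev_map map_map comp_def
  using idx_bounds[OF assms] by (auto intro!: arg_cong[where f = "mprod B"] simp: cmp_yp simp del: upt_Suc)

lemma cmp_map_gens:
  assumes "\<And>a. a \<in> set xs \<Longrightarrow> 1 \<le> a \<and> a < n"
  shows "map (\<lambda>x. cmp x B) (map (\<lambda>a. lgen (GX a)) xs) = map (\<lambda>a. bmw_elt n P (GX a)) xs"
    "map (\<lambda>x. cmp x B) (map (\<lambda>a. lgen (GE a)) xs) = map (\<lambda>a. bmw_elt n P (GE a)) xs"
  using assms by (auto simp: cmp_elt gens_mem)

lemma cmp_ALl:
  assumes "L.idx (n - 1) f i j s" "2 * f \<le> n"
  shows "mprod B (map (\<lambda>m. mprod B (map (\<lambda>a. bmw_elt n P (GX a)) [i m..<j m] @ map (\<lambda>a. bmw_elt n P (GE a)) [j m..<n - 2 * m + 2])) [1..<f + 1])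
    = cmp (prod_list (L.ALl (n - 1) f i j)) B"
proof -
  have "cmp (L.AL (i m) (j m) (n - 1 + 2 - 2 * m)) B =
      mprod B (map (\<lambda>a. bmw_elt n P (GX a)) [i m..<j m] @ map (\<lambda>a. bmw_elt n P (GE a)) [j m..<n - 2 * m + 2])"
    if "m \<in> set [1..<f + 1]" for m
  proof -
    note b = idx_bounds[OF assms that]
    have "L.AL (i m) (j m) (n - 1 + 2 - 2 * m) = prod_list (map (\<lambda>a. lgen (GX a)) [i m..<j m] @ map (\<lambda>a. lgen (GE a)) [j m..<n - 2 * m + 2])"
      unfolding L.AL_def L.XP_def L.EP_def b(5) by simp
    then have "cmp (L.AL (i m) (j m) (n - 1 + 2 - 2 * m)) B =
        mprod B (map (\<lambda>x. cmp x B) (map (\<lambda>a. lgen (GX a)) [i m..<j m]) @ map (\<lambda>x. cmp x B) (map (\<lambda>a. lgen (GE a)) [j m..<n - 2 * m + 2]))"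
      by (simp only: cmp_mprod map_append)
    then show ?thesis using b by (subst (asm) cmp_map_gens(1), force, subst (asm) cmp_map_gens(2), force)
  qed
  then show ?thesis unfolding cmp_mprod L.ALl_def map_map comp_def by (auto intro!: arg_cong[where f = "mprod B"])
qed

lemma cmp_ALRl:
  assumes "L.idx (n - 1) f i j s" "2 * f \<le> n"
  shows "mprod B (map (\<lambda>m. mprod B (map (\<lambda>a. bmw_elt n P (GE a)) (rev [j m..<n - 2 * m + 2]) @ map (\<lambda>a. bmw_elt n P (GX a)) (rev [i m..<j m]))) (rev [1..<f + 1]))
    = cmp (prod_list (L.ALRl (n - 1) f i j)) B"
proof -
  have "cmp (L.ALR (i m) (j m) (n - 1 + 2 - 2 * m)) B =
      mprod B (map (\<lambda>a. bmw_elt n P (GE a)) (rev [j m..<n - 2 * m + 2]) @ map (\<lambda>a. bmw_elt n P (GX a)) (rev [i m..<j m]))"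
    if "m \<in> set [1..<f + 1]" for m
  proof -
    note b = idx_bounds[OF assms that]
    have "L.ALR (i m) (j m) (n - 1 + 2 - 2 * m) = prod_list (map (\<lambda>a. lgen (GE a)) (rev [j m..<n - 2 * m + 2]) @ map (\<lambda>a. lgen (GX a)) (rev [i m..<j m]))"
      unfolding L.ALR_def b(5) by simp
    then have "cmp (L.ALR (i m) (j m) (n - 1 + 2 - 2 * m)) B =
        mprod B (map (\<lambda>x. cmp x B) (map (\<lambda>a. lgen (GE a)) (rev [j m..<n - 2 * m + 2])) @ map (\<lambda>x. cmp x B) (map (\<lambda>a. lgen (GX a)) (rev [i m..<j m])))"
      by (simp only: cmp_mprod map_append)
    then show ?thesis using b by (subst (asm) cmp_map_gens(2), force, subst (asm) cmp_map_gens(1), force)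
  qed
  then show ?thesis unfolding cmp_mprod L.ALRl_def map_map comp_def by (auto intro!: arg_cong[where f = "mprod B"])
qed

lemma cmp_mult: "cmp (x * y) B = cmp x B \<otimes>\<^bsub>B\<^esub> cmp y B"
  by (rule cmp_simps(4)[OF B_ring])

lemma lin_span_mono: "S \<subseteq> T \<Longrightarrow> lin_span M S \<subseteq> lin_span M T"
  unfolding lin_span_def by blast

lemma bmw_lin_span:
  assumes W: "\<And>l. l \<le> n \<Longrightarrow> is_basis (ak l P) (W l)" and Wb: "\<And>l. l \<le> n \<Longrightarrow> Wbar l \<subseteq> carrier (bmw l P)"
    and pr: "\<And>l. l \<le> n \<Longrightarrow> ak_proj l P ` Wbar l = W l"
  shows "lin_span B
     {cmp (prod_list (L.ypl f i s)) B
      \<otimes>\<^bsub>B\<^esub> cmp (prod_list (L.ALl (n - 1) f i j)) B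
      \<otimes>\<^bsub>B\<^esub> chi
      \<otimes>\<^bsub>B\<^esub> cmp (prod_list (L.ALRl (n - 1) f g h)) B
      \<otimes>\<^bsub>B\<^esub> cmp (prod_list (rev (L.ypl f g t))) B
      | f i j g h s t chi. 2 * f \<le> n \<and> L.idx (n - 1) f i j s \<and> L.idx (n - 1) f g h t \<and> chi \<in> bmw_incl n P ` Wbar (n - 2 * f)}
    = carrier B" (is "lin_span B ?T = _")
proof -
  let ?WL = "\<lambda>l. {x \<in> L.H l. cmp x B \<in> bmw_incl n P ` Wbar l}"
  have chi: "\<exists>p\<in>FA (bmw_gens l). chi = cls p" if l: "l \<le> n" and c: "chi \<in> bmw_incl n P ` Wbar l" for chi l
  proof -
    interpret Bl: presentation "bmw_gens l" "bmw_rels l P" by (rule bmw_presentation)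
    obtain p where "p \<in> FA (bmw_gens l)" "chi = bmw_incl n P (Bl.cls p)"
      using c Wb[OF l] Bl.carrier_B by (auto simp: bmw_def)
    then show ?thesis using incl_cls[OF l] by blast
  qed
  interpret Br: ring B by (rule B_ring)
  have T: "?T \<subseteq> carrier B"
  proof
    fix x assume "x \<in> ?T"
    then obtain f i j g h s t chi where *: "x = cmp (prod_list (L.ypl f i s)) B
      \<otimes>\<^bsub>B\<^esub> cmp (prod_list (L.ALl (n - 1) f i j)) B \<otimes>\<^bsub>B\<^esub> chi
      \<otimes>\<^bsub>B\<^esub> cmp (prod_list (L.ALRl (n - 1) f g h)) B \<otimes>\<^bsub>B\<^esub> cmp (prod_list (rev (L.ypl f g t))) B"
      and "chi \<in> bmw_incl n P ` Wbar (n - 2 * f)" by blast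
    then obtain p where "p \<in> FA (bmw_gens (n - 2 * f))" "chi = cls p" using chi[of "n - 2 * f" chi] by auto
    then have "chi \<in> carrier B" using pres.cls_closed[OF FA_n[of p "n - 2 * f"]] by simp
    then show "x \<in> carrier B" unfolding * by (intro Br.m_closed cmp_closed[OF B_ring])
  qed
  moreover have "carrier B \<subseteq> lin_span B ?T"
  proof
    fix b assume "b \<in> carrier B"
    then obtain p where p: "p \<in> FA (bmw_gens n)" "b = cls p" using pres.carrier_B by auto
    then obtain x where x: "x \<in> L.H n" "cmp x B = b" using FA_H[OF order_refl p(1)] by blast
    have n: "n - 1 < n" "Suc (n - 1) = n" using n_pos by auto
    have "eps * x \<in> L.zs (L.diagrams ?WL (n - 1))"
    proof (rule L.spanning[OF n(1) eps_lscalars eps_idem])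
      fix l y assume l: "l \<le> Suc (n - 1)" and "y \<in> L.H l"
      then have "l \<le> n" using n by simp
      show "\<exists>w\<in>L.zs (?WL l). \<exists>d\<in>L.zs {u * lgen (GE a) * v |u a v. u \<in> L.H l \<and> v \<in> L.H l \<and> 1 \<le> a \<and> a < l}. eps * y = eps * w + eps * d"
        using Wspan[OF \<open>l \<le> n\<close> W[OF \<open>l \<le> n\<close>] Wb[OF \<open>l \<le> n\<close>] pr[OF \<open>l \<le> n\<close>] \<open>y \<in> L.H l\<close>] unfolding e_span_def .
    qed (use x n in simp)
    then have "cmp (eps * x) B \<in> lin_span B ((\<lambda>a. cmp a B) ` L.diagrams ?WL (n - 1))" by (rule zspan_lin_span)
    \<comment> \<open>At \<open>B\<close> the idempotent is 1, so restricting to this component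
      loses nothing.\<close>
    also have "cmp (eps * x) B = b"
    proof -
      have "cmp eps B = \<one>\<^bsub>B\<^esub>" using rep_eps cmp_rep[OF rep_1] cmp_simps(2)[OF B_ring] by (simp add: rep_def)
      then show ?thesis using x(2) \<open>b \<in> carrier B\<close> by (simp add: cmp_mult)
    qed
    also have "(\<lambda>a. cmp a B) ` L.diagrams ?WL (n - 1) \<subseteq> ?T"
    proof
      fix t assume "t \<in> (\<lambda>a. cmp a B) ` L.diagrams ?WL (n - 1)"
      then obtain f l w r where *: "t = cmp (l * (w * r)) B" "2 * f \<le> Suc (n - 1)" "l \<in> L.left_diagrams f (n - 1)"
        "w \<in> ?WL (Suc (n - 1) - 2 * f)" "r \<in> L.right_diagrams f (n - 1)" unfolding L.diagrams_def by blast
      obtain i j s where l: "l = prod_list (L.ypl f i s) * prod_list (L.ALl (n - 1) f i j)" "L.idx (n - 1) f i j s"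
        using *(3) unfolding L.left_diagrams_def by blast
      obtain g h u where r: "r = prod_list (L.ALRl (n - 1) f g h) * prod_list (rev (L.ypl f g u))" "L.idx (n - 1) f g h u"
        using *(5) unfolding L.right_diagrams_def by blast
      have "t = cmp (prod_list (L.ypl f i s)) B \<otimes>\<^bsub>B\<^esub> cmp (prod_list (L.ALl (n - 1) f i j)) B \<otimes>\<^bsub>B\<^esub> cmp w B
        \<otimes>\<^bsub>B\<^esub> cmp (prod_list (L.ALRl (n - 1) f g h)) B \<otimes>\<^bsub>B\<^esub> cmp (prod_list (rev (L.ypl f g u))) B"
        unfolding *(1) l(1) r(1) cmp_mult[symmetric] by (simp add: mult.assoc)
      moreover have "cmp w B \<in> bmw_incl n P ` Wbar (n - 2 * f)" "2 * f \<le> n" using *(2,4) n by auto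
      ultimately show "t \<in> ?T" using l(2) r(2) unfolding mem_Collect_eq
        by - (rule exI[of _ f], rule exI[of _ i], rule exI[of _ j], rule exI[of _ g], rule exI[of _ h],
            rule exI[of _ s], rule exI[of _ u], rule exI[of _ "cmp w B"], intro conjI)
    qed
    then have "lin_span B ((\<lambda>a. cmp a B) ` L.diagrams ?WL (n - 1)) \<subseteq> lin_span B ?T" by (rule lin_span_mono)
    finally show "b \<in> lin_span B ?T" .
  qed
  ultimately show ?thesis by (rule subset_antisym[OF lin_span_carrier])
qed

end

theorem theorem2p2:
  fixes n :: nat
    and P :: "'r::comm_ring_1 cyc_params"
    and W :: "nat \<Rightarrow> (ak_gen, 'r) free_alg set set"
    and Wbar :: "nat \<Rightarrow> (bmw_gen, 'r) free_alg set set"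
  defines "B \<equiv> bmw n P"
    and "X \<equiv> (\<lambda>i. bmw_elt n P (GX i))"
    and "e \<equiv> (\<lambda>i. bmw_elt n P (GE i))"
    and "Y' \<equiv> bmw_Yp n P"
    and "Wtilde \<equiv> (\<lambda>l. bmw_incl n P ` Wbar l)"
    and "S \<equiv> {int (par_k P div 2) - (int (par_k P) - 1)..int (par_k P div 2)}"
  assumes "n \<ge> 1" and "par_k P \<ge> 1"
    and "valid_params P"
    and "\<And>l. l \<le> n \<Longrightarrow> is_basis (ak l P) (W l)"
    and "\<And>l. l \<le> n \<Longrightarrow> Wbar l \<subseteq> carrier (bmw l P)"
    and "\<And>l. l \<le> n \<Longrightarrow> Wbar l \<approx> W l"
    and "\<And>l. l \<le> n \<Longrightarrow> ak_proj l P ` Wbar l = W l"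
  shows "lin_span B
     {mprod B (map (\<lambda>m. Y' (i m) [^]\<^bsub>B\<^esub> (s m :: int)) [1..<f + 1])
      \<otimes>\<^bsub>B\<^esub> mprod B (map (\<lambda>m. mprod B (map X [i m..<j m] @ map e [j m..<n - 2 * m + 2])) [1..<f + 1])
      \<otimes>\<^bsub>B\<^esub> chi
      \<otimes>\<^bsub>B\<^esub> mprod B (map (\<lambda>m. mprod B (map e (rev [h m..<n - 2 * m + 2]) @ map X (rev [g m..<h m])))
                (rev [1..<f + 1]))
      \<otimes>\<^bsub>B\<^esub> mprod B (map (\<lambda>m. Y' (g m) [^]\<^bsub>B\<^esub> (t m :: int)) (rev [1..<f + 1]))
      | f i j g h s t chi.
          f \<le> n div 2
        \<and> (\<forall>m m'. 1 \<le> m \<and> m < m' \<and> m' \<le> f \<longrightarrow> i m > i m' \<and> g m > g m')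
        \<and> (\<forall>m. 1 \<le> m \<and> m \<le> f \<longrightarrow>
              1 \<le> i m \<and> i m \<le> j m \<and> j m \<le> n - 2 * m + 1
            \<and> 1 \<le> g m \<and> g m \<le> h m \<and> h m \<le> n - 2 * m + 1
            \<and> s m \<in> S \<and> t m \<in> S)
        \<and> chi \<in> Wtilde (n - 2 * f)}
     = carrier B"
proof -
  interpret bmw_lift n P using assms(7-9) by unfold_locales auto
  have "L.S = S" unfolding S_def L.S_def ..
  \<comment> \<open>The theorem bounds the left and the right indices under common quantifiers; this
    separates the two halves into one \<open>idx\<close> condition each.\<close>
  then have idx: "(\<forall>m m'. 1 \<le> m \<and> m < m' \<and> m' \<le> f \<longrightarrow> i m > i m' \<and> g m > g m')
        \<and> (\<forall>m. 1 \<le> m \<and> m \<le> f \<longrightarrow>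
              1 \<le> i m \<and> i m \<le> j m \<and> j m \<le> n - 2 * m + 1
            \<and> 1 \<le> g m \<and> g m \<le> h m \<and> h m \<le> n - 2 * m + 1
            \<and> s m \<in> S \<and> t m \<in> S) \<longleftrightarrow> L.idx (n - 1) f i j s \<and> L.idx (n - 1) f g h t"
    if "2 * f \<le> n" for f i j g h s t
  proof -
    have "n - 1 + 2 - 2 * m = n - 2 * m + 1" if "1 \<le> m" "m \<le> f" for m using that \<open>2 * f \<le> n\<close> by linarith
    then show ?thesis unfolding L.idx_def \<open>L.S = S\<close> by (smt (verit, best))
  qed
  have *: "mprod B (map (\<lambda>m. Y' (i m) [^]\<^bsub>B\<^esub> (s m :: int)) [1..<f + 1])
      \<otimes>\<^bsub>B\<^esub> mprod B (map (\<lambda>m. mprod B (map X [i m..<j m] @ map e [j m..<n - 2 * m + 2])) [1..<f + 1])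
      \<otimes>\<^bsub>B\<^esub> chi
      \<otimes>\<^bsub>B\<^esub> mprod B (map (\<lambda>m. mprod B (map e (rev [h m..<n - 2 * m + 2]) @ map X (rev [g m..<h m])))
                (rev [1..<f + 1]))
      \<otimes>\<^bsub>B\<^esub> mprod B (map (\<lambda>m. Y' (g m) [^]\<^bsub>B\<^esub> (t m :: int)) (rev [1..<f + 1]))
    = cmp (prod_list (L.ypl f i s)) B
      \<otimes>\<^bsub>B\<^esub> cmp (prod_list (L.ALl (n - 1) f i j)) B
      \<otimes>\<^bsub>B\<^esub> chi
      \<otimes>\<^bsub>B\<^esub> cmp (prod_list (L.ALRl (n - 1) f g h)) B
      \<otimes>\<^bsub>B\<^esub> cmp (prod_list (rev (L.ypl f g t))) B"
    if "2 * f \<le> n" "L.idx (n - 1) f i j s" "L.idx (n - 1) f g h t" for f i j g h s t chi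
    unfolding B_def bmw_def X_def e_def Y'_def
    by (simp only: cmp_ypl[OF that(2,1)] cmp_ypl[OF that(3,1)] cmp_ALl[OF that(2,1)] cmp_ALRl[OF that(3,1)])
  have f: "f \<le> n div 2 \<longleftrightarrow> 2 * f \<le> n" for f by auto
  have B: "presented_alg (bmw_gens n) (bmw_rels n P) = B" by (simp add: B_def bmw_def)
  show ?thesis
  proof (rule trans[OF _ bmw_lin_span[OF assms(10,11,13), unfolded B]], rule arg_cong[where f = "lin_span B"], rule Collect_cong, intro ex_cong1)
    fix x f i j g h s t chi
    let ?C = "L.idx (n - 1) f i j s \<and> L.idx (n - 1) f g h t"
    show "(x = mprod B (map (\<lambda>m. Y' (i m) [^]\<^bsub>B\<^esub> (s m :: int)) [1..<f + 1])
      \<otimes>\<^bsub>B\<^esub> mprod B (map (\<lambda>m. mprod B (map X [i m..<j m] @ map e [j m..<n - 2 * m + 2])) [1..<f + 1])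
      \<otimes>\<^bsub>B\<^esub> chi
      \<otimes>\<^bsub>B\<^esub> mprod B (map (\<lambda>m. mprod B (map e (rev [h m..<n - 2 * m + 2]) @ map X (rev [g m..<h m])))
                (rev [1..<f + 1]))
      \<otimes>\<^bsub>B\<^esub> mprod B (map (\<lambda>m. Y' (g m) [^]\<^bsub>B\<^esub> (t m :: int)) (rev [1..<f + 1]))
      \<and> f \<le> n div 2
        \<and> (\<forall>m m'. 1 \<le> m \<and> m < m' \<and> m' \<le> f \<longrightarrow> i m > i m' \<and> g m > g m')
        \<and> (\<forall>m. 1 \<le> m \<and> m \<le> f \<longrightarrow>
              1 \<le> i m \<and> i m \<le> j m \<and> j m \<le> n - 2 * m + 1
            \<and> 1 \<le> g m \<and> g m \<le> h m \<and> h m \<le> n - 2 * m + 1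
            \<and> s m \<in> S \<and> t m \<in> S)
        \<and> chi \<in> Wtilde (n - 2 * f)) \<longleftrightarrow>
      (x = cmp (prod_list (L.ypl f i s)) B
      \<otimes>\<^bsub>B\<^esub> cmp (prod_list (L.ALl (n - 1) f i j)) B
      \<otimes>\<^bsub>B\<^esub> chi
      \<otimes>\<^bsub>B\<^esub> cmp (prod_list (L.ALRl (n - 1) f g h)) B
      \<otimes>\<^bsub>B\<^esub> cmp (prod_list (rev (L.ypl f g t))) B
      \<and> 2 * f \<le> n \<and> L.idx (n - 1) f i j s \<and> L.idx (n - 1) f g h t \<and> chi \<in> bmw_incl n P ` Wbar (n - 2 * f))"
      (is "_ = ?l1 \<and> _ \<and> ?c1 \<and> ?c2 \<and> _ \<longleftrightarrow> _ = ?l2 \<and> _ \<and> ?c3 \<and> ?c4 \<and> _")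
    proof -
      have "?c1 \<and> ?c2 \<longleftrightarrow> ?c3 \<and> ?c4" if "2 * f \<le> n" by (rule idx[OF that])
      moreover have "?l1 = ?l2" if "2 * f \<le> n" ?c3 ?c4 by (rule *[OF that])
      moreover have "chi \<in> Wtilde (n - 2 * f) \<longleftrightarrow> chi \<in> bmw_incl n P ` Wbar (n - 2 * f)" unfolding Wtilde_def ..
      ultimately show ?thesis unfolding f by argo
    qed
  qed
qed

end
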